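(* In neutral constructive geometry (with intuitionistic logic), the strong parallel postulate is equivalent to the conjunction of Playfair's axiom and the statement: if $L$ and $M$ are non-coincident, non-parallel lines, then $M$ meets $L$ (i.e. there is a point on both).
   Context: Logic is intuitionistic. Neutral constructive geometry means constructive plane geometry without any parallel postulate. Primitives: points, strict betweenness $B(a,b,c)$, segment congruence $ab=cd$; $T(a,b,c)$ abbreviates $\neg(a\neq b\wedge b\neq c\wedge\neg B(a,b,c))$. For $a\neq b$, a point $x$ lies on $\mathrm{Line}(a,b)$ iff $\neg\neg(B(a,b,x)\vee B(b,x,a)\vee B(x,a,b)\vee x=a\vee x=b)$; every line is given by two distinct points. Points are collinear if they lie on a common line. A circle is given by a center and a radius segment (possibly null). $ab\le cd$ means $\exists e\,(T(c,e,d)\wedge ab=ce)$. No particular axiomatization is prescribed; the principles used are: (1) Stability: $\neg\neg A\to A$ for $A$ an equality, betweenness or congruence. (2) $ab=ba$; $ab=pq\wedge ab=rs\to pq=rs$; $ab=cc\to a=b$. (3) Extension: if $a\neq b$ then for all $c,d$ there is $x$ with $T(a,b,x)$ and $bx=cd$. (4) Five-segment axiom: if $a\neq b$, $T(a,b,c)$, $T(a',b',c')$, $ab=a'b'$, $bc=b'c'$, $ad=a'd'$, $bd=b'd'$ then $cd=c'd'$. (5) $B(a,b,c)$ implies $B(c,b,a)$, $a\ne b$, $b\neq c$; $\neg B(a,b,a)$; $T(a,b,d)\wedge T(b,c,d)\to T(a,b,c)\wedge T(a,c,d)$; $T(a,b,c)\wedge T(b,c,d)\wedge b\neq c\to T(a,c,d)\wedge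 T(a,b,d)$; $B(a,b,c)\wedge B(a,b,d)\wedge\neg T(a,c,d)\to T(a,d,c)$. (6) Inner Pasch: if $a,b,c$ are not collinear, $B(a,p,c)$ and $B(b,q,c)$, there is $x$ with $B(p,x,b)$ and $B(q,x,a)$. (7) There are three non-collinear points; any three points each equidistant from two given distinct points are collinear. (8) Line-circle continuity: if $a\ne b$, $a$ is non-strictly inside a circle and $b$ non-strictly outside it, then the circle contains a point $x$ with $T(a,x,b)$. Circle-circle continuity: if two circles have distinct centers and the first has a point non-strictly inside and a point non-strictly outside the second, they have a common point. Two lines are parallel if they have no common point (plane geometry). Lines coincide if they have the same points. Strong parallel postulate: for all points $p,q,r,s,t,a$, if $B(p,t,q)$, $B(s,t,r)$, $pt=qt$, $rt=st$, $p\neq r$, $p$ is not on $\mathrm{Line}(s,q)$, and $a$ is not on $\mathrm{Line}(p,r)$, then there is a point on both $\mathrm{Line}(s,q)$ and $\mathrm{Line}(p,a)$. Playfair's axiom: if lines $K$ and $M$ are both parallel to line $L$, and a point $p$ lies on both $K$ and $M$, then $K$ and $M$ have the same points. *)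

theory Defs
  imports Main
begin

section \<open>Intuitionistic first-order logic with equality\<close>

text \<open>
  Isabelle/HOL is classical, so the geometry is given as a first-order theory inside an explicit
  intuitionistic natural deduction calculus. The language has one sort (points), the three
  primitive relations of the geometry, and no function symbols; hence the only terms are
  variables, represented by de Bruijn indices.
\<close>

datatype form =
    Eq nat nat
  | Bet nat nat nat           \<comment> \<open>strict betweenness \<open>B(a,b,c)\<close>\<close>
  | Cong nat nat nat nat      \<comment> \<open>\<open>Cong a b c d\<close> is \<open>ab = cd\<close>\<close>
  | Falsum
  | Conj form form  (infixr "\<^bold>\<and>" 35)
  | Disj form form  (infixr "\<^bold>\<or>" 30)
  | Imp form form   (infixr "\<^bold>\<longrightarrow>" 25)
  | Forall form
  | Exists form

abbreviation Neg :: "form \<Rightarrow> form"  ("\<^bold>\<not> _" [40] 40)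
  where "\<^bold>\<not> A \<equiv> A \<^bold>\<longrightarrow> Falsum"

abbreviation Iff :: "form \<Rightarrow> form \<Rightarrow> form"  (infixr "\<^bold>\<longleftrightarrow>" 25)
  where "A \<^bold>\<longleftrightarrow> B \<equiv> (A \<^bold>\<longrightarrow> B) \<^bold>\<and> (B \<^bold>\<longrightarrow> A)"

abbreviation Neq :: "nat \<Rightarrow> nat \<Rightarrow> form"
  where "Neq a b \<equiv> \<^bold>\<not> Eq a b"

primrec ren :: "(nat \<Rightarrow> nat) \<Rightarrow> form \<Rightarrow> form" where
  "ren f (Eq a b) = Eq (f a) (f b)"
| "ren f (Bet a b c) = Bet (f a) (f b) (f c)"
| "ren f (Cong a b c d) = Cong (f a) (f b) (f c) (f d)"
| "ren f Falsum = Falsum"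
| "ren f (A \<^bold>\<and> B) = (ren f A \<^bold>\<and> ren f B)"
| "ren f (A \<^bold>\<or> B) = (ren f A \<^bold>\<or> ren f B)"
| "ren f (A \<^bold>\<longrightarrow> B) = (ren f A \<^bold>\<longrightarrow> ren f B)"
| "ren f (Forall A) = Forall (ren (case_nat 0 (\<lambda>i. Suc (f i))) A)"
| "ren f (Exists A) = Exists (ren (case_nat 0 (\<lambda>i. Suc (f i))) A)"

text \<open>\<open>shift\<close> passes a formula under one additional quantifier; \<open>inst A t\<close> is the body \<open>A\<close> of a
  quantifier with the bound variable replaced by \<open>t\<close>.\<close>

abbreviation shift :: "form \<Rightarrow> form"
  where "shift \<equiv> ren Suc"

abbreviation inst :: "form \<Rightarrow> nat \<Rightarrow> form"
  where "inst A t \<equiv> ren (case_nat t (\<lambda>i. i)) A"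

inductive deriv :: "form set \<Rightarrow> form \<Rightarrow> bool"  (infix "\<turnstile>" 20) where
  assm: "A \<in> \<Gamma> \<Longrightarrow> \<Gamma> \<turnstile> A"
| falsumE: "\<Gamma> \<turnstile> Falsum \<Longrightarrow> \<Gamma> \<turnstile> A"
| conjI: "\<Gamma> \<turnstile> A \<Longrightarrow> \<Gamma> \<turnstile> B \<Longrightarrow> \<Gamma> \<turnstile> (A \<^bold>\<and> B)"
| conjE1: "\<Gamma> \<turnstile> (A \<^bold>\<and> B) \<Longrightarrow> \<Gamma> \<turnstile> A"
| conjE2: "\<Gamma> \<turnstile> (A \<^bold>\<and> B) \<Longrightarrow> \<Gamma> \<turnstile> B"
| disjI1: "\<Gamma> \<turnstile> A \<Longrightarrow> \<Gamma> \<turnstile> (A \<^bold>\<or> B)"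
| disjI2: "\<Gamma> \<turnstile> B \<Longrightarrow> \<Gamma> \<turnstile> (A \<^bold>\<or> B)"
| disjE: "\<Gamma> \<turnstile> (A \<^bold>\<or> B) \<Longrightarrow> insert A \<Gamma> \<turnstile> C \<Longrightarrow> insert B \<Gamma> \<turnstile> C \<Longrightarrow> \<Gamma> \<turnstile> C"
| impI: "insert A \<Gamma> \<turnstile> B \<Longrightarrow> \<Gamma> \<turnstile> (A \<^bold>\<longrightarrow> B)"
| impE: "\<Gamma> \<turnstile> (A \<^bold>\<longrightarrow> B) \<Longrightarrow> \<Gamma> \<turnstile> A \<Longrightarrow> \<Gamma> \<turnstile> B"
| forallI: "shift ` \<Gamma> \<turnstile> A \<Longrightarrow> \<Gamma> \<turnstile> Forall A"
| forallE: "\<Gamma> \<turnstile> Forall A \<Longrightarrow> \<Gamma> \<turnstile> inst A t"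
| existsI: "\<Gamma> \<turnstile> inst A t \<Longrightarrow> \<Gamma> \<turnstile> Exists A"
| existsE: "\<Gamma> \<turnstile> Exists A \<Longrightarrow> insert A (shift ` \<Gamma>) \<turnstile> shift C \<Longrightarrow> \<Gamma> \<turnstile> C"
| eq_refl: "\<Gamma> \<turnstile> Eq t t"
| eq_subst: "\<Gamma> \<turnstile> Eq s t \<Longrightarrow> \<Gamma> \<turnstile> inst A s \<Longrightarrow> \<Gamma> \<turnstile> inst A t"

text \<open>Universal closures. The matrix is given as a function of its variables, the first argument
  being the outermost quantifier. An \<open>Exists\<close> inside the matrix must use index \<open>0\<close> for its own
  variable and \<open>Suc x\<close> for an outer variable \<open>x\<close>.\<close>

definition forall2 :: "(nat \<Rightarrow> nat \<Rightarrow> form) \<Rightarrow> form"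
  where "forall2 F = Forall (Forall (F 1 0))"

definition forall3 :: "(nat \<Rightarrow> nat \<Rightarrow> nat \<Rightarrow> form) \<Rightarrow> form"
  where "forall3 F = Forall (forall2 (F 2))"

definition forall4 :: "(nat \<Rightarrow> nat \<Rightarrow> nat \<Rightarrow> nat \<Rightarrow> form) \<Rightarrow> form"
  where "forall4 F = Forall (forall3 (F 3))"

definition forall5 :: "(nat \<Rightarrow> nat \<Rightarrow> nat \<Rightarrow> nat \<Rightarrow> nat \<Rightarrow> form) \<Rightarrow> form"
  where "forall5 F = Forall (forall4 (F 4))"

definition forall6 :: "(nat \<Rightarrow> nat \<Rightarrow> nat \<Rightarrow> nat \<Rightarrow> nat \<Rightarrow> nat \<Rightarrow> form) \<Rightarrow> form"
  where "forall6 F = Forall (forall5 (F 5))"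

definition forall7 :: "(nat \<Rightarrow> nat \<Rightarrow> nat \<Rightarrow> nat \<Rightarrow> nat \<Rightarrow> nat \<Rightarrow> nat \<Rightarrow> form) \<Rightarrow> form"
  where "forall7 F = Forall (forall6 (F 6))"

definition forall8 :: "(nat \<Rightarrow> nat \<Rightarrow> nat \<Rightarrow> nat \<Rightarrow> nat \<Rightarrow> nat \<Rightarrow> nat \<Rightarrow> nat \<Rightarrow> form) \<Rightarrow> form"
  where "forall8 F = Forall (forall7 (F 7))"


section \<open>Geometric notions\<close>

definition T :: "nat \<Rightarrow> nat \<Rightarrow> nat \<Rightarrow> form" where
  "T a b c = (\<^bold>\<not> (Neq a b \<^bold>\<and> Neq b c \<^bold>\<and> \<^bold>\<not> Bet a b c))"

text \<open>\<open>on x a b\<close>: the point \<open>x\<close> lies on \<open>Line(a,b)\<close>, where \<open>a\<close> and \<open>b\<close> are distinct. A line is always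
  given by two points together with the hypothesis that they are distinct.\<close>

definition on :: "nat \<Rightarrow> nat \<Rightarrow> nat \<Rightarrow> form" where
  "on x a b = (\<^bold>\<not> \<^bold>\<not> (Bet a b x \<^bold>\<or> Bet b x a \<^bold>\<or> Bet x a b \<^bold>\<or> Eq x a \<^bold>\<or> Eq x b))"

definition collinear :: "nat \<Rightarrow> nat \<Rightarrow> nat \<Rightarrow> form" where
  "collinear a b c = Exists (Exists (Neq 1 0 \<^bold>\<and>
     on (Suc (Suc a)) 1 0 \<^bold>\<and> on (Suc (Suc b)) 1 0 \<^bold>\<and> on (Suc (Suc c)) 1 0))"

definition le :: "nat \<Rightarrow> nat \<Rightarrow> nat \<Rightarrow> nat \<Rightarrow> form" where
  "le a b c d = Exists (T (Suc c) 0 (Suc d) \<^bold>\<and> Cong (Suc a) (Suc b) (Suc c) 0)"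

text \<open>The circle with center \<open>c\<close> and radius segment \<open>pq\<close> (possibly null) consists of the points
  \<open>x\<close> with \<open>cx = pq\<close>; inside and outside are meant non-strictly.\<close>

definition on_circle :: "nat \<Rightarrow> nat \<Rightarrow> nat \<Rightarrow> nat \<Rightarrow> form" where
  "on_circle x c p q = Cong c x p q"

definition inside :: "nat \<Rightarrow> nat \<Rightarrow> nat \<Rightarrow> nat \<Rightarrow> form" where
  "inside x c p q = le c x p q"

definition outside :: "nat \<Rightarrow> nat \<Rightarrow> nat \<Rightarrow> nat \<Rightarrow> form" where
  "outside x c p q = le p q c x"

definition meets :: "nat \<Rightarrow> nat \<Rightarrow> nat \<Rightarrow> nat \<Rightarrow> form" where
  "meets a b c d = Exists (on 0 (Suc a) (Suc b) \<^bold>\<and> on 0 (Suc c) (Suc d))"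

definition parallel :: "nat \<Rightarrow> nat \<Rightarrow> nat \<Rightarrow> nat \<Rightarrow> form" where
  "parallel a b c d = (\<^bold>\<not> meets a b c d)"

definition coincide :: "nat \<Rightarrow> nat \<Rightarrow> nat \<Rightarrow> nat \<Rightarrow> form" where
  "coincide a b c d = Forall (on 0 (Suc a) (Suc b) \<^bold>\<longleftrightarrow> on 0 (Suc c) (Suc d))"


section \<open>Neutral constructive geometry\<close>

inductive_set neutral :: "form set" where
  stable_eq:
    "forall2 (\<lambda>a b. \<^bold>\<not> \<^bold>\<not> Eq a b \<^bold>\<longrightarrow> Eq a b) \<in> neutral"
| stable_bet:
    "forall3 (\<lambda>a b c. \<^bold>\<not> \<^bold>\<not> Bet a b c \<^bold>\<longrightarrow> Bet a b c) \<in> neutral"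
| stable_cong:
    "forall4 (\<lambda>a b c d. \<^bold>\<not> \<^bold>\<not> Cong a b c d \<^bold>\<longrightarrow> Cong a b c d) \<in> neutral"

| cong_swap:
    "forall2 (\<lambda>a b. Cong a b b a) \<in> neutral"
| cong_trans:
    "forall6 (\<lambda>a b p q r s. Cong a b p q \<^bold>\<and> Cong a b r s \<^bold>\<longrightarrow> Cong p q r s) \<in> neutral"
| cong_null:
    "forall3 (\<lambda>a b c. Cong a b c c \<^bold>\<longrightarrow> Eq a b) \<in> neutral"

| extension:
    "forall4 (\<lambda>a b c d. Neq a b \<^bold>\<longrightarrow>
       Exists (T (Suc a) (Suc b) 0 \<^bold>\<and> Cong (Suc b) 0 (Suc c) (Suc d))) \<in> neutral"

| five_segment:
    "forall8 (\<lambda>a b c d a' b' c' d'.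
       Neq a b \<^bold>\<and> T a b c \<^bold>\<and> T a' b' c' \<^bold>\<and> Cong a b a' b' \<^bold>\<and> Cong b c b' c' \<^bold>\<and>
       Cong a d a' d' \<^bold>\<and> Cong b d b' d' \<^bold>\<longrightarrow> Cong c d c' d') \<in> neutral"

| bet_sym:
    "forall3 (\<lambda>a b c. Bet a b c \<^bold>\<longrightarrow> Bet c b a \<^bold>\<and> Neq a b \<^bold>\<and> Neq b c) \<in> neutral"
| bet_irrefl:
    "forall2 (\<lambda>a b. \<^bold>\<not> Bet a b a) \<in> neutral"
| inner_trans:
    "forall4 (\<lambda>a b c d. T a b d \<^bold>\<and> T b c d \<^bold>\<longrightarrow> T a b c \<^bold>\<and> T a c d) \<in> neutral"
| outer_trans:
    "forall4 (\<lambda>a b c d. T a b c \<^bold>\<and> T b c d \<^bold>\<and> Neq b c \<^bold>\<longrightarrow> T a c d \<^bold>\<and> T a b d) \<in> neutral"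
| connectivity:
    "forall4 (\<lambda>a b c d. Bet a b c \<^bold>\<and> Bet a b d \<^bold>\<and> \<^bold>\<not> T a c d \<^bold>\<longrightarrow> T a d c) \<in> neutral"

| inner_pasch:
    "forall5 (\<lambda>a b c p q. \<^bold>\<not> collinear a b c \<^bold>\<and> Bet a p c \<^bold>\<and> Bet b q c \<^bold>\<longrightarrow>
       Exists (Bet (Suc p) 0 (Suc b) \<^bold>\<and> Bet (Suc q) 0 (Suc a))) \<in> neutral"

| lower_dim:
    "Exists (Exists (Exists (\<^bold>\<not> collinear 2 1 0))) \<in> neutral"
| upper_dim:
    "forall5 (\<lambda>p q x y z. Neq p q \<^bold>\<and> Cong x p x q \<^bold>\<and> Cong y p y q \<^bold>\<and> Cong z p z q \<^bold>\<longrightarrow>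
       collinear x y z) \<in> neutral"

| line_circle:
    "forall5 (\<lambda>a b c p q. Neq a b \<^bold>\<and> inside a c p q \<^bold>\<and> outside b c p q \<^bold>\<longrightarrow>
       Exists (T (Suc a) 0 (Suc b) \<^bold>\<and> on_circle 0 (Suc c) (Suc p) (Suc q))) \<in> neutral"
| circle_circle:
    "forall8 (\<lambda>c p q d r s x y. Neq c d \<^bold>\<and>
       on_circle x c p q \<^bold>\<and> inside x d r s \<^bold>\<and> on_circle y c p q \<^bold>\<and> outside y d r s \<^bold>\<longrightarrow>
       Exists (on_circle 0 (Suc c) (Suc p) (Suc q) \<^bold>\<and> on_circle 0 (Suc d) (Suc r) (Suc s)))
     \<in> neutral"


section \<open>Parallel axioms\<close>

text \<open>In \<open>strong_parallel\<close> the points defining each line are distinct: \<open>p \<noteq> r\<close> is assumed,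
  \<open>p \<noteq> a\<close> holds because \<open>a\<close> is not on \<open>Line(p,r)\<close>, and \<open>s = q\<close> would make \<open>p\<close> and \<open>r\<close> both
  the reflection of \<open>q\<close> in \<open>t\<close>.\<close>

definition strong_parallel :: form where
  "strong_parallel = forall6 (\<lambda>p q r s t a.
     Bet p t q \<^bold>\<and> Bet s t r \<^bold>\<and> Cong p t q t \<^bold>\<and> Cong r t s t \<^bold>\<and> Neq p r \<^bold>\<and>
     \<^bold>\<not> on p s q \<^bold>\<and> \<^bold>\<not> on a p r \<^bold>\<longrightarrow> meets s q p a)"

definition playfair :: form where
  "playfair = forall7 (\<lambda>k k' l l' m m' p.
     Neq k k' \<^bold>\<and> Neq l l' \<^bold>\<and> Neq m m' \<^bold>\<and> parallel k k' l l' \<^bold>\<and> parallel m m' l l' \<^bold>\<and>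
     on p k k' \<^bold>\<and> on p m m' \<^bold>\<longrightarrow> coincide k k' m m')"

definition nonparallel_meet :: form where
  "nonparallel_meet = forall4 (\<lambda>l l' m m'.
     Neq l l' \<^bold>\<and> Neq m m' \<^bold>\<and> \<^bold>\<not> coincide l l' m m' \<^bold>\<and> \<^bold>\<not> parallel l l' m m' \<^bold>\<longrightarrow>
     meets m m' l l')"

end

theory Submission
  imports Defs "HOL-Library.Countable_Set"
begin

text \<open>
  Almost all of the argument is classical geometry, carried out in ordinary Isabelle/HOL about
  structures with a strict betweenness and a congruence relation. What makes this legitimate for the
  intuitionistic calculus is a completeness theorem of Glivenko type, \<open>double_negation_completeness\<close>:
  if \<open>\<Gamma>\<close> consists of the neutral axioms and further hypotheses in finitely many variables, among them that two
  points are distinct, if universal quantifiers occur only positively in \<open>\<Gamma>\<close> and only negatively in \<open>\<phi>\<close>,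
  and if every classical structure satisfying \<open>\<Gamma>\<close> satisfies \<open>\<phi>\<close>, then \<open>\<Gamma>\<close> proves \<open>\<not>\<not>\<phi>\<close>
  intuitionistically. Its proof is a Henkin construction with intuitionistic provability. Since
  equality, betweenness and congruence are stable, \<open>\<not>\<not>\<phi>\<close> gives \<open>\<phi>\<close> whenever \<open>\<phi>\<close> contains no
  strictly positive disjunction or quantifier (\<open>stable_form_deriv\<close>). So negative assertions, such
  as distinctness, non-incidence, betweenness or congruence, may be checked classically, and only the
  existence of points has to be derived in the calculus, from axioms that assert existence.

  For two of the three implications this leaves next to nothing to derive. Playfair's axiom is a
  negative assertion, so the classical proof suffices: through a point outside a line, the strong
  parallel postulate makes every line other than the one obtained by point reflection meet the given
  line. Conversely, given the configuration of the strong parallel postulate, the lines \<open>Line(s,q)\<close>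
  and \<open>Line(p,a)\<close> are not coincident, and by Playfair's axiom they are not parallel, because
  \<open>Line(p,r)\<close> is parallel to \<open>Line(s,q)\<close> and does not contain \<open>a\<close>; then they meet by the second axiom.

  The constructive content lies in the remaining implication. Let \<open>L\<close> and \<open>M\<close> be non-coincident and
  not parallel. To apply the strong parallel postulate to \<open>M\<close> one needs a point of \<open>L\<close> that is
  definitely not on \<open>M\<close>, but it cannot be decided which of two given points of \<open>L\<close> has this
  property. The way out is an auxiliary line \<open>W\<close>, parallel to \<open>M\<close> and at a distance from \<open>M\<close> greater
  than that of \<open>M\<close> from a chosen point \<open>l\<close> of \<open>L\<close>: on a perpendicular to \<open>M\<close> at a point \<open>m\<close> take \<open>t\<close> with
  \<open>mt > ml\<close>, and let \<open>W\<close> be the image of \<open>M\<close> under reflection in \<open>t\<close>. Then \<open>l\<close> is not on \<open>W\<close>, wherever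
  \<open>l\<close> lies, because the hypotenuse of a right triangle is longer than its legs (\<open>leg_not_longer\<close>,
  \<open>far_parallel\<close>). A first application of the postulate, with the point \<open>l\<close> and the line \<open>W\<close>, gives a
  point \<open>p\<close> on \<open>L\<close> and \<open>W\<close>. This point is not on \<open>M\<close>, so a second application, with \<open>p\<close> and \<open>M\<close>, gives a
  point on \<open>L\<close> and \<open>M\<close>. The auxiliary points come from segment extension, circle-circle
  continuity and inner Pasch; the whole chain is \<open>meets_if_not_parallel\<close>.
\<close>

section \<open>Renaming and structural properties of the calculus\<close>

primrec fv :: "form \<Rightarrow> nat set" where
  "fv (Eq a b) = {a, b}"
| "fv (Bet a b c) = {a, b, c}"
| "fv (Cong a b c d) = {a, b, c, d}"
| "fv Falsum = {}"
| "fv (A \<^bold>\<and> B) = fv A \<union> fv B"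
| "fv (A \<^bold>\<or> B) = fv A \<union> fv B"
| "fv (A \<^bold>\<longrightarrow> B) = fv A \<union> fv B"
| "fv (Forall A) = {i. Suc i \<in> fv A}"
| "fv (Exists A) = {i. Suc i \<in> fv A}"

lemma ren_cong: "(\<And>i. i \<in> fv A \<Longrightarrow> f i = g i) \<Longrightarrow> ren f A = ren g A"
proof (induction A arbitrary: f g)
  case (Forall A)
  show ?case using Forall.prems by (auto intro!: Forall.IH split: nat.split)
next
  case (Exists A)
  show ?case using Exists.prems by (auto intro!: Exists.IH split: nat.split)
next
  case (Conj A B)
  show ?case using Conj.prems Conj.IH(1)[of f g] Conj.IH(2)[of f g] by simp
next
  case (Disj A B)
  show ?case using Disj.prems Disj.IH(1)[of f g] Disj.IH(2)[of f g] by simp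
next
  case (Imp A B)
  show ?case using Imp.prems Imp.IH(1)[of f g] Imp.IH(2)[of f g] by simp
qed auto

lemma up_comp: "(\<lambda>i. case_nat x (\<lambda>i. h (f i)) (case_nat 0 (\<lambda>i. Suc (g i)) i)) =
  case_nat x (\<lambda>i. h (f (g i)))"
  by (rule ext) (simp split: nat.split)

lemma ren_ren: "ren f (ren g A) = ren (\<lambda>i. f (g i)) A"
  by (induction A arbitrary: f g) (simp_all add: up_comp)

lemma ren_id: "ren (\<lambda>i. i) A = A"
proof -
  have [simp]: "case_nat 0 Suc = (\<lambda>i. i)" by (rule ext) (simp split: nat.split)
  show ?thesis by (induction A) simp_all
qed

lemma finite_fv: "finite (fv A)"
proof (induction A)
  case (Forall A)
  have "{i. Suc i \<in> fv A} = Suc -` fv A" by auto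
  thus ?case using finite_vimageI[OF Forall.IH, of Suc] by simp
next
  case (Exists A)
  have "{i. Suc i \<in> fv A} = Suc -` fv A" by auto
  thus ?case using finite_vimageI[OF Exists.IH, of Suc] by simp
qed auto

lemma ren_closed: "fv A = {} \<Longrightarrow> ren f A = A"
  using ren_cong[of A f "\<lambda>i. i"] by (simp add: ren_id)

lemma shift_closed: "(\<And>A. A \<in> \<Gamma> \<Longrightarrow> fv A = {}) \<Longrightarrow> shift ` \<Gamma> = \<Gamma>"
  using ren_closed by force

lemma shift_inst_comm: "ren f (inst A t) = inst (ren (case_nat 0 (\<lambda>i. Suc (f i))) A) (f t)"
  unfolding ren_ren by (rule ren_cong) (simp split: nat.split)

lemma shift_comm: "ren (case_nat 0 (\<lambda>i. Suc (f i))) (shift A) = shift (ren f A)"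
  unfolding ren_ren by simp

lemma deriv_weaken: "\<Gamma> \<turnstile> A \<Longrightarrow> \<Gamma> \<subseteq> \<Delta> \<Longrightarrow> \<Delta> \<turnstile> A"
proof (induction arbitrary: \<Delta> rule: deriv.induct)
  case (disjE \<Gamma> A B C)
  show ?case by (rule deriv.disjE[OF disjE.IH(1)[OF disjE.prems]]; rule disjE.IH; use disjE.prems in blast)
next
  case (impI A \<Gamma> B)
  show ?case by (rule deriv.impI, rule impI.IH) (use impI.prems in blast)
next
  case (forallI \<Gamma> A)
  show ?case by (rule deriv.forallI, rule forallI.IH) (use forallI.prems in blast)
next
  case (existsE \<Gamma> A C)
  show ?case by (rule deriv.existsE[OF existsE.IH(1)[OF existsE.prems]], rule existsE.IH)
    (use existsE.prems in blast)
qed (blast intro: deriv.intros)+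

lemma deriv_ren: "\<Gamma> \<turnstile> A \<Longrightarrow> ren f ` \<Gamma> \<turnstile> ren f A"
proof (induction arbitrary: f rule: deriv.induct)
  case (disjE \<Gamma> A B C)
  show ?case using deriv.disjE[of "ren f ` \<Gamma>" "ren f A" "ren f B" "ren f C"] disjE.IH[of f] by simp
next
  case (impI A \<Gamma> B)
  show ?case using deriv.impI impI.IH[of f] by simp
next
  case (impE \<Gamma> A B)
  show ?case using deriv.impE[of _ "ren f A"] impE.IH[of f] by simp
next
  case (forallI \<Gamma> A)
  show ?case using deriv.forallI forallI.IH[of "case_nat 0 (\<lambda>i. Suc (f i))"]
    by (simp add: image_image shift_comm)
next
  case (forallE \<Gamma> A t)
  show ?case unfolding shift_inst_comm using deriv.forallE forallE.IH[of f] by simp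
next
  case (existsI \<Gamma> A t)
  show ?case using deriv.existsI existsI.IH[of f] unfolding shift_inst_comm by simp
next
  case (existsE \<Gamma> A C)
  show ?case using deriv.existsE[of _ _ "ren f C"] existsE.IH(1)[of f]
      existsE.IH(2)[of "case_nat 0 (\<lambda>i. Suc (f i))"]
    by (simp add: image_image shift_comm)
next
  case (eq_subst \<Gamma> s t A)
  show ?case unfolding shift_inst_comm using deriv.eq_subst[of _ "f s" "f t"] eq_subst.IH[of f]
    unfolding shift_inst_comm by simp
qed (auto intro: deriv.intros)

text \<open>
  The renaming that sends the fresh variable to index \<open>0\<close> and shifts all others turns the
  derivation from the named witness into the premise that the de Bruijn rule asks for.
\<close>

lemma existsE_fresh:
  assumes ex: "\<Gamma> \<turnstile> Exists A" and d: "insert (inst A y) \<Gamma> \<turnstile> C"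
    and fresh: "\<And>B. B \<in> \<Gamma> \<Longrightarrow> y \<notin> fv B" "y \<notin> fv (Exists A)" "y \<notin> fv C"
  shows "\<Gamma> \<turnstile> C"
proof -
  define f where "f i = (if i = y then 0 else Suc i)" for i
  have sh: "ren f B = shift B" if "y \<notin> fv B" for B
    by (rule ren_cong) (use that in \<open>auto simp: f_def\<close>)
  have A: "ren f (inst A y) = A"
  proof -
    have "ren f (inst A y) = ren (\<lambda>i. i) A"
      unfolding ren_ren by (rule ren_cong) (use fresh(2) in \<open>auto simp: f_def split: nat.split\<close>)
    thus ?thesis by (simp add: ren_id)
  qed
  have "ren f ` \<Gamma> = shift ` \<Gamma>" using sh fresh(1) by (intro image_cong) auto
  hence "insert A (shift ` \<Gamma>) \<turnstile> shift C" using deriv_ren[OF d, of f] A sh[OF fresh(3)] by simp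
  thus ?thesis using deriv.existsE[OF ex] by blast
qed

lemma deriv_finite: "\<Gamma> \<turnstile> A \<Longrightarrow> \<exists>F \<subseteq> \<Gamma>. finite F \<and> (F \<turnstile> A)"
proof (induction rule: deriv.induct)
  case (assm A \<Gamma>)
  thus ?case by (intro exI[of _ "{A}"]) (auto intro: deriv.assm)
next
  case (conjI \<Gamma> A B)
  then obtain F G where "F \<subseteq> \<Gamma>" "finite F" "F \<turnstile> A" "G \<subseteq> \<Gamma>" "finite G" "G \<turnstile> B" by blast
  thus ?case by (intro exI[of _ "F \<union> G"]) (auto intro!: deriv.conjI intro: deriv_weaken)
next
  case (disjE \<Gamma> A B C)
  then obtain F G H where F: "F \<subseteq> \<Gamma>" "finite F" "F \<turnstile> (A \<^bold>\<or> B)" 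
    and G: "G \<subseteq> insert A \<Gamma>" "finite G" "G \<turnstile> C" and H: "H \<subseteq> insert B \<Gamma>" "finite H" "H \<turnstile> C" by blast
  have "F \<union> (G - {A}) \<union> (H - {B}) \<turnstile> C"
    by (rule deriv.disjE[OF deriv_weaken[OF F(3)] deriv_weaken[OF G(3)] deriv_weaken[OF H(3)]]) auto
  thus ?case using F G H by (intro exI[of _ "F \<union> (G - {A}) \<union> (H - {B})"]) auto
next
  case (impI A \<Gamma> B)
  then obtain G where G: "G \<subseteq> insert A \<Gamma>" "finite G" "G \<turnstile> B" by blast
  have "G - {A} \<turnstile> (A \<^bold>\<longrightarrow> B)" by (rule deriv.impI, rule deriv_weaken[OF G(3)]) auto
  thus ?case using G by (intro exI[of _ "G - {A}"]) auto
next
  case (impE \<Gamma> A B)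
  then obtain F G where "F \<subseteq> \<Gamma>" "finite F" "F \<turnstile> (A \<^bold>\<longrightarrow> B)" "G \<subseteq> \<Gamma>" "finite G" "G \<turnstile> A" by blast
  thus ?case by (intro exI[of _ "F \<union> G"]) (auto intro!: deriv.impE[of "F \<union> G" A B] intro: deriv_weaken)
next
  case (forallI \<Gamma> A)
  then obtain F where F: "F \<subseteq> shift ` \<Gamma>" "finite F" "F \<turnstile> A" by blast
  then obtain G where G: "G \<subseteq> \<Gamma>" "finite G" "F = shift ` G" by (meson finite_subset_image)
  thus ?case using F deriv.forallI by blast
next
  case (existsE \<Gamma> A C)
  then obtain F G where F: "F \<subseteq> \<Gamma>" "finite F" "F \<turnstile> Exists A" 
    and G: "G \<subseteq> insert A (shift ` \<Gamma>)" "finite G" "G \<turnstile> shift C" by blast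
  have "G - {A} \<subseteq> shift ` \<Gamma>" "finite (G - {A})" using G by auto
  then obtain H where H: "H \<subseteq> \<Gamma>" "finite H" "G - {A} = shift ` H" by (meson finite_subset_image)
  have "F \<union> H \<turnstile> C"
    by (rule deriv.existsE[OF deriv_weaken[OF F(3)] deriv_weaken[OF G(3)]]) (use H in auto)
  thus ?case using F H by (intro exI[of _ "F \<union> H"]) auto
next
  case (eq_subst \<Gamma> s t A)
  then obtain F G where "F \<subseteq> \<Gamma>" "finite F" "F \<turnstile> Eq s t" "G \<subseteq> \<Gamma>" "finite G" "G \<turnstile> inst A s" by blast
  thus ?case by (intro exI[of _ "F \<union> G"]) (auto intro!: deriv.eq_subst[of "F \<union> G" s t A] intro: deriv_weaken)
qed (blast intro: deriv.intros)+

lemma deriv_cut: "\<Gamma> \<turnstile> A \<Longrightarrow> insert A \<Gamma> \<turnstile> B \<Longrightarrow> \<Gamma> \<turnstile> B"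
  using deriv.impE[OF deriv.impI] by blast

section \<open>Classical structures and Henkin theories\<close>

text \<open>
  Equality is interpreted by an arbitrary relation \<open>E\<close>: the structure read off from a Henkin
  theory has the variables as points, and there derivable equality is only a congruence.
\<close>

primrec sat :: "('p \<Rightarrow> 'p \<Rightarrow> bool) \<Rightarrow> ('p \<Rightarrow> 'p \<Rightarrow> 'p \<Rightarrow> bool) \<Rightarrow> ('p \<Rightarrow> 'p \<Rightarrow> 'p \<Rightarrow> 'p \<Rightarrow> bool) \<Rightarrow>
    (nat \<Rightarrow> 'p) \<Rightarrow> form \<Rightarrow> bool" where
  "sat E B C e (Eq a b) = E (e a) (e b)"
| "sat E B C e (Bet a b c) = B (e a) (e b) (e c)"
| "sat E B C e (Cong a b c d) = C (e a) (e b) (e c) (e d)"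
| "sat E B C e Falsum = False"
| "sat E B C e (F \<^bold>\<and> G) = (sat E B C e F \<and> sat E B C e G)"
| "sat E B C e (F \<^bold>\<or> G) = (sat E B C e F \<or> sat E B C e G)"
| "sat E B C e (F \<^bold>\<longrightarrow> G) = (sat E B C e F \<longrightarrow> sat E B C e G)"
| "sat E B C e (Forall F) = (\<forall>x. sat E B C (case_nat x e) F)"
| "sat E B C e (Exists F) = (\<exists>x. sat E B C (case_nat x e) F)"

text \<open>
  \<open>univ_at True A\<close> says that every universal quantifier of \<open>A\<close> occurs positively,
  \<open>univ_at False A\<close> that every one occurs negatively. Existential quantifiers and disjunctions
  are unrestricted. The restriction is what allows a Henkin construction without counterexamples to universal
  statements: intuitionistically, \<open>\<not>\<forall>x. A\<close> does not in general make it consistent to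
  add \<open>\<not>A\<close> for a fresh variable.
\<close>

primrec univ_at :: "bool \<Rightarrow> form \<Rightarrow> bool" where
  "univ_at b (Eq x y) = True"
| "univ_at b (Bet x y z) = True"
| "univ_at b (Cong x y z w) = True"
| "univ_at b Falsum = True"
| "univ_at b (F \<^bold>\<and> G) = (univ_at b F \<and> univ_at b G)"
| "univ_at b (F \<^bold>\<or> G) = (univ_at b F \<and> univ_at b G)"
| "univ_at b (F \<^bold>\<longrightarrow> G) = (univ_at (\<not> b) F \<and> univ_at b G)"
| "univ_at b (Forall F) = (b \<and> univ_at b F)"
| "univ_at b (Exists F) = univ_at b F"

instance form :: countable by countable_datatype

definition consistent where "consistent \<Gamma> \<longleftrightarrow> \<not> (\<Gamma> \<turnstile> Falsum)"

definition fresh_var where "fresh_var S = (SOME y. y \<notin> (\<Union>A\<in>S. fv A))"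

lemma fresh_var: assumes "finite (\<Union>A\<in>S. fv A)" "A \<in> S" shows "fresh_var S \<notin> fv A"
proof -
  have "\<exists>y. y \<notin> (\<Union>A\<in>S. fv A)" using ex_new_if_finite[OF infinite_UNIV_nat assms(1)] .
  hence "fresh_var S \<notin> (\<Union>A\<in>S. fv A)" unfolding fresh_var_def by (rule someI_ex)
  thus ?thesis using assms(2) by blast
qed

definition add_formula where
  "add_formula A S = (if consistent (insert A S) then
     insert A S \<union> {inst B (fresh_var (insert A S)) | B. A = Exists B} else S)"

text \<open>
  The witness of an existential formula is a fresh variable, so adding it is consistent by existential
  elimination.
\<close>

lemma consistent_add: assumes "consistent S" "finite (\<Union>A\<in>S. fv A)" shows "consistent (add_formula A S)"
proof (cases "consistent (insert A S)")
  case c: True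
  show ?thesis
  proof (cases "\<exists>B. A = Exists B")
    case True
    then obtain B where B: "A = Exists B" by blast
    let ?y = "fresh_var (insert A S)"
    have fr: "?y \<notin> fv D" if "D \<in> insert A S" for D using fresh_var[OF _ that] assms(2) finite_fv by simp
    have "\<not> (insert (inst B ?y) (insert A S) \<turnstile> Falsum)"
    proof
      assume d: "insert (inst B ?y) (insert A S) \<turnstile> Falsum"
      have "insert A S \<turnstile> Exists B" using B deriv.assm by blast
      hence "insert A S \<turnstile> Falsum" 
        by (rule existsE_fresh[OF _ d]) (use fr fr[of A, unfolded B] B in auto)
      thus False using c consistent_def by blast
    qed
    moreover have "add_formula A S = insert (inst B ?y) (insert A S)"
      using c B unfolding add_formula_def by auto
    ultimately show ?thesis unfolding consistent_def by simp
  next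
    case False
    hence "add_formula A S = insert A S" using c unfolding add_formula_def by auto
    thus ?thesis using c by simp
  qed
next
  case False
  thus ?thesis using assms unfolding add_formula_def by simp
qed

primrec henkin :: "form set \<Rightarrow> nat \<Rightarrow> form set" where
  "henkin \<Gamma> 0 = \<Gamma>"
| "henkin \<Gamma> (Suc k) = add_formula (from_nat k) (henkin \<Gamma> k)"

lemma finite_add: assumes "finite (\<Union>A\<in>S. fv A)" shows "finite (\<Union>A\<in>add_formula A S. fv A)"
proof -
  have "finite {inst B (fresh_var (insert A S)) | B. A = Exists B}"
  proof (cases A)
    case (Exists B)
    hence "{inst B (fresh_var (insert A S)) | B. A = Exists B} = {inst B (fresh_var (insert A S))}" by auto
    thus ?thesis by simp
  qed auto
  thus ?thesis using assms finite_fv unfolding add_formula_def by auto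
qed

text \<open>
  A maximal set that does not prove falsum decides every formula even intuitionistically, because
  inconsistency of \<open>A\<close> with the set is a derivation of \<open>\<not>A\<close>. So the
  propositional part of the extension is classical.
\<close>

lemma henkin_extension:
  assumes "consistent \<Gamma>" "finite (\<Union>A\<in>\<Gamma>. fv A)"
  obtains \<Sigma> where "\<Gamma> \<subseteq> \<Sigma>" "consistent \<Sigma>" "\<And>A. A \<in> \<Sigma> \<or> (\<^bold>\<not> A) \<in> \<Sigma>" "\<And>A. Exists A \<in> \<Sigma> \<Longrightarrow> \<exists>y. inst A y \<in> \<Sigma>"
    "\<And>A. \<Sigma> \<turnstile> A \<Longrightarrow> A \<in> \<Sigma>"
proof -
  let ?S = "\<Union>k. henkin \<Gamma> k"
  have fin: "finite (\<Union>A\<in>henkin \<Gamma> k. fv A)" for k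
    by (induction k) (simp_all add: assms finite_add del: UN_simps)
  have consistent: "consistent (henkin \<Gamma> k)" for k
    by (induction k) (simp_all add: assms consistent_add fin)
  have step: "henkin \<Gamma> k \<subseteq> henkin \<Gamma> (Suc k)" for k by (auto simp: add_formula_def)
  have mono: "i \<le> j \<Longrightarrow> henkin \<Gamma> i \<subseteq> henkin \<Gamma> j" for i j
    by (rule lift_Suc_mono_le[of "henkin \<Gamma>"]) (use step in auto)
  have fsub: "\<exists>k. F \<subseteq> henkin \<Gamma> k" if "finite F" "F \<subseteq> ?S" for F
    using that
  proof (induction F rule: finite_induct)
    case empty thus ?case by simp
  next
    case (insert A F)
    then obtain k l where "F \<subseteq> henkin \<Gamma> k" "A \<in> henkin \<Gamma> l" by auto
    hence "insert A F \<subseteq> henkin \<Gamma> (max k l)" using mono[of k "max k l"] mono[of l "max k l"] by auto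
    thus ?case by blast
  qed
  have conS: "consistent ?S"
    unfolding consistent_def
  proof
    assume "?S \<turnstile> Falsum"
    then obtain F where F: "F \<subseteq> ?S" "finite F" "F \<turnstile> Falsum" using deriv_finite by blast
    then obtain k where "F \<subseteq> henkin \<Gamma> k" using fsub by blast
    thus False using consistent[of k] deriv_weaken[OF F(3)] unfolding consistent_def by blast
  qed
  have max: "A \<in> ?S" if "consistent (insert A ?S)" for A
  proof -
    have "consistent (insert A (henkin \<Gamma> (to_nat A)))"
      using that deriv_weaken[of "insert A (henkin \<Gamma> (to_nat A))" Falsum "insert A ?S"] unfolding consistent_def by blast
    hence "A \<in> henkin \<Gamma> (Suc (to_nat A))" by (simp add: add_formula_def)
    thus ?thesis by blast
  qed
  have closed: "A \<in> ?S" if d: "?S \<turnstile> A" for A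
  proof (rule max)
    show "consistent (insert A ?S)" using deriv_cut[OF d, of Falsum] conS unfolding consistent_def by blast
  qed
  have dec: "A \<in> ?S \<or> (\<^bold>\<not> A) \<in> ?S" for A
  proof (cases "consistent (insert A ?S)")
    case True thus ?thesis using max by simp
  next
    case False
    hence "?S \<turnstile> \<^bold>\<not> A" unfolding consistent_def by (simp add: deriv.impI)
    thus ?thesis using closed by blast
  qed
  have wit: "\<exists>y. inst A y \<in> ?S" if "Exists A \<in> ?S" for A
  proof -
    let ?k = "to_nat (Exists A)"
    have "insert (Exists A) (henkin \<Gamma> ?k) \<subseteq> ?S" using that by blast
    hence "consistent (insert (Exists A) (henkin \<Gamma> ?k))"
      using conS deriv_weaken[of "insert (Exists A) (henkin \<Gamma> ?k)" Falsum ?S] unfolding consistent_def by blast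
    hence "inst A (fresh_var (insert (Exists A) (henkin \<Gamma> ?k))) \<in> henkin \<Gamma> (Suc ?k)"
      by (simp add: add_formula_def)
    thus ?thesis by blast
  qed
  have "\<Gamma> \<subseteq> ?S" using UN_upper[of 0 UNIV "henkin \<Gamma>"] by simp
  thus thesis by (rule that[OF _ conS dec wit closed])
qed

text \<open>
  In a Henkin theory only one direction of the usual truth lemma is available for each polarity. For a
  positive universal quantifier membership of all instances suffices; a negative occurrence would need a
  counterexample, and is excluded by \<open>univ_at\<close>.
\<close>

lemma truth:
  assumes consistent: "consistent \<Sigma>" and dec: "\<And>A. A \<in> \<Sigma> \<or> (\<^bold>\<not> A) \<in> \<Sigma>" 
    and wit: "\<And>A. Exists A \<in> \<Sigma> \<Longrightarrow> \<exists>y. inst A y \<in> \<Sigma>" and closed: "\<And>A. \<Sigma> \<turnstile> A \<Longrightarrow> A \<in> \<Sigma>"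
  shows "(univ_at True A \<longrightarrow> ren f A \<in> \<Sigma> \<longrightarrow> 
      sat (\<lambda>a b. Eq a b \<in> \<Sigma>) (\<lambda>a b c. Bet a b c \<in> \<Sigma>) (\<lambda>a b c d. Cong a b c d \<in> \<Sigma>) f A) \<and>
    (univ_at False A \<longrightarrow> ren f A \<notin> \<Sigma> \<longrightarrow> 
      \<not> sat (\<lambda>a b. Eq a b \<in> \<Sigma>) (\<lambda>a b c. Bet a b c \<in> \<Sigma>) (\<lambda>a b c d. Cong a b c d \<in> \<Sigma>) f A)"
proof -
  have iff: "A \<in> \<Sigma> \<longleftrightarrow> (\<Sigma> \<turnstile> A)" for A using closed deriv.assm by blast
  have bot: "Falsum \<notin> \<Sigma>" using consistent iff consistent_def by blast
  have and_iff: "(A \<^bold>\<and> B) \<in> \<Sigma> \<longleftrightarrow> A \<in> \<Sigma> \<and> B \<in> \<Sigma>" for A B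
    unfolding iff using deriv.conjI deriv.conjE1 deriv.conjE2 by blast
  have not_iff: "(\<^bold>\<not> A) \<in> \<Sigma> \<longleftrightarrow> A \<notin> \<Sigma>" for A
    using dec[of A] bot deriv.impE unfolding iff by blast
  have imp_iff: "(A \<^bold>\<longrightarrow> B) \<in> \<Sigma> \<longleftrightarrow> (A \<in> \<Sigma> \<longrightarrow> B \<in> \<Sigma>)" for A B
  proof
    assume "(A \<^bold>\<longrightarrow> B) \<in> \<Sigma>" thus "A \<in> \<Sigma> \<longrightarrow> B \<in> \<Sigma>" using deriv.impE unfolding iff by blast
  next
    assume r: "A \<in> \<Sigma> \<longrightarrow> B \<in> \<Sigma>"
    show "(A \<^bold>\<longrightarrow> B) \<in> \<Sigma>"
    proof (cases "A \<in> \<Sigma>")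
      case True
      hence "\<Sigma> \<turnstile> B" using r iff by blast
      thus ?thesis using deriv.impI[OF deriv_weaken] iff by blast
    next
      case False
      hence "(\<^bold>\<not> A) \<in> \<Sigma>" using not_iff by blast
      hence "insert A \<Sigma> \<turnstile> Falsum" using deriv.impE[of "insert A \<Sigma>" A] deriv.assm by blast
      thus ?thesis using deriv.impI[OF deriv.falsumE] iff by blast
    qed
  qed
  have or_iff: "(A \<^bold>\<or> B) \<in> \<Sigma> \<longleftrightarrow> A \<in> \<Sigma> \<or> B \<in> \<Sigma>" for A B
  proof
    assume o: "(A \<^bold>\<or> B) \<in> \<Sigma>"
    show "A \<in> \<Sigma> \<or> B \<in> \<Sigma>"
    proof (rule ccontr)
      assume "\<not> (A \<in> \<Sigma> \<or> B \<in> \<Sigma>)"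
      hence "(\<^bold>\<not> A) \<in> \<Sigma>" "(\<^bold>\<not> B) \<in> \<Sigma>" using not_iff by blast+
      hence "insert A \<Sigma> \<turnstile> Falsum" "insert B \<Sigma> \<turnstile> Falsum"
        using deriv.impE[of "insert A \<Sigma>" A] deriv.impE[of "insert B \<Sigma>" B] deriv.assm by blast+
      hence "\<Sigma> \<turnstile> Falsum" using deriv.disjE o iff by blast
      thus False using bot iff by blast
    qed
  next
    assume "A \<in> \<Sigma> \<or> B \<in> \<Sigma>" thus "(A \<^bold>\<or> B) \<in> \<Sigma>" unfolding iff using deriv.disjI1 deriv.disjI2 by blast
  qed
  have all: "ren (case_nat y f) A \<in> \<Sigma>" if "ren f (Forall A) \<in> \<Sigma>" for A f y
  proof -
    have "\<Sigma> \<turnstile> inst (ren (case_nat 0 (\<lambda>i. Suc (f i))) A) y" using that deriv.forallE iff by simp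
    moreover have "inst (ren (case_nat 0 (\<lambda>i. Suc (f i))) A) y = ren (case_nat y f) A"
      unfolding ren_ren by (rule ren_cong) (simp split: nat.split)
    ultimately show ?thesis using iff by simp
  qed
  have ex: "ren f (Exists A) \<in> \<Sigma> \<longleftrightarrow> (\<exists>y. ren (case_nat y f) A \<in> \<Sigma>)" for A f
  proof -
    have e: "inst (ren (case_nat 0 (\<lambda>i. Suc (f i))) A) y = ren (case_nat y f) A" for y
      unfolding ren_ren by (rule ren_cong) (simp split: nat.split)
    show ?thesis using wit[of "ren (case_nat 0 (\<lambda>i. Suc (f i))) A"]
        deriv.existsI[of \<Sigma> _ "ren (case_nat 0 (\<lambda>i. Suc (f i))) A"] unfolding e iff[symmetric] by auto
  qed
  show ?thesis
  proof (induction A arbitrary: f)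
    case (Forall A)
    show ?case using Forall.IH all by auto
  next
    case (Exists A)
    show ?case using Exists.IH unfolding ex by auto
  next
    case (Imp A B)
    show ?case using Imp.IH[of f] by (auto simp: imp_iff)
  next
    case (Conj A B)
    show ?case using Conj.IH[of f] by (auto simp: and_iff)
  next
    case (Disj A B)
    show ?case using Disj.IH[of f] by (auto simp: or_iff)
  qed (auto simp: bot)
qed

lemma sat_quotient:
  assumes h: "surj h" "\<And>x y. h x = h y \<longleftrightarrow> E x y"
    and B: "\<And>x y z. B' (h x) (h y) (h z) \<longleftrightarrow> B x y z"
    and C: "\<And>x y z w. C' (h x) (h y) (h z) (h w) \<longleftrightarrow> C x y z w"
  shows "sat (=) B' C' (\<lambda>i. h (e i)) A \<longleftrightarrow> sat E B C e A"
proof (induction A arbitrary: e)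
  case (Forall A)
  have "(\<forall>x. P x) \<longleftrightarrow> (\<forall>y. P (h y))" for P using h(1) unfolding surj_def by metis
  moreover have "case_nat (h y) (\<lambda>i. h (e i)) = (\<lambda>i. h (case_nat y e i))" for y
    by (rule ext) (simp split: nat.split)
  ultimately show ?case using Forall.IH by simp
next
  case (Exists A)
  have "(\<exists>x. P x) \<longleftrightarrow> (\<exists>y. P (h y))" for P using h(1) unfolding surj_def by metis
  moreover have "case_nat (h y) (\<lambda>i. h (e i)) = (\<lambda>i. h (case_nat y e i))" for y
    by (rule ext) (simp split: nat.split)
  ultimately show ?case using Exists.IH by simp
qed (simp_all add: h B C)

section \<open>Neutral plane geometry in a classical structure\<close>

definition wbet :: "('p \<Rightarrow> 'p \<Rightarrow> 'p \<Rightarrow> bool) \<Rightarrow> 'p \<Rightarrow> 'p \<Rightarrow> 'p \<Rightarrow> bool" where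
  "wbet B a b c \<longleftrightarrow> \<not> (a \<noteq> b \<and> b \<noteq> c \<and> \<not> B a b c)"

definition on_line :: "('p \<Rightarrow> 'p \<Rightarrow> 'p \<Rightarrow> bool) \<Rightarrow> 'p \<Rightarrow> 'p \<Rightarrow> 'p \<Rightarrow> bool" where
  "on_line B x a b \<longleftrightarrow> B a b x \<or> B b x a \<or> B x a b \<or> x = a \<or> x = b"

definition on_common_line :: "('p \<Rightarrow> 'p \<Rightarrow> 'p \<Rightarrow> bool) \<Rightarrow> 'p \<Rightarrow> 'p \<Rightarrow> 'p \<Rightarrow> bool" where
  "on_common_line B a b c \<longleftrightarrow> (\<exists>u v. u \<noteq> v \<and> on_line B a u v \<and> on_line B b u v \<and> on_line B c u v)"

definition seg_le :: "('p \<Rightarrow> 'p \<Rightarrow> 'p \<Rightarrow> bool) \<Rightarrow> ('p \<Rightarrow> 'p \<Rightarrow> 'p \<Rightarrow> 'p \<Rightarrow> bool) \<Rightarrow>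
    'p \<Rightarrow> 'p \<Rightarrow> 'p \<Rightarrow> 'p \<Rightarrow> bool" where
  "seg_le B C a b c d \<longleftrightarrow> (\<exists>e. wbet B c e d \<and> C a b c e)"

text \<open>
  The axioms of neutral constructive geometry also hold in a structure with one point, where three points fail
  to lie on a common line for want of a line; \<open>nontrivial\<close> rules this out.
\<close>

locale neutral_plane =
  fixes B :: "'p \<Rightarrow> 'p \<Rightarrow> 'p \<Rightarrow> bool" and C :: "'p \<Rightarrow> 'p \<Rightarrow> 'p \<Rightarrow> 'p \<Rightarrow> bool"
  assumes cong_flip: "C a b b a"
    and cong_common: "C a b p q \<Longrightarrow> C a b r s \<Longrightarrow> C p q r s"
    and cong_null: "C a b c c \<Longrightarrow> a = b"
    and extend: "a \<noteq> b \<Longrightarrow> \<exists>x. wbet B a b x \<and> C b x c d"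
    and five_segment: "a \<noteq> b \<Longrightarrow> wbet B a b c \<Longrightarrow> wbet B a' b' c' \<Longrightarrow> C a b a' b' \<Longrightarrow> C b c b' c' \<Longrightarrow>
      C a d a' d' \<Longrightarrow> C b d b' d' \<Longrightarrow> C c d c' d'"
    and bet_strict: "B a b c \<Longrightarrow> B c b a \<and> a \<noteq> b \<and> b \<noteq> c"
    and bet_irrefl: "\<not> B a b a"
    and bt_inner: "wbet B a b d \<Longrightarrow> wbet B b c d \<Longrightarrow> wbet B a b c \<and> wbet B a c d"
    and bt_outer: "wbet B a b c \<Longrightarrow> wbet B b c d \<Longrightarrow> b \<noteq> c \<Longrightarrow> wbet B a c d \<and> wbet B a b d"
    and connectivity: "B a b c \<Longrightarrow> B a b d \<Longrightarrow> \<not> wbet B a c d \<Longrightarrow> wbet B a d c"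
    and inner_pasch: "\<not> on_common_line B a b c \<Longrightarrow> B a p c \<Longrightarrow> B b q c \<Longrightarrow> \<exists>x. B p x b \<and> B q x a"
    and nontrivial: "\<exists>a b :: 'p. a \<noteq> b"
    and upper_dim: "p \<noteq> q \<Longrightarrow> C x p x q \<Longrightarrow> C y p y q \<Longrightarrow> C z p z q \<Longrightarrow> on_common_line B x y z"
    and circle_circle: "c \<noteq> d \<Longrightarrow> C c x p q \<Longrightarrow> seg_le B C d x r s \<Longrightarrow> C c y p q \<Longrightarrow> seg_le B C r s d y \<Longrightarrow>
      \<exists>z. C c z p q \<and> C d z r s"
begin

abbreviation "bt \<equiv> wbet B"
abbreviation "lies \<equiv> on_line B"

lemma cong_refl: "C a b a b"
  using cong_common[OF cong_flip cong_flip] .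
lemma cong_sym: "C a b c d \<Longrightarrow> C c d a b"
  using cong_common[OF _ cong_refl] .
lemma cong_trans: "C a b c d \<Longrightarrow> C c d e f \<Longrightarrow> C a b e f"
  using cong_common[OF cong_sym] .
lemma cong_flip1: "C a b c d \<Longrightarrow> C b a c d"
  using cong_common[OF cong_flip] .
lemma cong_flip2: "C a b c d \<Longrightarrow> C a b d c"
  using cong_trans[OF _ cong_flip] .

lemma bt_iff: "bt a b c \<longleftrightarrow> a = b \<or> b = c \<or> B a b c"
  unfolding wbet_def by blast
lemma bet_sym: "B a b c \<Longrightarrow> B c b a" using bet_strict by blast
lemma bet_ne: "B a b c \<Longrightarrow> a \<noteq> b \<and> b \<noteq> c \<and> a \<noteq> c" using bet_strict bet_irrefl by metis
lemma bet_iff: "B a b c \<longleftrightarrow> bt a b c \<and> a \<noteq> b \<and> b \<noteq> c"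
  using bt_iff bet_ne by metis
lemma bt_sym: "bt a b c \<Longrightarrow> bt c b a" using bet_sym unfolding bt_iff by auto
lemma bt_ident: "bt a b a \<Longrightarrow> a = b" using bet_irrefl unfolding bt_iff by auto
lemma bt_triv [simp]: "bt a a b" "bt a b b" unfolding bt_iff by auto

lemma cong_zero: "C a a b b"
proof (cases "\<exists>u. u \<noteq> a")
  case True
  then obtain u where "u \<noteq> a" by blast
  then obtain x where "C a x b b" using extend by metis
  thus ?thesis using cong_null by metis
next
  case False
  thus ?thesis using cong_refl by metis
qed

lemma cong_null2: "C c c a b \<Longrightarrow> a = b" using cong_null cong_sym by metis

lemma extend_any: "\<exists>x. bt a b x \<and> C b x c d"
proof (cases "a = b")
  case False thus ?thesis using extend by blast
next
  case True
  show ?thesis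
  proof (cases "\<exists>u. u \<noteq> b")
    case T: True
    then obtain u where "u \<noteq> b" by blast
    then obtain x where "C b x c d" using extend by metis
    thus ?thesis using True by auto
  next
    case False
    hence "c = b" "d = b" by auto
    thus ?thesis using True cong_refl by auto
  qed
qed

lemma other_point: "\<exists>b. b \<noteq> (a::'p)" using nontrivial by metis

lemma extend_strict: assumes "a \<noteq> b" "c \<noteq> d" shows "\<exists>x. B a b x \<and> C b x c d"
proof -
  obtain x where x: "bt a b x" "C b x c d" using extend assms by blast
  have "b \<noteq> x" using x assms cong_null2 by metis
  thus ?thesis using x assms bet_iff by blast
qed

lemma beyond: "a \<noteq> b \<Longrightarrow> \<exists>x. B a b x" using extend_strict by blast

lemmas cong_flips = cong_flip1 cong_flip2

lemma sum_cong: assumes "bt a b c" "bt a' b' c'" "C a b a' b'" "C b c b' c'" shows "C a c a' c'"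
proof (cases "a = b")
  case True
  hence "a' = b'" using assms cong_null2 by blast
  thus ?thesis using True assms by simp
next
  case False
  have "C c a c' a'" using five_segment[OF False assms, of a a'] cong_zero assms cong_flips by blast
  thus ?thesis using cong_flips by blast
qed

lemma extend_unique: assumes "a \<noteq> b" "bt a b x" "bt a b y" "C b x b y" shows "x = y"
proof -
  have 1: "C a x a y" using sum_cong assms cong_refl by blast
  have "C x x x y" using five_segment[OF assms(1,2,2) cong_refl cong_refl, of x y] 1 assms by blast
  thus ?thesis using cong_null2 by blast
qed

lemma bt_inner1: "bt a b d \<Longrightarrow> bt b c d \<Longrightarrow> bt a b c" using bt_inner by blast
lemma bt_inner2: "bt a b d \<Longrightarrow> bt b c d \<Longrightarrow> bt a c d" using bt_inner by blast
lemma bt_outer1: "bt a b c \<Longrightarrow> bt b c d \<Longrightarrow> b \<noteq> c \<Longrightarrow> bt a c d" using bt_outer by blast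
lemma bt_outer2: "bt a b c \<Longrightarrow> bt b c d \<Longrightarrow> b \<noteq> c \<Longrightarrow> bt a b d" using bt_outer by blast

lemma bt_nest1: assumes "bt a c d" "bt a b c" shows "bt b c d"
  using bt_inner1[of d c a b] bt_sym assms by blast
lemma bt_nest2: assumes "bt a c d" "bt a b c" shows "bt a b d"
  using bt_inner2[of d c a b] bt_sym assms by blast

lemma conn1: assumes "a \<noteq> b" "bt a b c" "bt a b d" shows "bt a c d \<or> bt a d c"
  using assms connectivity bt_iff by metis
lemma conn2: assumes "a \<noteq> b" "bt a b c" "bt a b d" shows "bt b c d \<or> bt b d c"
  using conn1[OF assms] bt_nest1 assms by blast
lemma conn3: assumes "bt a b d" "bt a c d" shows "bt a b c \<or> bt a c b"
proof (cases "a = d")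
  case True thus ?thesis using assms bt_ident by auto
next
  case False
  then obtain p where p: "B d a p" using beyond by metis
  hence pd: "bt p a d" "p \<noteq> a" using bet_iff bet_sym by blast+
  have "bt p a b" "bt p a c" using bt_inner1[OF pd(1)] assms by blast+
  thus ?thesis using conn2[OF pd(2)] by blast
qed

text \<open>
  Subtraction of segments: extend beyond \<open>c\<close> and apply the five-segment axiom from the other
  side.
\<close>

lemma diff_cong: assumes "bt a b c" "bt a' b' c'" "C a c a' c'" "C b c b' c'" shows "C a b a' b'"
proof (cases "a = c")
  case True
  hence "a' = c'" "a = b" using assms cong_null2 bt_ident by blast+
  thus ?thesis using assms True bt_ident cong_zero by blast
next
  case False
  obtain e where e: "B a c e" using beyond False by blast
  have ne': "a' \<noteq> c'" using False assms cong_null by blast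
  obtain e' where e': "bt a' c' e'" "C c' e' c e" using extend ne' by blast
  have ae: "bt a c e" "c \<noteq> e" using e bet_iff by blast+
  have ee: "C c e c' e'" "C e c e' c'" using cong_sym[OF e'(2)] cong_flips by blast+
  have ea: "C e a e' a'" using sum_cong[OF ae(1) e'(1) assms(3) ee(1)] cong_flips by blast
  have 1: "bt e c b" "bt e' c' b'"
    using bt_sym[OF bt_nest1[OF ae(1) assms(1)]] bt_sym[OF bt_nest1[OF e'(1) assms(2)]] by blast+
  have "C b a b' a'" using five_segment[OF ae(2)[symmetric] 1 ee(2) _ ea] assms(3,4) cong_flips by blast
  thus ?thesis using cong_flips by blast
qed

text \<open>
  The five-segment axiom with the unknown segment issuing from the inner point; again by extending beyond
  \<open>c\<close>.
\<close>

lemma inner_five: assumes "bt a b c" "bt a' b' c'" "C a c a' c'" "C b c b' c'" "C a d a' d'" "C c d c' d'"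
  shows "C b d b' d'"
proof (cases "a = c")
  case True
  hence "a' = c'" using assms cong_null2 by blast
  hence "a' = b'" "a = b" using assms True bt_ident by blast+
  thus ?thesis using assms by blast
next
  case False
  obtain e where e: "B a c e" using beyond False by blast
  have ne': "a' \<noteq> c'" using False assms cong_null by blast
  obtain e' where e': "bt a' c' e'" "C c' e' c e" using extend ne' by blast
  have ee: "C c e c' e'" "C e c e' c'" using cong_sym[OF e'(2)] cong_flips by blast+
  have ae: "bt a c e" and diffc: "e \<noteq> c" using e bet_iff by blast+
  have "C e d e' d'" using five_segment[OF False ae e'(1) assms(3) ee(1)] assms by blast
  moreover have 1: "bt e c b" "bt e' c' b'"
    using bt_sym[OF bt_nest1[OF ae assms(1)]] bt_sym[OF bt_nest1[OF e'(1) assms(2)]] by blast+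
  ultimately show ?thesis using five_segment[OF _ 1 ee(2)] diffc assms(4,6) cong_flips by blast
qed

lemma transfer_between: assumes "bt a b c" "C a c a' c'" 
  shows "\<exists>b'. bt a' b' c' \<and> C a b a' b' \<and> C b c b' c'"
proof (cases "a = c")
  case True
  hence "a' = c'" "a = b" using assms cong_null2 bt_ident by blast+
  thus ?thesis using assms(1) True cong_zero by (intro exI[of _ c']) auto
next
  case False
  hence ne: "a' \<noteq> c'" using assms cong_null by blast
  obtain x where x: "B c' a' x" using beyond ne by metis
  have xa: "x \<noteq> a'" "bt x a' c'" using x bet_iff bt_sym by blast+
  obtain b' where b': "bt x a' b'" "C a' b' a b" using extend xa(1) by blast
  obtain c'' where c'': "bt x b' c''" "C b' c'' b c" using extend_any by blast
  have 1: "bt a' b' c''" using bt_nest1 b' c'' by blast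
  have "C a' c'' a c" using sum_cong[OF 1 assms(1)] b' c'' by blast
  hence "C a' c'' a' c'" using assms cong_trans by blast
  moreover have "bt x a' c''" using b' c'' bt_nest2 by blast
  ultimately have "c'' = c'" using extend_unique[OF xa(1)] xa(2) by blast
  thus ?thesis using 1 b' c'' cong_sym by blast
qed

text \<open>
  The transferred copy of \<open>b\<close> lies between \<open>a'\<close> and \<open>c'\<close> and has the
  same distances from them as \<open>b'\<close>; by the inner form of the five-segment axiom its distance from
  \<open>b'\<close> is null.
\<close>

lemma between_cong: assumes "bt a b c" "C a b a' b'" "C b c b' c'" "C a c a' c'" shows "bt a' b' c'"
proof -
  obtain b'' where b'': "bt a' b'' c'" "C a b a' b''" "C b c b'' c'"
    using transfer_between assms by blast
  have 2: "C a' b'' a' b'" "C c' b'' c' b'" 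
    using assms b'' cong_sym cong_trans cong_flips by meson+
  have "C b'' b'' b'' b'" using inner_five[OF b''(1,1) cong_refl cong_refl, of b'' b'] 2 by blast
  hence "b'' = b'" using cong_null2 by blast
  thus ?thesis using b'' by blast
qed

definition col where "col a b c \<longleftrightarrow> bt a b c \<or> bt b c a \<or> bt c a b"

lemma col_perm: assumes "col a b c" shows "col b c a" "col c a b" "col b a c" "col a c b" "col c b a"
  using assms bt_sym unfolding col_def by blast+
lemma col_triv [simp]: "col a a b" "col a b b" "col a b a" unfolding col_def by auto
lemma bt_col: "bt a b c \<Longrightarrow> col a b c" unfolding col_def by blast
lemma bet_col: "B a b c \<Longrightarrow> col a b c" unfolding col_def using bet_iff by blast

lemma lies_iff: assumes "a \<noteq> b" shows "lies x a b \<longleftrightarrow> col a b x"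
  unfolding on_line_def col_def bt_iff using assms bet_sym by blast

lemma col_trans: assumes "a \<noteq> b" "col a b c" "col a b d" shows "col a c d"
proof -
  have main: "col a x y" if x: "bt a b x" "bt a b y \<or> bt b y a \<or> bt y a b" for x y
    using that(2)
  proof (elim HOL.disjE)
    assume "bt a b y" thus ?thesis using conn1[OF assms(1) x(1)] bt_sym unfolding col_def by blast
  next
    assume "bt b y a" thus ?thesis using bt_nest2[OF x(1)] bt_sym unfolding col_def by blast
  next
    assume "bt y a b" thus ?thesis using bt_outer2[OF _ x(1) assms(1)] bt_sym unfolding col_def by blast
  qed
  have mid: "col a x y" if x: "bt b x a" "bt b y a \<or> bt y a b" for x y
    using that(2)
  proof (elim HOL.disjE)
    assume "bt b y a" thus ?thesis using conn3[OF bt_sym[OF x(1)] bt_sym] unfolding col_def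
      using bt_sym by blast
  next
    assume "bt y a b" thus ?thesis using bt_inner1[OF _ bt_sym[OF x(1)]] bt_sym unfolding col_def by blast
  qed
  have last: "col a x y" if x: "bt x a b" "bt y a b" for x y
    using conn2[OF assms(1)[symmetric] bt_sym[OF x(1)] bt_sym[OF x(2)]] bt_sym unfolding col_def by blast
  have flip: "col a y x \<Longrightarrow> col a x y" for x y using bt_sym unfolding col_def by blast
  show ?thesis using assms(2,3) main[of c d] main[of d c] mid[of c d] mid[of d c] last[of c d] flip[of c d] flip[of d c]
    unfolding col_def[of a b] by blast
qed

lemma col_line: assumes "u \<noteq> v" "col u v a" "col u v b" "col u v c" shows "col a b c"
proof (cases "u = a")
  case True
  thus ?thesis using col_trans[of u v b c] assms by blast
next
  case False
  have "col u a b" "col u a c" using col_trans assms by blast+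
  hence "col a b c" using col_trans[of a u b c] False col_perm by metis
  thus ?thesis .
qed

text \<open>
  Two distinct points of a line determine it.
\<close>

lemma col_line2: assumes "a \<noteq> b" "col u v a" "col u v b" "col a b c" "u \<noteq> v" shows "col u v c"
proof -
  have "col a b u" "col a b v" using col_line[OF assms(5)] assms by simp_all
  thus ?thesis using col_line[OF assms(1)] assms(4) by blast
qed

lemma on_common_line_iff: "on_common_line B a b c \<longleftrightarrow> col a b c"
proof
  assume "on_common_line B a b c"
  then obtain u v where "u \<noteq> v" "lies a u v" "lies b u v" "lies c u v" unfolding on_common_line_def by blast
  thus "col a b c" using lies_iff col_line by metis
next
  assume c: "col a b c"
  have "u \<noteq> v \<Longrightarrow> col u v a \<Longrightarrow> col u v b \<Longrightarrow> col u v c \<Longrightarrow> on_common_line B a b c" for u v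
    unfolding on_common_line_def using lies_iff by metis
  moreover obtain z where "z \<noteq> a" using other_point by blast
  ultimately show "on_common_line B a b c" using c col_perm col_triv by metis
qed

lemma pasch: "\<not> col a b c \<Longrightarrow> B a p c \<Longrightarrow> B b q c \<Longrightarrow> \<exists>x. B p x b \<and> B q x a"
  using inner_pasch on_common_line_iff by blast
lemma plane: "p \<noteq> q \<Longrightarrow> C x p x q \<Longrightarrow> C y p y q \<Longrightarrow> C z p z q \<Longrightarrow> col x y z"
  using upper_dim on_common_line_iff by blast

lemma line_cong: assumes "a \<noteq> b" "col a b c" "C a p a q" "C b p b q" shows "C c p c q"
proof -
  consider "bt a b c" | "bt b c a" | "bt c a b" using assms(2) col_def by blast
  thus ?thesis
  proof cases
    case 1 thus ?thesis using five_segment[OF assms(1) 1 1 cong_refl cong_refl] assms by blast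
  next
    case 2 thus ?thesis using inner_five[OF 2 2 cong_refl cong_refl] assms by blast
  next
    case 3 
    hence "bt b a c" using bt_sym by blast
    thus ?thesis using five_segment[of b a c b a c p q] assms cong_refl by blast
  qed
qed

lemma line_cong_eq: assumes "a \<noteq> b" "col a b c" "C a c a d" "C b c b d" shows "c = d"
  using line_cong[OF assms] cong_null2 by blast

section \<open>Point reflections and midpoints\<close>

text \<open>
  Point reflection is used as a relation: \<open>mid m a b\<close> says that \<open>b\<close> is the
  reflection of \<open>a\<close> in \<open>m\<close>. The case \<open>a = m = b\<close> is included.
\<close>

definition mid where "mid m a b \<longleftrightarrow> bt a m b \<and> C a m m b"

lemma mid_sym: "mid m a b \<Longrightarrow> mid m b a" 
  unfolding mid_def using bt_sym cong_flip1[OF cong_flip2[OF cong_sym]] by blast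
lemma mid_ex: "\<exists>b. mid m a b" unfolding mid_def using extend_any[of a m a m] cong_sym by blast
lemma mid_same [simp]: "mid m m b \<longleftrightarrow> b = m" "mid m b m \<longleftrightarrow> b = m"
  unfolding mid_def using cong_null2 cong_zero cong_null by auto
lemma mid_same2 [simp]: "mid m b b \<longleftrightarrow> b = m"
  unfolding mid_def using bt_ident cong_zero by auto
lemma mid_unique: assumes "mid m a b" "mid m a c" shows "b = c"
proof (cases "a = m")
  case True thus ?thesis using assms by simp
next
  case False
  thus ?thesis using assms extend_unique cong_sym cong_trans unfolding mid_def by blast
qed
lemma mid_cong: "mid m a b \<Longrightarrow> C m a m b" unfolding mid_def using cong_flips by blast
lemma mid_bet: "mid m a b \<Longrightarrow> a \<noteq> m \<Longrightarrow> B a m b"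
  unfolding mid_def using bet_iff[of a m b] cong_null[of a m m] by blast
lemma mid_ne: "mid m a b \<Longrightarrow> a \<noteq> m \<Longrightarrow> b \<noteq> m \<and> b \<noteq> a" using mid_bet bet_ne by metis
lemma mid_col: "mid m a b \<Longrightarrow> col a m b" unfolding mid_def using bt_col by blast

text \<open>
  A point reflection is an isometry. The segments from \<open>a\<close> to \<open>p\<close>, \<open>q\<close>,
  \<open>p'\<close>, \<open>q'\<close> are prolonged to points \<open>x\<close>, \<open>y\<close>,
  \<open>x'\<close>, \<open>y'\<close> at the distance \<open>ap + aq\<close> from \<open>a\<close>. For these
  the five-segment axiom gives \<open>xy = x'y'\<close>, and the inner form of the axiom carries the
  congruence back to \<open>pq = p'q'\<close>.
\<close>

lemma reflect_cong: assumes "mid a p p'" "mid a q q'" shows "C p q p' q'"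
proof -
  have p: "bt p a p'" "C a p a p'" and q: "bt q a q'" "C a q a q'"
    using assms mid_def mid_cong by blast+
  show ?thesis
  proof (cases "p = a")
    case True
    hence "p' = a" using assms mid_same by metis
    thus ?thesis using True q by blast
  next
    case pa: False
    show ?thesis
    proof (cases "q = a")
      case True
      hence "q' = a" using assms mid_same by metis
      thus ?thesis using True p cong_flips by blast
    next
      case qa: False
      have pa': "p' \<noteq> a" "q' \<noteq> a" using assms mid_ne pa qa by blast+
      obtain x where x: "bt a p x" "C p x q a" using extend_any by blast
      obtain x' where x': "bt a p' x'" "C p' x' q a" using extend_any by blast
      obtain y where y: "bt a q y" "C q y p a" using extend_any by blast
      obtain y' where y': "bt a q' y'" "C q' y' p a" using extend_any by blast
      have ax': "C a x a x'" using sum_cong[OF x(1) x'(1) p(2)] x(2) x'(2) cong_sym cong_trans by blast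
      have ay': "C a y a y'" using sum_cong[OF y(1) y'(1) q(2)] y(2) y'(2) cong_sym cong_trans by blast
      have axy: "C a x y a"
        using sum_cong[OF x(1) bt_sym[OF y(1)]] x(2) y(2) cong_sym cong_trans cong_flips by meson
      have axx: "bt x a x'"
      proof -
        have "bt p a x'" using p(1) x'(1) pa' bt_outer2 by blast
        thus ?thesis using bt_sym[OF bt_outer2[OF bt_sym x(1)]] pa by blast
      qed
      have ayy: "bt y a y'"
      proof -
        have "bt q a y'" using q(1) y'(1) pa' bt_outer2 by blast
        thus ?thesis using bt_sym[OF bt_outer2[OF bt_sym y(1)]] qa by blast
      qed
      have xa: "x \<noteq> a" using x pa bt_ident by blast
      have "C x' y' y x"
        using five_segment[OF xa axx bt_sym[OF ayy], of y' x] axy ax' ay' cong_flip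
          cong_sym cong_trans cong_flips by meson
      hence xy: "C y x y' x'" using cong_sym cong_flips by meson
      have qx: "C q x q' x'"
        using inner_five[OF bt_sym[OF y(1)] bt_sym[OF y'(1)], of x x'] xy ay' ax' q(2) cong_flips
        by meson
      show ?thesis
        using inner_five[OF bt_sym[OF x(1)] bt_sym[OF x'(1)], of q q'] qx ax' q(2) p(2) cong_flips by meson
    qed
  qed
qed

lemma reflect_bt: assumes "mid o1 a a'" "mid o1 b b'" "mid o1 c c'" "bt a b c" shows "bt a' b' c'"
  using between_cong[OF assms(4)] reflect_cong assms by blast
lemma reflect_inj: "mid o1 a a' \<Longrightarrow> mid o1 b b' \<Longrightarrow> a \<noteq> b \<Longrightarrow> a' \<noteq> b'"
  using mid_unique[OF mid_sym mid_sym] by metis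
lemma reflect_bet: assumes "mid o1 a a'" "mid o1 b b'" "mid o1 c c'" "B a b c" shows "B a' b' c'"
  using reflect_bt[OF assms(1-3)] assms(4) reflect_inj[OF assms(1,2)] reflect_inj[OF assms(2,3)]
    bet_iff[of a b c] bet_iff[of a' b' c'] by blast
lemma reflect_col: assumes "mid o1 a a'" "mid o1 b b'" "mid o1 c c'" "col a b c" shows "col a' b' c'"
  using reflect_bt[OF assms(1,2,3)] reflect_bt[OF assms(2,3,1)] reflect_bt[OF assms(3,1,2)] assms(4)
  unfolding col_def by blast

lemma equidist_col: assumes "a \<noteq> b" "col a m b" "C m a m b" shows "mid m a b"
proof -
  consider "bt a m b" | "bt m b a" | "bt b a m" using assms(2) col_def by blast
  thus ?thesis
  proof cases
    case 1 thus ?thesis using assms mid_def cong_flips by meson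
  next
    case 2
    hence "C b a a a" using diff_cong[of a b m a a m] bt_sym assms bt_triv cong_flips cong_sym cong_refl by meson
    thus ?thesis using cong_null assms by blast
  next
    case 3
    hence "C b a b b" using diff_cong[of b a m b b m] assms bt_triv cong_flips cong_sym cong_refl by meson
    thus ?thesis using cong_null assms by blast
  qed
qed

text \<open>
  The two circles about \<open>a\<close> and \<open>b\<close> with radius \<open>ab\<close>. The first
  contains \<open>b\<close>, the center of the second, and the point \<open>y\<close> opposite to
  \<open>b\<close>, which lies outside the second.
\<close>

lemma equilateral: assumes "a \<noteq> b" shows "\<exists>c. C a c a b \<and> C b c b a"
proof -
  obtain y where y: "bt b a y" "C a y a b" using extend_any by blast
  have "seg_le B C b b b a" unfolding seg_le_def using cong_refl by (intro exI[of _ b]) auto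
  moreover have "seg_le B C b a b y" unfolding seg_le_def using y(1) cong_refl by (intro exI[of _ a]) auto
  ultimately show ?thesis
    using circle_circle[OF assms cong_refl, of b b a y] y(2) by blast
qed

lemma equilateral_not_col: assumes "a \<noteq> b" "C a c a b" "C b c b a" shows "\<not> col a b c"
proof
  assume c: "col a b c"
  have "C c a c b" using assms cong_sym cong_trans cong_flips by meson
  hence m: "mid c a b" using equidist_col[OF assms(1)] c col_perm(4) by blast
  have "bt a c b" "C a c a b" using m assms unfolding mid_def by blast+
  moreover have "bt a b b" by simp
  obtain x where x: "x \<noteq> a" "bt x a b"
  proof -
    obtain x where "B b a x" using beyond assms(1) by metis
    thus ?thesis using that bet_ne bet_iff bt_sym by metis
  qed
  have "bt x a c" using bt_inner1[OF x(2) calculation(1)] .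
  hence "c = b" using extend_unique[OF x(1) _ x(2)] calculation(2) by blast
  thus False using m assms(1) by simp
qed

text \<open>
  The midpoint of \<open>ab\<close> is found from an isosceles triangle \<open>abc\<close> by prolonging its
  legs to \<open>p\<close> and \<open>q\<close> by the same length. The segments \<open>aq\<close> and
  \<open>bp\<close> cross in a point \<open>r\<close> of the axis, and the axis \<open>cr\<close> meets
  \<open>ab\<close> in the midpoint; both crossings come from inner Pasch. The construction is split into one
  lemma per application, because the calculus has to go through the same two existential steps.
\<close>

lemma isosceles_setup:
  assumes "\<not> col a b c" "C c a c b" "bt c a p" "C a p a b" "bt c b q" "C b q a b"
  shows "B p a c" "B q b c" "\<not> col p q c"
proof -
  have ne: "a \<noteq> b" "a \<noteq> c" "b \<noteq> c" using assms(1) col_triv by blast+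
  have pq: "a \<noteq> p" "b \<noteq> q" using assms(4,6) cong_null2 ne(1) by blast+
  have bb: "B c a p" "B c b q" using bet_iff[of c a p] bet_iff[of c b q] assms ne pq by blast+
  show "B p a c" "B q b c" using bb bet_sym by blast+
  show "\<not> col p q c"
  proof
    assume "col p q c"
    hence 1: "col c p q" using col_perm by blast
    have pc: "c \<noteq> p" "c \<noteq> q" using bb bet_ne by blast+
    have "col c p a" using bet_col[OF bb(1)] col_perm(4) by blast
    hence "col c q a" using col_trans[OF pc(1) 1] by blast
    moreover have "col c q b" using bet_col[OF bb(2)] col_perm(4) by blast
    ultimately have "col c a b" using col_trans[OF pc(2)] by blast
    thus False using assms(1) col_perm by blast
  qed
qed

text \<open>
  The crossing point is on the axis: the reflection in the axis exchanges \<open>aq\<close> and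
  \<open>bp\<close>, so it maps \<open>r\<close> to a common point \<open>r'\<close> of these two lines, which
  is \<open>r\<close> itself.
\<close>

lemma isosceles_crossing:
  assumes "\<not> col a b c" "C c a c b" "bt c a p" "C a p a b" "bt c b q" "C b q a b"
    "B a r q" "B b r p"
  shows "\<not> col c b p" "B c a p" "C r a r b"
proof -
  note s = isosceles_setup[OF assms(1-6)]
  show cap: "B c a p" using s bet_sym by blast
  have cbq: "B c b q" using s bet_sym by blast
  have ne: "a \<noteq> b" "a \<noteq> c" "b \<noteq> c" using assms(1) col_triv by blast+
  show "\<not> col c b p"
  proof
    assume "col c b p"
    hence "col c p b" using col_perm by blast
    moreover have "col c p a" using bet_col[OF cap] col_perm(4) by blast
    ultimately have "col c a b" using col_trans bet_ne[OF cap] by blast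
    thus False using assms(1) col_perm by blast
  qed
  have ca: "c \<noteq> a" using ne by blast
  have abpq: "C a p b q" using assms(4,6) cong_sym cong_trans by blast
  have "C p b q a" using five_segment[OF ca assms(3,5,2) abpq assms(2)[THEN cong_sym] cong_flip] .
  hence bp: "C b p a q" using cong_flips by blast
  obtain r' where r': "bt a r' q" "C b r a r'" "C r p r' q"
    using transfer_between[OF _ bp] assms(8) bet_iff by blast
  have br: "bt b r p" using assms(8) bet_iff by blast
  have ar: "bt a r q" using assms(7) bet_iff by blast
  have "C r a r' b" using inner_five[OF br r'(1) bp r'(3) cong_flip] abpq cong_flips by blast
  moreover have "C r q r' p"
    using inner_five[OF br r'(1) bp r'(3), of q p] assms(4,6) cong_flip cong_flips cong_sym cong_trans by meson
  moreover have "C a q b p" using bp cong_sym by blast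
  ultimately have br': "bt b r' p" using between_cong[OF ar] cong_flips by blast
  have "r = r'"
  proof (rule ccontr)
    assume n: "r \<noteq> r'"
    have 1: "col a q r" "col a q r'" "col b p r" "col b p r'"
      using ar r'(1) br br' bt_col col_perm(4) by blast+
    have aq: "a \<noteq> q" "b \<noteq> p" using assms(7,8) bet_ne by blast+
    have "col r r' a" "col r r' q" "col r r' b" "col r r' p"
      using col_line[OF aq(1) 1(1,2)] col_line[OF aq(2) 1(3,4)] by simp_all
    hence "col a b q" "col a b p" using col_line[OF n] by blast+
    hence "col a b c" using col_line2[of b q a b c] cbq bet_ne[OF cbq] bet_col ne col_perm by (metis col_triv)
    thus False using assms by blast
  qed
  hence "C b r a r" using r'(2) by blast
  thus "C r a r b" using cong_sym cong_flips by blast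
qed

lemma isosceles_midpoint:
  assumes "\<not> col a b c" "C c a c b" "C r a r b" "B a x b" "B r x c"
  shows "mid x a b"
proof -
  have "c \<noteq> r" "col c r x" using bet_ne[OF assms(5)] bet_col[OF assms(5)] col_perm by blast+
  hence "C x a x b" using line_cong[OF _ _ assms(2,3)] by blast
  thus ?thesis using assms(4) bet_iff cong_flips unfolding mid_def by blast
qed

lemma midpoint_exists: assumes "a \<noteq> b" shows "\<exists>m. mid m a b"
proof -
  obtain c where c: "C a c a b" "C b c b a" using equilateral assms by blast
  have nc: "\<not> col a b c" using equilateral_not_col assms c by blast
  have i: "C c a c b" using c cong_sym cong_trans cong_flips by meson
  obtain p q where pq: "bt c a p" "C a p a b" "bt c b q" "C b q a b" using extend_any by metis
  note s = isosceles_setup[OF nc i pq]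
  obtain r where r: "B a r q" "B b r p" using pasch[OF s(3,1,2)] by blast
  note k = isosceles_crossing[OF nc i pq r]
  obtain x where "B a x b" "B r x c" using pasch[OF k(1,2) r(2)] by blast
  thus ?thesis using isosceles_midpoint[OF nc i k(3)] by blast
qed

section \<open>Right angles\<close>

text \<open>
  The angle at \<open>b\<close> is right if \<open>a\<close> is equidistant from \<open>c\<close> and its
  reflection in \<open>b\<close>. Degenerate angles with \<open>a = b\<close> or \<open>b = c\<close> count as
  right.
\<close>

definition right_angle where "right_angle a b c \<longleftrightarrow> (\<exists>c'. mid b c c' \<and> C a c a c')"

lemma right_angle_refl: "mid b c c' \<Longrightarrow> right_angle a b c \<Longrightarrow> C a c a c'"
  unfolding right_angle_def using mid_unique by blast

lemma right_angle_sym: assumes "right_angle a b c" shows "right_angle c b a"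
proof -
  obtain c' where c': "mid b c c'" "C a c a c'" using assms right_angle_def by blast
  obtain a' where a': "mid b a a'" using mid_ex by blast
  have "C a c' a' c" using reflect_cong[OF a' mid_sym[OF c'(1)]] .
  hence "C a c a' c" using c'(2) cong_trans by blast
  thus ?thesis unfolding right_angle_def using a' cong_flips by blast
qed

lemma right_angle_line: assumes "right_angle a b c" "a \<noteq> b" "col b a a'" shows "right_angle a' b c"
proof -
  obtain c' where c': "mid b c c'" "C a c a c'" using assms right_angle_def by blast
  have "C a' c a' c'" using line_cong[OF assms(2)[symmetric] assms(3) mid_cong[OF c'(1)] c'(2)] .
  thus ?thesis unfolding right_angle_def using c' by blast
qed

lemma right_angle_line2: assumes "right_angle a b c" "c \<noteq> b" "col b c c'" shows "right_angle a b c'"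
  using right_angle_sym[OF right_angle_line[OF right_angle_sym[OF assms(1)] assms(2,3)]] .

lemma right_angle_reflect: assumes "right_angle a b c" "mid o1 a a'" "mid o1 b b'" "mid o1 c c'" shows "right_angle a' b' c'"
proof -
  obtain d where d: "mid b c d" "C a c a d" using assms right_angle_def by blast
  obtain d' where d': "mid o1 d d'" using mid_ex by blast
  have "C a' c' a c" "C a d a' d'" using reflect_cong assms(2,4) d' mid_sym by blast+
  hence "C a' c' a' d'" using d(2) cong_trans by blast
  moreover have "bt c' b' d'" using reflect_bt[OF assms(4,3) d'] d(1) mid_def by blast
  moreover have "C c' b' b' d'" 
    using reflect_cong[OF assms(4,3)] reflect_cong[OF assms(3) d'] d(1) cong_sym cong_trans
    unfolding mid_def by blast
  ultimately show ?thesis unfolding right_angle_def mid_def by blast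
qed

lemma right_angle_cong: assumes "right_angle a b c" "C a b a' b'" "C b c b' c'" "C a c a' c'" shows "right_angle a' b' c'"
proof (cases "b = c")
  case True
  hence "b' = c'" using assms cong_null2 by blast
  thus ?thesis unfolding right_angle_def using cong_refl by (intro exI[of _ c']) auto
next
  case False
  obtain d where d: "mid b c d" "C a c a d" using assms right_angle_def by blast
  obtain d' where d': "mid b' c' d'" using mid_ex by blast
  have 1: "bt c b d" "bt c' b' d'" "C b c b d" "C b' c' b' d'" using d d' mid_def mid_cong by blast+
  have 2: "C b d b' d'" using 1(3,4) assms(3) cong_sym cong_trans by meson
  have "C d a d' a'" using five_segment[OF False[symmetric] 1(1,2) _ 2, of a a'] assms cong_flips by blast
  hence "C a d a' d'" using cong_flips by blast
  hence "C a' c' a' d'" using assms(4) d(2) cong_sym cong_trans by meson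
  thus ?thesis unfolding right_angle_def using d' by blast
qed

text \<open>
  Equidistance of \<open>a\<close> and \<open>a'\<close> from \<open>c\<close> and its reflection
  \<open>c'\<close> passes to every point of the line \<open>aa'\<close>, in particular to \<open>c\<close>.
\<close>

lemma right_angle_bt: assumes "right_angle a b c" "right_angle a' b c" "bt a c a'" shows "b = c"
proof -
  obtain c' where c': "mid b c c'" using mid_ex by blast
  have 1: "C a c a c'" "C a' c a' c'" using right_angle_refl[OF c'] assms by blast+
  have "c = c'"
  proof (cases "a = a'")
    case True
    hence "a = c" using assms(3) bt_ident by blast
    thus ?thesis using 1 cong_null2 by blast
  next
    case False
    thus ?thesis using line_cong_eq[OF False _ 1] bt_col[OF assms(3)] col_perm by blast
  qed
  thus ?thesis using c' by simp
qed

text \<open>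
  A triangle has at most one right angle. Let \<open>c'\<close> be the reflection of \<open>c\<close> in
  \<open>b\<close>, and \<open>a'\<close> that of \<open>a\<close> in \<open>c\<close>. If the angles at
  \<open>b\<close> and \<open>c\<close> are right, then \<open>a\<close> and \<open>a'\<close> are both
  equidistant from \<open>c\<close> and \<open>c'\<close>, hence so is \<open>c\<close>, which lies between
  them.
\<close>

lemma two_right_angles: assumes "right_angle a b c" "right_angle a c b" shows "b = c"
proof (rule ccontr)
  assume n: "b \<noteq> c"
  obtain c' where c': "mid b c c'" "C a c a c'" using assms right_angle_def by blast
  obtain a' where a': "mid c a a'" using mid_ex by blast
  have "col c b c'" using mid_col[OF c'(1)] by blast
  hence "right_angle a c c'" using right_angle_line2[OF assms(2) n] by blast
  hence "C c' a c' a'" using right_angle_refl[OF a'] right_angle_sym by blast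
  moreover have "C a c a' c" using mid_cong[OF a'] cong_flips by blast
  ultimately have "C a' c a' c'" using c'(2) cong_sym cong_trans cong_flips by meson
  hence "right_angle a' b c" unfolding right_angle_def using c' by blast
  thus False using right_angle_bt[OF assms(1)] a' n mid_def by blast
qed

lemma right_angle_not_col: assumes "right_angle a b c" "a \<noteq> b" "c \<noteq> b" shows "\<not> col a b c"
proof
  assume c: "col a b c"
  have "right_angle c b c" using right_angle_line[OF assms(1,2)] c col_perm by blast
  then obtain c' where "mid b c c'" "C c c c c'" using right_angle_def by blast
  thus False using cong_null2 assms(3) by (metis mid_same2)
qed

text \<open>
  A line and its image under a reflection in a point \<open>t\<close> off the line are disjoint: the
  reflection exchanges them, so a common point and its image would be two common points.
\<close>

lemma reflected_lines_disjoint: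
  assumes p: "mid t p q" and s: "mid t s r" and n: "\<not> col s q p"
  shows "\<not> (col p r x \<and> col s q x)"
proof
  assume x: "col p r x \<and> col s q x"
  have sq: "s \<noteq> q" using n col_triv by blast
  hence pr: "p \<noteq> r" using reflect_inj[OF s mid_sym[OF p]] by blast
  obtain x' where x': "mid t x x'" using mid_ex by blast
  have 1: "col q s x'" "col r p x'" 
    using reflect_col[OF p mid_sym[OF s] x'] reflect_col[OF s mid_sym[OF p] x'] x by blast+
  hence 2: "col s q x'" "col p r x'" using col_perm(3) by blast+
  show False
  proof (cases "x = x'")
    case True
    hence "x = t" using x' by simp
    hence t: "col s q t" using x by blast
    have "t \<noteq> q" using p n col_triv mid_same by metis
    moreover have "col t q p" using mid_col[OF p] col_perm by blast
    ultimately have "col s q p" using col_line2[OF _ t _ _ sq] by simp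
    thus False using n by blast
  next
    case False
    have "col x x' p" using col_line[OF pr _ 2(2), of x p] x by simp
    thus False using col_line2[OF False _ 2(1) _ sq] x n by blast
  qed
qed

section \<open>Separation of points by a line\<close>

text \<open>
  A point of the line \<open>uv\<close> lies strictly between \<open>a\<close> and \<open>c\<close>. That
  \<open>a\<close> and \<open>c\<close> are off the line is a separate hypothesis where it matters.
\<close>

definition separated where "separated u v a c \<longleftrightarrow> (\<exists>t. col u v t \<and> B a t c)"

lemma separated_sym: "separated u v a c \<Longrightarrow> separated u v c a" unfolding separated_def using bet_sym by blast

lemma separated_off: assumes "u \<noteq> v" "\<not> col u v a" "col u v t" "B a t c" shows "\<not> col u v c"
proof
  assume "col u v c"
  moreover have "t \<noteq> c" "col t c a" using assms(4) bet_ne bet_col col_perm by blast+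
  ultimately have "col u v a" using col_line2[of t c u v a] assms by blast
  thus False using assms by blast
qed

text \<open>
  Moving \<open>a\<close> towards a point \<open>r\<close> of the line does not leave its side: this is inner
  Pasch.
\<close>

lemma separated_closer:
  assumes uv: "u \<noteq> v" and r: "col u v r" and a: "\<not> col u v a" and ac: "separated u v a c" and b: "B r b a"
  shows "separated u v b c"
proof -
  obtain t where t: "col u v t" "B a t c" using ac separated_def by blast
  show ?thesis
  proof (cases "r = t")
    case True
    have "bt c t b" using bt_inner1[of c t a b] t(2) b True bet_sym bet_iff by metis
    thus ?thesis using t True b bet_ne bet_iff bet_sym unfolding separated_def by metis
  next
    case False
    have "\<not> col c r a"
    proof
      assume "col c r a"
      hence 1: "col a c r" using col_perm by blast
      have "col a c t" "a \<noteq> c" using bet_col[OF t(2)] bet_ne[OF t(2)] col_perm(4) by blast+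
      hence "col t r a" using col_line[of a c t r a] 1 by simp
      thus False using col_line2[OF False[symmetric] t(1) r _ uv] a by blast
    qed
    then obtain x where x: "B t x r" "B b x c" using pasch[of c r a t b] t(2) b bet_sym by blast
    have "col t r x" using bet_col[OF x(1)] col_perm(4) by blast
    hence "col u v x" using col_line2[OF False[symmetric] t(1) r _ uv] by blast
    thus ?thesis unfolding separated_def using x by blast
  qed
qed

text \<open>
  Moving \<open>a\<close> away from \<open>r\<close> is an instance of outer Pasch. If the point where
  \<open>ac\<close> crosses the line is the midpoint of \<open>ac\<close>, it follows from inner Pasch:
  reflection in this midpoint maps \<open>a\<close> to \<open>c\<close> and keeps the line, so
  \<open>c\<close> lies on the segment from the image of \<open>r\<close> to the image of \<open>b\<close>.
\<close>

lemma separated_mid: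
  assumes uv: "u \<noteq> v" and r: "col u v r" and a: "\<not> col u v a" and t: "col u v t" and ac: "mid t a c"
    and b: "B r a b"
  shows "separated u v b c"
proof -
  have at: "a \<noteq> t" using a t by blast
  have act: "B a t c" using mid_bet[OF ac at] .
  show ?thesis
  proof (cases "r = t")
    case True
    have "bt b t c" using bt_outer2[of c t a b] act b True bet_sym bet_iff bt_sym by metis
    thus ?thesis using t True b bet_ne act bet_iff unfolding separated_def by metis
  next
    case rt: False
    obtain r' where r': "mid t r r'" using mid_ex by blast
    obtain b' where b': "mid t b b'" using mid_ex by blast
    have rcb: "B r' c b'" using reflect_bet[OF r' ac b' b] .
    have tr': "t \<noteq> r'" "col t r' r" "col t r r'" using r' rt mid_ne mid_col col_perm by blast+
    have r'A: "col u v r'" using col_line2[OF rt[symmetric] t r tr'(3) uv] .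
    have bA: "\<not> col u v b"
    proof
      assume "col u v b"
      hence "col u v a" using col_line2[OF _ r _ _ uv, of b a] bet_ne[OF b] bet_col[OF b] col_perm(4) by blast
      thus False using a by blast
    qed
    have btb: "B b t b'" using mid_bet[OF b'] bA t by blast
    have "\<not> col b r' b'"
    proof
      assume "col b r' b'"
      hence 1: "col b b' r'" using col_perm by blast
      have "col b b' t" "b \<noteq> b'" using bet_col[OF btb] bet_ne[OF btb] col_perm(4) by blast+
      hence "col t r' b" using col_line[of b b' t r' b] 1 by simp
      thus False using col_line2[OF tr'(1) t r'A _ uv] bA by blast
    qed
    then obtain x where x: "B t x r'" "B c x b" using pasch[OF _ btb rcb] by blast
    have "col t r' x" using bet_col[OF x(1)] col_perm(4) by blast
    hence "col u v x" using col_line2[OF tr'(1) t r'A _ uv] by blast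
    thus ?thesis unfolding separated_def using x bet_sym by blast
  qed
qed

end

locale euclidean_plane = neutral_plane +
  assumes parallel_unique: "l \<noteq> l' \<Longrightarrow> p \<noteq> a \<Longrightarrow> p \<noteq> b \<Longrightarrow> (\<And>x. \<not> (col p a x \<and> col l l' x)) \<Longrightarrow>
     (\<And>x. \<not> (col p b x \<and> col l l' x)) \<Longrightarrow> col p a b"
begin

text \<open>
  Outer Pasch in general, by reduction to the case of a midpoint. Let \<open>ac\<close> cross the line in
  \<open>t\<close>, and let \<open>a'\<close> be the reflection of \<open>c\<close> in \<open>t\<close>. If
  \<open>a'\<close> is not beyond \<open>a\<close>, use the reflection of \<open>a\<close> instead of
  \<open>c\<close> and then move from it towards \<open>t\<close>. If it is, then \<open>a'\<close> is
  separated from \<open>c\<close> with midpoint \<open>t\<close>, and \<open>b\<close> is reached from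
  \<open>a'\<close> along the line \<open>a'b\<close>, provided that this line meets \<open>uv\<close>. By
  uniqueness of parallels this can only fail for one point \<open>b\<close> on the ray, and then one passes to
  a point \<open>d\<close> beyond \<open>b\<close> and comes back.
\<close>

lemma separated_farther:
  assumes uv: "u \<noteq> v" and r: "col u v r" and a: "\<not> col u v a" and ac: "separated u v a c" and b: "B r a b"
  shows "separated u v b c"
proof -
  obtain t where t: "col u v t" "B a t c" using ac separated_def by blast
  have bA: "\<not> col u v b" if "B r a b" for b
  proof
    assume "col u v b"
    hence "col u v a" using col_line2[OF _ r _ _ uv, of b a] bet_ne[OF that] bet_col[OF that] col_perm(4) by blast
    thus False using a by blast
  qed
  have cA: "\<not> col u v c" using separated_off[OF uv a t] .
  obtain a' where a': "mid t c a'" using mid_ex by blast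
  have ct: "B c t a'" using mid_bet[OF a'] t(1) cA by blast
  have a'A: "\<not> col u v a'" using separated_off[OF uv cA t(1) ct] .
  have ne: "c \<noteq> t" "t \<noteq> a" "a \<noteq> t" using bet_ne[OF t(2)] by blast+
  have order: "bt t a a' \<or> bt t a' a"
    using conn2[OF ne(1), of a a'] t(2) ct bet_sym bet_iff by blast
  show ?thesis
  proof (cases "r = t")
    case True
    have "bt b t c" using bt_outer2[of c t a b] t(2) b True bet_sym bet_iff bt_sym by metis
    thus ?thesis using t True b bet_ne bet_iff unfolding separated_def by metis
  next
    case rt: False
    have meets: "separated u v b c" if tr: "bt t a a'" "a \<noteq> a'" and b: "B r a b" and r': "col u v r'" "col b a' r'" for b r'
    proof (cases "b = a'")
      case True
      thus ?thesis unfolding separated_def using t(1) ct bet_sym by blast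
    next
      case False
      have taa: "B t a a'" using tr ne bet_iff by blast
      have n: "\<not> B b r' a'"
      proof
        assume br: "B b r' a'"
        have "\<not> col t r a'" using col_line2[OF rt[symmetric] t(1) r _ uv] a'A by blast
        moreover have "\<not> col r a' b"
        proof
          assume "col r a' b"
          hence "col r b a'" using col_perm by blast
          moreover have "col r b a" using bet_col[OF b] col_perm(4) by blast
          ultimately have raa: "col r a a'" using col_trans[of r b a a'] bet_ne[OF b] by blast
          have taa': "col a' a t" using bet_col[OF taa] col_perm(5) by blast
          have "col a' a r" using col_perm(5)[OF raa] .
          hence "col a' r t" using col_trans[OF tr(2)[symmetric] _ taa'] by blast
          thus False using col_perm(5) \<open>\<not> col t r a'\<close> by blast
        qed
        ultimately obtain z where z: "B a z a'" "B r' z r"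
          using pasch[of r a' b a r'] b br bet_sym by blast
        have zA: "col u v z"
        proof (cases "r' = r")
          case True thus ?thesis using z bet_irrefl by blast
        next
          case False
          thus ?thesis using col_line2[OF False r'(1) r _ uv] bet_col[OF z(2)] col_perm(4) by blast
        qed
        have azs: "bt a z a'" "bt t a a'" using z(1) taa bet_iff by blast+
        have "t \<noteq> z" using bt_inner1[OF azs(2,1)] bt_ident ne(2) by blast
        hence tz: "B t z a'"
          using bt_inner2[OF azs(2,1)] bet_ne[OF z(1)] bet_iff by blast
        have "col t z a'" "t \<noteq> z" using bet_col[OF tz] bet_ne[OF tz] by blast+
        thus False using col_line2[OF _ t(1) zA _ uv] a'A by blast
      qed
      have ne': "r' \<noteq> b" "r' \<noteq> a'" using r'(1) bA[OF b] a'A by blast+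
      consider "B r' b a'" | "B r' a' b"
        using r'(2) n False ne' bet_sym[of a' r' b] bet_sym[of a' b r'] bet_sym[of b a' r']
        unfolding col_def bt_iff by blast
      thus ?thesis
      proof cases
        case 1
        have "separated u v a' c" unfolding separated_def using t(1) ct bet_sym by blast
        thus ?thesis using separated_closer[OF uv r'(1) a'A _ 1] by blast
      next
        case 2
        show ?thesis using separated_mid[OF uv r'(1) a'A t(1) mid_sym[OF a'] 2] .
      qed
    qed
    show ?thesis
    proof (cases "bt t a a' \<and> a \<noteq> a'")
      case far: True
      show ?thesis
      proof (cases "\<exists>r'. col u v r' \<and> col b a' r'")
        case True
        thus ?thesis using meets far b by blast
      next
        case nb: False
        have ba': "b \<noteq> a'"
          using nb col_triv r by metis
        obtain d where d: "B a b d" using beyond bet_ne[OF b] by blast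
        have rad: "B r a d" "B r b d"
          using bt_outer2[of r a b d] bt_outer1[of r a b d] b d bet_ne[OF b] bet_ne[OF d]
            bet_iff[of r a b] bet_iff[of a b d] bet_iff[of r a d] bet_iff[of r b d] by blast+
        have da': "d \<noteq> a'" if "\<not> (\<exists>r'. col u v r' \<and> col d a' r')"
          using that col_triv r by metis
        have "\<exists>r'. col u v r' \<and> col d a' r'"
        proof (rule ccontr)
          assume nd: "\<nexists>r'. col u v r' \<and> col d a' r'"
          have "col a' b d"
            using parallel_unique[OF uv, of a' b d] ba' da'[OF nd] nb nd col_perm(3) by blast
          hence "col b d a'" using col_perm by blast
          moreover have "col b d a" using bet_col[OF d] col_perm by blast
          ultimately have 1: "col a a' b" "b \<noteq> a"
            using col_trans[of b d a a'] bet_ne[OF d] col_perm by blast+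
          have "col b a r" using bet_col[OF b] col_perm by blast
          moreover have "col b a a'" using 1 col_perm by blast
          ultimately have 2: "col a a' r" using col_line[OF 1(2), of a a' r] by simp
          have "col a a' t" using far bt_col col_perm by blast
          hence "col r t a" using col_line[of a a' r t a] 2 far by simp
          thus False using col_line2[OF rt r t(1) _ uv] a by blast
        qed
        hence "separated u v d c" using meets far rad by blast
        thus ?thesis using separated_closer[OF uv r bA[OF rad(1)] _ rad(2)] by blast
      qed
    next
      case False
      hence near: "bt t a' a" using order bt_triv by blast
      obtain c1 where c1: "mid t a c1" using mid_ex by blast
      have 1: "separated u v b c1" using separated_mid[OF uv r a t(1) c1 b] .
      have ac1: "B a t c1" using mid_bet[OF c1 ne(3)] .
      have c1A: "\<not> col u v c1" using separated_off[OF uv a t(1) ac1] .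
      have tcc: "bt t c c1" using reflect_bt[OF _ mid_sym[OF a'] c1 near, of t] by simp
      show ?thesis
      proof (cases "c = c1")
        case True thus ?thesis using 1 by blast
      next
        case False
        hence "B t c c1" using tcc ne bet_iff by metis
        thus ?thesis using separated_sym[OF separated_closer[OF uv t(1) c1A separated_sym[OF 1]]] by blast
      qed
    qed
  qed
qed

lemma separated_ray:
  assumes "u \<noteq> v" "col u v r" "\<not> col u v a" "separated u v a c" "bt r a b \<or> bt r b a" "r \<noteq> b"
  shows "separated u v b c"
  using separated_farther separated_closer assms bet_iff by metis

section \<open>A hypotenuse is longer than a leg\<close>

text \<open>In a triangle \<open>mlw\<close> with a right angle at \<open>w\<close> the leg \<open>mw\<close> cannot be longer than the hypotenuse \<open>ml\<close>. Suppose it is, and let \<open>x\<close> on \<open>mw\<close>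
have the same distance from \<open>m\<close> as \<open>l\<close>. The perpendicular to \<open>mw\<close> at \<open>x\<close> runs between \<open>m\<close> and \<open>l\<close>, since it is parallel to \<open>lw\<close>. So the
angle \<open>lxm\<close> is obtuse when compared with the perpendicular to \<open>xm\<close>. An angle can be compared with the perpendicular to either of its sides;
exchanging the sides shows that the perpendicular to \<open>xl\<close> at \<open>x\<close> also runs between \<open>l\<close> and \<open>m\<close>. But the angle is a base angle of the
isosceles triangle \<open>mlx\<close>: the perpendicular to \<open>xl\<close> at the midpoint \<open>h\<close> of \<open>xl\<close> passes through \<open>m\<close>, and would have to cross the one at \<open>x\<close>.\<close>

lemma leg_not_longer:
  assumes mxw: "B m x w" and mx: "C m x m l" and w: "right_angle l w m" and lw: "l \<noteq> w"
  shows False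
proof -
  have mw: "m \<noteq> w" "m \<noteq> x" "x \<noteq> w" using bet_ne[OF mxw] by blast+
  have nc: "\<not> col m w l" using right_angle_not_col[OF w lw mw(1)] col_perm by blast
  have colmw: "col m w x" using bet_col[OF mxw] col_perm by blast
  have xl: "x \<noteq> l" using colmw nc by blast
  \<comment> \<open>The perpendicular at \<open>x\<close> is the reflection of the line \<open>lw\<close> in the midpoint of \<open>xw\<close>.\<close>
  obtain c where c: "mid c x w" using midpoint_exists mw(3) by blast
  obtain y0 where y0: "mid c l y0" using mid_ex by blast
  obtain m0 where m0: "mid c m m0" using mid_ex by blast
  have cx: "c \<noteq> x" "c \<noteq> w" using c mid_same mw by metis+
  have cxw: "B x c w" using mid_bet[OF c] cx by blast
  have mwc: "col m w c" using col_line2[of x w m w c] colmw bet_col[OF cxw] col_perm(4) mw by auto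
  have p0: "right_angle y0 x m0" using right_angle_reflect[OF w y0 mid_sym[OF c] m0] .
  have m0w: "col m w m0"
  proof (cases "m = c")
    case True thus ?thesis using m0 by simp
  next
    case False
    thus ?thesis using col_line2[of m c m w m0] mwc mid_col[OF m0] mw by simp
  qed
  have xm0: "x \<noteq> m0" using reflect_inj[OF m0 mid_sym[OF c] mw(1)] by blast
  have "col x m0 m" using col_line[of m w x m0 m] colmw m0w mw by simp
  hence p1: "right_angle y0 x m" using right_angle_line2[OF p0] xm0 by blast
  have y0x: "y0 \<noteq> x" using reflect_inj[OF y0 mid_sym[OF c] lw] .
  have nA: "\<not> col y0 x m" using right_angle_not_col[OF p1 y0x mw(2)] .
  have bmxc: "B m x c" using mxw cxw bt_inner1[of m x w c] bet_iff cx by metis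
  have "separated y0 x m c" unfolding separated_def using bmxc col_triv by blast
  have cA: "\<not> col y0 x c" using separated_off[OF y0x nA _ bmxc] by simp
  have lc: "l \<noteq> c" using mwc nc by blast
  have y0cl: "B y0 c l" using mid_bet[OF y0 lc] bet_sym by blast
  have "separated y0 x l m"
    using separated_farther[OF y0x _ cA separated_sym[OF \<open>separated y0 x m c\<close>] y0cl] by simp
  hence lm: "separated y0 x m l" using separated_sym by blast
  \<comment> \<open>With \<open>xm' = xl\<close> the sides of the angle \<open>lxm'\<close> are exchanged by a reflection, which maps \<open>y1\<close> to \<open>n\<close>.\<close>
  obtain m' where m': "B w x m'" "C x m' x l" using extend_strict mw xl by metis
  have wxm: "B w x m" using mxw bet_sym by blast
  have ray: "bt x m m' \<or> bt x m' m"
    using conn2[of w x m m'] m'(1) wxm bet_iff mw by blast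
  have xm': "x \<noteq> m'" using bet_ne[OF m'(1)] by blast
  have "separated y0 x m' l" using separated_ray[OF y0x _ nA lm ray xm'] by simp
  then obtain y1 where y1: "col y0 x y1" "B m' y1 l" unfolding separated_def by blast
  have colxmm': "col x m m'" using ray col_perm unfolding col_def by blast
  have pm': "right_angle y0 x m'" using right_angle_line2[OF p1 mw(2) colxmm'] .
  have p2: "right_angle y1 x m'" using right_angle_line[OF pm' y0x] y1(1) col_perm by blast
  have lm': "C m' l l m'" using cong_flip .
  obtain n where n: "bt l n m'" "C m' y1 l n" "C y1 l n m'"
    using transfer_between[OF _ lm', of y1] y1(2) bet_iff by blast
  have "bt m' y1 l" using y1 bet_iff by blast
  hence ny: "C y1 x n x" using inner_five[OF _ n(1) lm' n(3), of x x] m'(2) cong_sym cong_flips by blast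
  have lx: "C x m' x l" using m'(2) .
  have p3: "right_angle n x l" using right_angle_cong[OF p2 ny lx] n(2) cong_flips by blast
  have nb: "B l n m'" 
  proof -
    have "l \<noteq> n" using n(2) y1(2) bet_ne cong_null by blast
    moreover have "n \<noteq> m'" using n(3) y1(2) bet_ne cong_null by blast
    ultimately show ?thesis using n(1) bet_iff by blast
  qed
  have nx: "n \<noteq> x"
  proof
    assume "n = x"
    hence "col x m' l" using bet_col[OF nb] col_perm by blast
    hence "col x m l" using col_trans[OF xm', of m l] colxmm' col_perm(4) by blast
    moreover have "col m w x" by (rule colmw)
    ultimately have "col m w l" using col_line2[of x m m w l] mw by simp
    thus False using nc by blast
  qed
  have nl: "\<not> col n x l" using right_angle_not_col[OF p3 nx] xl by blast
  have lnm: "separated n x l m'" unfolding separated_def using nb col_triv by blast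
  have m'n: "\<not> col n x m'" using separated_off[OF nx nl _ nb] by simp
  have ray': "bt x m' m \<or> bt x m m'" using ray by blast
  have "separated n x m l" using separated_ray[OF nx _ m'n separated_sym[OF lnm] ray'] mw by auto
  then obtain n2 where n2: "col n x n2" "B m n2 l" unfolding separated_def by blast
  have p4: "right_angle n2 x l" using right_angle_line[OF p3 nx] n2(1) col_perm by blast
  obtain h where h: "mid h x l" using midpoint_exists xl by blast
  have hx: "h \<noteq> x" "h \<noteq> l" using h mid_same xl by metis+
  have bh: "B x h l" using mid_bet[OF h] hx by blast
  have pm: "right_angle m h l" unfolding right_angle_def using mid_sym[OF h] mx cong_sym by blast
  have "\<not> col x m l"
  proof
    assume "col x m l"
    hence "col m w l" using col_line2[of x m m w l] colmw mw by simp
    thus False using nc by blast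
  qed
  then obtain z where z: "B h z m" "B n2 z x" using pasch[OF _ bh n2(2)] by blast
  have hxl: "col h l x" "col x l h" using bet_col[OF bh] col_perm by blast+
  have "right_angle m h x" using right_angle_line2[OF pm _ hxl(1)] hx by blast
  moreover have "m \<noteq> h" using z bet_ne by blast
  moreover have "col h m z" "col x n2 z" using bet_col[OF z(1)] bet_col[OF z(2)] col_perm by blast+
  ultimately have "right_angle z h x" using right_angle_line by blast
  moreover have "n2 \<noteq> x" using bet_ne[OF z(2)] by blast
  have "right_angle n2 x h" using right_angle_line2[OF p4 _ hxl(2)] xl by blast
  hence "right_angle z x h" using right_angle_line \<open>n2 \<noteq> x\<close> \<open>col x n2 z\<close> by blast
  ultimately have "h = x" using two_right_angles by blast
  thus False using hx by blast
qed

end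

context neutral_plane begin

section \<open>The parallel axioms in a classical structure\<close>

text \<open>
  Reflection in the midpoint of \<open>pl\<close> gives a line \<open>pr\<close>. By the strong parallel
  postulate every other line through \<open>p\<close> meets the line \<open>ll'\<close>, so a line through
  \<open>p\<close> that does not meet it is \<open>pr\<close>.
\<close>

lemma parallel_unique_if_strong_parallel:
  assumes spp: "\<And>p q r s t a. B p t q \<Longrightarrow> B s t r \<Longrightarrow> C p t q t \<Longrightarrow> C r t s t \<Longrightarrow> p \<noteq> r \<Longrightarrow>
     \<not> lies p s q \<Longrightarrow> \<not> lies a p r \<Longrightarrow> \<exists>x. lies x s q \<and> lies x p a"
  shows "euclidean_plane B C"
proof unfold_locales
  fix l l' p a b
  assume ll: "l \<noteq> l'" and pa: "p \<noteq> a" and pb: "p \<noteq> b"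
    and da: "\<And>x. \<not> (col p a x \<and> col l l' x)" and db: "\<And>x. \<not> (col p b x \<and> col l l' x)"
  have pL: "\<not> col l l' p" using da[of p] by simp
  have pl: "p \<noteq> l" using pL by auto
  obtain t where t: "mid t p l" using midpoint_exists pl by blast
  obtain r where r: "mid t l' r" using mid_ex by blast
  have tn: "t \<noteq> p" using t pl by auto
  have l't: "l' \<noteq> t" using mid_col[OF t] pL col_perm(1) col_perm(2) col_perm(5) by metis
  have b1: "B p t l" "B l' t r" using mid_bet[OF t tn(1)[symmetric]] mid_bet[OF r l't] .
  have pr: "p \<noteq> r" using reflect_inj[OF mid_sym[OF t] r ll] by blast
  have c1: "C p t l t" using mid_cong[OF t] cong_flips by blast
  have c2: "C r t l' t" using cong_sym[OF mid_cong[OF r]] cong_flips by blast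
  have np: "\<not> lies p l' l" using lies_iff[OF ll[symmetric]] pL col_perm(3) by blast
  have on: "col p r x" if "p \<noteq> x" "\<And>y. \<not> (col p x y \<and> col l l' y)" for x
  proof (rule ccontr)
    assume "\<not> col p r x"
    hence "\<not> lies x p r" using lies_iff[OF pr] by blast
    then obtain y where "lies y l' l" "lies y p x" using spp[OF b1 c1 c2 pr np] by blast
    hence "col l' l y" "col p x y" using lies_iff that ll by metis+
    thus False using that(2) col_perm(3) by blast
  qed
  show "col p a b" using col_trans[OF pr on[OF pa da] on[OF pb db]] by blast
qed

lemma bt_cong_eq: assumes "bt a b c" "C a b a c" shows "b = c"
proof (cases "a = c")
  case True thus ?thesis using assms bt_ident by blast
next
  case False
  obtain x where x: "B c a x" using beyond False by metis
  hence x: "x \<noteq> a" "bt x a c" using bet_ne bet_iff bt_sym by blast+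
  show ?thesis using extend_unique[OF x(1) bt_inner1[OF x(2) assms(1)] x(2) assms(2)] .
qed

lemma opposite_point: "bt m t w \<Longrightarrow> C t w m t \<Longrightarrow> mid t m w"
  unfolding mid_def using cong_sym by blast

lemma double_segment: assumes "m \<noteq> m'" "bt m' m m1" "C m m1 m m'" shows "m' \<noteq> m1"
  using assms bt_ident by blast

text \<open>
  The apex \<open>e\<close> of an equilateral triangle with base \<open>m'm1\<close> lies on the perpendicular
  to the base at its midpoint \<open>m\<close>.
\<close>

lemma apex:
  assumes "m \<noteq> m'" "bt m' m m1" "C m m1 m m'" "C m' e m' m1" "C m1 e m1 m'"
  shows "\<not> col m m' e" "right_angle e m m'"
proof -
  have n: "m' \<noteq> m1" using double_segment assms by blast
  have mm: "mid m m' m1" unfolding mid_def using assms(2,3) cong_sym cong_flips by blast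
  have "\<not> col m' m1 e" using equilateral_not_col[OF n assms(4,5)] .
  moreover have c: "col m' m1 m" using mid_col[OF mm] col_perm(4) by blast
  ultimately show "\<not> col m m' e" using col_line2[OF assms(1) c col_triv(3) _ n] by blast
  have "C e m' e m1" using assms(4,5) cong_sym cong_trans cong_flips by meson
  thus "right_angle e m m'" unfolding right_angle_def using mm by blast
qed

lemma apex_ne: assumes "m \<noteq> m'" "bt m' m m1" "C m m1 m m'" "C m' e m' m1" "C m1 e m1 m'"
  shows "e \<noteq> m"
  using apex[OF assms] col_triv by blast

lemma altitude_ends:
  assumes "e \<noteq> m" "bt e m t1" "bt e t1 t" "C t1 t e m"
  shows "e \<noteq> t1" "t1 \<noteq> t" "m \<noteq> t" "bt m t1 t"
proof -
  show "e \<noteq> t1" using assms bt_ident by blast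
  show n: "t1 \<noteq> t" using assms(1,4) cong_null2 by blast
  show b: "bt m t1 t" using bt_nest1 assms by blast
  show "m \<noteq> t" using b n bt_ident by blast
qed

text \<open>
  The line \<open>W\<close> through \<open>w\<close> and \<open>s1\<close> misses \<open>l\<close>. It is
  perpendicular at \<open>w\<close> to \<open>mw\<close>, and \<open>mw\<close> contains the point
  \<open>t1\<close> with \<open>m t1 = ml\<close> strictly before \<open>w\<close>. If \<open>l\<close> were
  on \<open>W\<close>, then \<open>mw\<close> would be a leg longer than the hypotenuse \<open>ml\<close>.
  Adding the length \<open>em\<close> to \<open>ml\<close> keeps \<open>t\<close> away from \<open>m\<close>
  also if \<open>l = m\<close>, a case that the construction cannot single out.
\<close>

lemma (in euclidean_plane) far_parallel:
  assumes a: "m \<noteq> m'" "bt m' m m1" "C m m1 m m'" "C m' e m' m1" "C m1 e m1 m'"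
    and b: "bt e m t1" "C m t1 m l" "bt e t1 t" "C t1 t e m"
    and w: "mid t m w" and s1: "mid t m' s1"
  shows "\<not> col m m' t" "\<not> col s1 w l"
proof -
  have e: "\<not> col m m' e" "right_angle e m m'" "e \<noteq> m" using apex[OF a] apex_ne[OF a] .
  note alt = altitude_ends[OF e(3) b(1,3,4)]
  have emt: "bt e m t" using bt_nest2[OF b(3,1)] .
  hence c: "col m e t" "col m t e" using bt_col col_perm by blast+
  have pt: "right_angle t m m'" using right_angle_line[OF e(2,3) c(1)] .
  show T: "\<not> col m m' t" using right_angle_not_col[OF pt] alt(3) a(1) col_perm(1) by blast
  have tw: "bt m t w" "w \<noteq> m" "t \<noteq> w" using w alt(3) mid_ne[OF w] unfolding mid_def by auto
  have "col m t w" using bt_col[OF tw(1)] .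
  hence pw: "right_angle w m m'" using right_angle_line[OF pt] alt(3) by blast
  have ps: "right_angle m w s1" using right_angle_reflect[OF pw mid_sym[OF w] w s1] .
  have s1w: "s1 \<noteq> w" using reflect_inj[OF s1 w] a(1) by blast
  have bt1: "bt m t1 w" "t1 \<noteq> w"
  proof -
    show "bt m t1 w" using bt_nest2[OF tw(1) alt(4)] .
    have "bt t1 t w" using bt_nest1[OF tw(1) alt(4)] .
    thus "t1 \<noteq> w" using bt_ident alt(2) by blast
  qed
  show "\<not> col s1 w l"
  proof
    assume lW: "col s1 w l"
    show False
    proof (cases "l = w")
      case True
      thus False using bt_cong_eq[OF bt1(1)] b(2) bt1(2) by blast
    next
      case False
      have "right_angle m w l" using right_angle_line2[OF ps s1w] col_perm(3)[OF lW] by blast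
      hence p: "right_angle l w m" using right_angle_sym by blast
      have "\<not> col l w m" using right_angle_not_col[OF p False] tw(2) by blast
      hence "m \<noteq> l" by auto
      hence "m \<noteq> t1" using b(2) cong_null2 by blast
      hence "B m t1 w" using bt1 bet_iff by blast
      thus False using leg_not_longer[OF _ b(2) p False] by blast
    qed
  qed
qed

lemma reflected_line:
  assumes "m \<noteq> m'" and t: "\<not> col m m' t" and w: "mid t m w" and s: "mid t m' s"
  shows "s \<noteq> w" "\<not> col s w t" "\<not> (col m m' x \<and> col s w x)" "w \<noteq> t"
proof -
  show sw: "s \<noteq> w" using reflect_inj[OF s w] assms(1) by blast
  have "mid t t t" by simp
  hence n: "\<not> col s w t" using reflect_col[OF mid_sym[OF s] mid_sym[OF w]] t col_perm(3) by blast
  thus "\<not> col s w t" .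
  show tw: "w \<noteq> t" using n by auto
  have "\<not> col s w m"
  proof
    assume "col s w m"
    moreover have "col w m t" using mid_col[OF w] col_perm(2) by blast
    moreover have "w \<noteq> m" using tw w mid_same2 by metis
    ultimately have "col s w t" using col_line2[of w m s w t] sw by simp
    thus False using n by blast
  qed
  thus "\<not> (col m m' x \<and> col s w x)" using reflected_lines_disjoint[OF w mid_sym[OF s]] by blast
qed

lemma (in euclidean_plane) playfair_col:
  assumes "k \<noteq> k'" "l \<noteq> l'" "m \<noteq> m'" "\<And>x. \<not> (col k k' x \<and> col l l' x)"
    "\<And>x. \<not> (col m m' x \<and> col l l' x)" "col k k' p" "col m m' p"
  shows "col k k' x \<longleftrightarrow> col m m' x"
proof -
  have main: "col m m' x" if "k \<noteq> k'" "m \<noteq> m'" "\<And>x. \<not> (col k k' x \<and> col l l' x)"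
    "\<And>x. \<not> (col m m' x \<and> col l l' x)" "col k k' p" "col m m' p" "col k k' x" for k k' m m' x
    using that
  proof (cases "x = p")
    case True thus ?thesis using \<open>col m m' p\<close> by blast
  next
    case False
    obtain b where b: "col m m' b" "p \<noteq> b" using \<open>m \<noteq> m'\<close> col_triv by metis
    have "col k k' y" if "col p x y" for y
      using col_line2[OF False _ _ _ \<open>k \<noteq> k'\<close>] that col_perm(3) \<open>col k k' p\<close> \<open>col k k' x\<close> by blast
    moreover have "col m m' y" if "col p b y" for y
      using col_line2[OF b(2) \<open>col m m' p\<close> b(1) that \<open>m \<noteq> m'\<close>] .
    ultimately have "col p x b"
      using parallel_unique[OF assms(2), of p x b] False b(2) \<open>\<And>x. \<not> (col k k' x \<and> col l l' x)\<close>
        \<open>\<And>x. \<not> (col m m' x \<and> col l l' x)\<close> by blast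
    hence "col p b x" using col_perm(4) by blast
    thus ?thesis using col_line2[OF b(2) \<open>col m m' p\<close> b(1) _ \<open>m \<noteq> m'\<close>] by blast
  qed
  show ?thesis using main[of k k' m m'] main[of m m' k k'] assms by blast
qed

lemma (in euclidean_plane) playfair_holds:
  assumes "k \<noteq> k'" "l \<noteq> l'" "m \<noteq> m'" "\<not> (\<exists>x. lies x k k' \<and> lies x l l')"
    "\<not> (\<exists>x. lies x m m' \<and> lies x l l')" "lies p k k'" "lies p m m'"
  shows "lies x k k' \<longleftrightarrow> lies x m m'"
  using playfair_col[OF assms(1-3)] assms lies_iff by metis

lemma euclidean_if_playfair:
  assumes "\<And>k k' l l' m m' p x. k \<noteq> k' \<Longrightarrow> l \<noteq> l' \<Longrightarrow> m \<noteq> m' \<Longrightarrow> \<not> (\<exists>x. lies x k k' \<and> lies x l l') \<Longrightarrow>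
    \<not> (\<exists>x. lies x m m' \<and> lies x l l') \<Longrightarrow> lies p k k' \<Longrightarrow> lies p m m' \<Longrightarrow> lies x k k' \<longleftrightarrow> lies x m m'"
  shows "euclidean_plane B C"
proof unfold_locales
  fix l l' p a b
  assume h: "l \<noteq> l'" "p \<noteq> a" "p \<noteq> b" 
    "\<And>x. \<not> (col p a x \<and> col l l' x)" "\<And>x. \<not> (col p b x \<and> col l l' x)"
  have "lies b p a \<longleftrightarrow> lies b p b"
    using assms[OF h(2,1,3), of p b] h lies_iff[OF h(1)] lies_iff[OF h(2)] lies_iff[OF h(3)] by simp
  thus "col p a b" using lies_iff[OF h(2)] lies_iff[OF h(3)] by simp
qed

lemma (in euclidean_plane) strong_parallel_lines:
  assumes "B p t q" "B s t r" "C p t q t" "C r t s t" "p \<noteq> r" "\<not> lies p s q" "\<not> lies a p r"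
  shows "p \<noteq> a" "s \<noteq> q" "\<exists>x. \<not> (lies x p a \<longleftrightarrow> lies x s q)" "\<exists>x. lies x p a \<and> lies x s q"
proof -
  have m: "mid t p q" "mid t s r" unfolding mid_def
    using assms(1-4) bet_iff cong_flips cong_sym by meson+
  show pa: "p \<noteq> a" using assms(5,7) lies_iff[OF assms(5)] by auto
  show sq: "s \<noteq> q" using reflect_inj[OF m(1) mid_sym[OF m(2)] assms(5)] by blast
  have n: "\<not> col s q p" using assms(6) lies_iff[OF sq] by blast
  have "lies p p a" using lies_iff[OF pa] by simp
  thus "\<exists>x. \<not> (lies x p a \<longleftrightarrow> lies x s q)" using assms(6) by blast
  show "\<exists>x. lies x p a \<and> lies x s q"
  proof (rule ccontr)
    assume "\<not> ?thesis"
    hence "\<And>x. \<not> (col p a x \<and> col s q x)" using lies_iff[OF sq] lies_iff[OF pa] by blast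
    hence "col p r a" using parallel_unique[OF sq assms(5) pa] reflected_lines_disjoint[OF m n] by blast
    thus False using assms(7) lies_iff[OF assms(5)] by blast
  qed
qed

text \<open>
  The hypotheses of the strong parallel postulate for the point \<open>l\<close> and the line \<open>W\<close>
  through \<open>s\<close> and \<open>w\<close>. The essential one is that \<open>l'\<close> is not on the
  parallel \<open>lr\<close> to \<open>W\<close>: otherwise the line \<open>ll'\<close> would be disjoint from
  \<open>W\<close>, as is \<open>mm'\<close>, and having a common point the two would coincide.
\<close>

lemma (in euclidean_plane) first_application:
  assumes L: "l \<noteq> l'" and M: "m \<noteq> m'" and nc: "\<not> (\<forall>x. lies x l l' \<longleftrightarrow> lies x m m')"
    and meet: "\<exists>x. lies x l l' \<and> lies x m m'"
    and t: "\<not> col m m' t" and w: "mid t m w" and s: "mid t m' s" and l: "\<not> col s w l"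
    and u: "mid u l w" and r: "mid u s r"
  shows "s \<noteq> u" "l \<noteq> r" "\<not> lies l s w" "\<not> lies l' l r" "B s u r" "B l u w"
proof -
  note R = reflected_line[OF M t w s]
  have lw: "l \<noteq> w" using l by auto
  show su: "s \<noteq> u" using mid_col[OF u] l col_perm(1) by blast
  show lr: "l \<noteq> r" using reflect_inj[OF mid_sym[OF u] r] R(1) by blast
  show "\<not> lies l s w" using l lies_iff[OF R(1)] by blast
  show "B s u r" using mid_bet[OF r su] .
  have "u \<noteq> l" using u lw mid_same by metis
  thus "B l u w" using mid_bet[OF u] by blast
  have dis: "\<not> (col l r x \<and> col s w x)" for x using reflected_lines_disjoint[OF u r l] .
  show "\<not> lies l' l r"
  proof
    assume "lies l' l r"
    hence l'r: "col l r l'" using lies_iff[OF lr] by blast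
    have "col l r x" if "col l l' x" for x using col_line2[OF L _ l'r that lr] by simp
    hence d1: "\<not> (col l l' x \<and> col s w x)" for x using dis by blast
    obtain x where x: "col l l' x" "col m m' x" using meet lies_iff[OF L] lies_iff[OF M] by blast
    have "col l l' y \<longleftrightarrow> col m m' y" for y using playfair_col[OF L R(1) M d1 R(3) x] .
    thus False using nc lies_iff[OF L] lies_iff[OF M] by blast
  qed
qed

lemma center_off_parallel:
  assumes M: "m \<noteq> m'" and t: "\<not> col m m' t" and w: "mid t m w" and s: "mid t m' s" and p: "lies p s w"
  shows "p \<noteq> t"
  using reflected_line[OF M t w s] p lies_iff by metis

text \<open>
  A construction of a point \<open>s\<close> on the line \<open>mm'\<close> different from a given point
  \<open>q\<close>: since \<open>ms = mq + mm'\<close>, the distance of \<open>s\<close> from \<open>m\<close>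
  is greater than that of \<open>q\<close>.
\<close>

lemma second_point:
  assumes M: "m \<noteq> m'" and "bt m' m z" "C m z m q" "bt m' z s" "C z s m m'"
  shows "m' \<noteq> z" "s \<noteq> q" "col m m' s"
proof -
  show z: "m' \<noteq> z" using assms bt_ident by blast
  have "bt m z s" using bt_nest1 assms by blast
  moreover have "z \<noteq> s" using assms(5) M cong_null2 by blast
  ultimately show "s \<noteq> q" using bt_cong_eq assms(3) by blast
  have "bt m' m s" using bt_nest2[OF assms(4,2)] .
  thus "col m m' s" using bt_col col_perm(3) by blast
qed

text \<open>
  The hypotheses of the strong parallel postulate for the point \<open>p\<close> on \<open>W\<close> and the
  line \<open>mm'\<close>. Reflection in \<open>t\<close> exchanges \<open>W\<close> and \<open>mm'\<close>,
  so \<open>t\<close> already is the midpoint that the postulate requires, and the parallel through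
  \<open>p\<close> is \<open>W\<close>, which misses \<open>l\<close>.
\<close>

lemma second_application:
  assumes L: "l \<noteq> l'" and M: "m \<noteq> m'" 
    and t: "\<not> col m m' t" and w: "mid t m w" and s: "mid t m' s" and l: "\<not> col s w l"
    and p: "lies p s w" "lies p l l'" and q: "mid t p q" and s2: "col m m' s2" "s2 \<noteq> q" and r2: "mid t s2 r2"
  shows "s2 \<noteq> t" "B p t q" "B s2 t r2" "p \<noteq> r2" "\<not> lies p s2 q" "\<not> lies l p r2" 
    "lies y s2 q \<Longrightarrow> lies y p l \<Longrightarrow> lies y m m' \<and> lies y l l'"
proof -
  note R = reflected_line[OF M t w s]
  show s2t: "s2 \<noteq> t" using s2 t by blast
  have pt: "p \<noteq> t" using center_off_parallel[OF M t w s p(1)] .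
  show "B p t q" "B s2 t r2" using mid_bet[OF q pt] mid_bet[OF r2 s2t] .
  show pr: "p \<noteq> r2" using reflect_inj[OF mid_sym[OF q] r2] s2(2) by blast
  have pW: "col s w p" using p(1) lies_iff[OF R(1)] by blast
  have qM: "col m m' q" using reflect_col[OF mid_sym[OF s] mid_sym[OF w] q pW] col_perm(3) by blast
  have rW: "col s w r2" using reflect_col[OF w s r2 s2(1)] col_perm(3) by blast
  have M': "col m m' x" if "col s2 q x" for x using col_line2[OF s2(2,1) qM that M] .
  show "\<not> lies p s2 q" using M' R(3)[of p] pW lies_iff[OF s2(2)] by blast
  show "\<not> lies l p r2" using col_line2[OF pr pW rW _ R(1)] l lies_iff[OF pr] by blast
  have pl: "p \<noteq> l" using pW l by blast
  have pL: "col l l' p" using p(2) lies_iff[OF L] by blast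
  assume y: "lies y s2 q" "lies y p l"
  have "col l l' y" using col_line2[OF pl pL _ _ L] y(2) lies_iff[OF pl] by simp
  thus "lies y m m' \<and> lies y l l'" using M' y(1) lies_iff[OF s2(2)] lies_iff[OF L] lies_iff[OF M] by blast
qed

end

section \<open>From classical truth to intuitionistic derivability\<close>

lemmas forall_defs = forall2_def forall3_def forall4_def forall5_def forall6_def forall7_def forall8_def
lemmas geo_defs = T_def on_def collinear_def le_def on_circle_def inside_def outside_def meets_def
  parallel_def coincide_def

lemma neutral_univ: "A \<in> neutral \<Longrightarrow> univ_at True A"
  by (erule neutral.cases) (simp_all add: forall_defs geo_defs)

lemma neutral_closed: "A \<in> neutral \<Longrightarrow> fv A = {}"
  by (erule neutral.cases) (simp_all add: forall_defs geo_defs numeral_eq_Suc)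

text \<open>
  Repeated extension beyond \<open>b\<close> on the ray from \<open>a\<close> gives infinitely many points,
  pairwise unequal in the sense of \<open>E\<close>. So the quotient of the variables by derivable equality is
  countably infinite, and can be carried by the type of natural numbers itself.
\<close>

lemma infinite_classes:
  fixes E :: "'p \<Rightarrow> 'p \<Rightarrow> bool"
  assumes S: "\<And>A. A \<in> neutral \<Longrightarrow> sat E B C e A" 
    and E: "\<And>x. E x x" "\<And>x y. E x y \<Longrightarrow> E y x" "\<And>x y z. E x y \<Longrightarrow> E y z \<Longrightarrow> E x z"
    and cong: "\<And>a b c d d'. C a b c d \<Longrightarrow> E d d' \<Longrightarrow> C a b c d'"
    and bet: "\<And>a b c c'. B a b c \<Longrightarrow> E c c' \<Longrightarrow> B a b c'"
    and ab: "\<not> E a b"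
  shows "infinite (range (\<lambda>x. {y. E x y}))"
proof -
  define bt where "bt x y z \<longleftrightarrow> E x y \<or> E y z \<or> B x y z" for x y z
  note simps = forall_defs T_def
  have ext: "\<exists>z. bt x y z \<and> C y z u v" if "\<not> E x y" for x y u v
    using S[OF neutral.extension, simplified simps, simplified, rule_format, OF that, of u v]
    unfolding bt_def by blast
  have flip: "C x y y x" for x y
    using S[OF neutral.cong_swap, simplified simps, simplified] by blast
  have common: "C p q r s" if "C x y p q" "C x y r s" for x y p q r s
    using S[OF neutral.cong_trans, simplified simps, simplified, rule_format, of x y p q r s] that by blast
  have null: "E x y" if "C x y z z" for x y z
    using S[OF neutral.cong_null, simplified simps, simplified] that by blast
  have sym: "B z y x \<and> \<not> E x y \<and> \<not> E y z" if "B x y z" for x y z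
    using S[OF neutral.bet_sym, simplified simps, simplified, rule_format, OF that] .
  have irr: "\<not> B x y x" for x y
    using S[OF neutral.bet_irrefl, simplified simps, simplified] by blast
  have inner: "bt x y z \<and> bt x z w" if "bt x y w" "bt y z w" for x y z w
    using S[OF neutral.inner_trans, simplified simps, simplified, rule_format, of x y w z] that
    unfolding bt_def by blast
  have B_bt: "B x y z \<longleftrightarrow> bt x y z \<and> \<not> E x y \<and> \<not> E y z" for x y z
    using sym unfolding bt_def by blast
  have next_point: "\<exists>z. B x y z" if n: "\<not> E x y" for x y
  proof -
    obtain z where z: "bt x y z" "C y z x y" using ext[OF n] by blast
    have "\<not> E y z"
    proof
      assume "E y z"
      hence "C x y y z" using common[OF z(2) common[OF flip flip]] by blast
      hence "C x y y y" using cong \<open>E y z\<close> E(2) by blast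
      thus False using null n by blast
    qed
    thus ?thesis using z n B_bt by blast
  qed
  have trans: "B a x z" if xy: "B a x y" "B a y z" for x y z
  proof -
    have 1: "bt z y a" "bt y x a" using sym[OF xy(1)] sym[OF xy(2)] B_bt by blast+
    have 2: "bt z y x" "bt z x a" using inner[OF 1] by blast+
    have "\<not> E z x"
    proof
      assume "E z x"
      hence "B a y x" using bet[OF xy(2)] by blast
      hence "bt x y a" "bt y x a" using sym B_bt 1 by blast+
      hence "bt x y x" using inner by blast
      hence "E x y" unfolding bt_def using irr E(2) by blast
      thus False using sym[OF xy(1)] by blast
    qed
    moreover have "\<not> E x a" using sym[OF xy(1)] E(2) by blast
    ultimately have "B z x a" using 2 B_bt by blast
    thus ?thesis using sym by blast
  qed
  define x where "x = rec_nat b (\<lambda>_ y. SOME z. B a y z)"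
  have ne: "\<not> E a (x n)" and stp: "B a (x n) (x (Suc n))" for n
  proof -
    have "\<not> E a (x n) \<and> B a (x n) (x (Suc n))"
    proof (induction n)
      case 0
      show ?case using ab someI_ex[OF next_point[OF ab]] by (simp add: x_def)
    next
      case (Suc n)
      have n: "\<not> E a (x (Suc n))"
      proof
        assume "E a (x (Suc n))"
        hence "B a (x n) a" using Suc bet E(2) by blast
        thus False using irr by blast
      qed
      have "B a (x (Suc n)) (SOME z. B a (x (Suc n)) z)" using someI_ex[OF next_point[OF n]] .
      thus ?case using n by (simp add: x_def)
    qed
    thus "\<not> E a (x n)" "B a (x n) (x (Suc n))" by blast+
  qed
  have less: "B a (x i) (x j)" if "i < j" for i j
    using that
  proof (induction j)
    case (Suc j)
    show ?case using Suc stp[of j] trans by (cases "i = j") auto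
  qed simp
  have diff: "\<not> E (x i) (x j)" if "i < j" for i j using less[OF that] sym by blast
  have "inj (\<lambda>i. {y. E (x i) y})"
  proof (rule injI)
    fix i j assume "{y. E (x i) y} = {y. E (x j) y}"
    hence "E (x i) (x j)" "E (x j) (x i)" using E(1) by blast+
    thus "i = j" using diff[of i j] diff[of j i] by (meson linorder_neqE_nat)
  qed
  hence "infinite (range (\<lambda>i. {y. E (x i) y}))" using range_inj_infinite by blast
  moreover have "range (\<lambda>i. {y. E (x i) y}) \<subseteq> range (\<lambda>x. {y. E x y})" by blast
  ultimately show ?thesis by (rule infinite_super[rotated])
qed

lemma quotient_map:
  fixes E :: "nat \<Rightarrow> nat \<Rightarrow> bool"
  assumes E: "\<And>x. E x x" "\<And>x y. E x y \<Longrightarrow> E y x" "\<And>x y z. E x y \<Longrightarrow> E y z \<Longrightarrow> E x z"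
    and inf: "infinite (range (\<lambda>x. {y. E x y}))"
  shows "\<exists>h :: nat \<Rightarrow> nat. surj h \<and> (\<forall>x y. h x = h y \<longleftrightarrow> E x y)"
proof -
  let ?c = "\<lambda>x. {y. E x y}" and ?Q = "range (\<lambda>x. {y. E x y})"
  have bij: "bij_betw (to_nat_on ?Q) ?Q UNIV" by (rule to_nat_on_infinite[OF _ inf]) simp
  have "h x = h y \<longleftrightarrow> E x y" if "h = to_nat_on ?Q \<circ> ?c" for x y h
  proof -
    have "h x = h y \<longleftrightarrow> ?c x = ?c y" using bij that by (simp add: inj_on_eq_iff bij_betw_def)
    also have "\<dots> \<longleftrightarrow> E x y" using E(1)[of y] E(2) E(3) by (metis mem_Collect_eq Collect_cong)
    finally show ?thesis .
  qed
  moreover have "surj (to_nat_on ?Q \<circ> ?c)" using bij unfolding bij_betw_def by (simp add: image_comp)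
  ultimately show ?thesis by blast
qed

text \<open>
  If \<open>\<Gamma>\<close> does not prove \<open>\<not>\<not>\<phi>\<close>, then \<open>\<Gamma>\<close>
  with \<open>\<not>\<phi>\<close> is consistent and extends to a Henkin theory, whose structure satisfies
  \<open>\<Gamma>\<close> but not \<open>\<phi>\<close>. Two provably distinct points make its quotient
  infinite.
\<close>

lemma double_negation_completeness:
  assumes neutral: "neutral \<subseteq> \<Gamma>" and univ: "\<And>A. A \<in> \<Gamma> \<Longrightarrow> univ_at True A" and fin: "finite (\<Union>A\<in>\<Gamma>. fv A)"
    and ab: "\<Gamma> \<turnstile> Neq a b" and phi: "univ_at False \<phi>"
    and valid: "\<And>B C (e :: nat \<Rightarrow> nat). e a \<noteq> e b \<Longrightarrow> (\<And>A. A \<in> \<Gamma> \<Longrightarrow> sat (=) B C e A) \<Longrightarrow>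
      sat (=) B C e \<phi>"
  shows "\<Gamma> \<turnstile> \<^bold>\<not> \<^bold>\<not> \<phi>"
proof (rule ccontr)
  assume "\<not> ?thesis"
  hence c: "consistent (insert (\<^bold>\<not> \<phi>) \<Gamma>)" unfolding consistent_def using deriv.impI by blast
  have "finite (\<Union>A\<in>insert (\<^bold>\<not> \<phi>) \<Gamma>. fv A)" using fin finite_fv by simp
  then obtain \<Sigma> where \<Sigma>: "insert (\<^bold>\<not> \<phi>) \<Gamma> \<subseteq> \<Sigma>" "consistent \<Sigma>" "\<And>A. A \<in> \<Sigma> \<or> (\<^bold>\<not> A) \<in> \<Sigma>"
    "\<And>A. Exists A \<in> \<Sigma> \<Longrightarrow> \<exists>y. inst A y \<in> \<Sigma>" "\<And>A. \<Sigma> \<turnstile> A \<Longrightarrow> A \<in> \<Sigma>"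
    using henkin_extension[OF c] by blast
  let ?E = "\<lambda>a b. Eq a b \<in> \<Sigma>" and ?B = "\<lambda>a b c. Bet a b c \<in> \<Sigma>" and ?C = "\<lambda>a b c d. Cong a b c d \<in> \<Sigma>"
  have iff: "A \<in> \<Sigma> \<longleftrightarrow> (\<Sigma> \<turnstile> A)" for A using \<Sigma>(5) deriv.assm by blast
  have sat1: "sat ?E ?B ?C (\<lambda>i. i) A" if "A \<in> \<Gamma>" for A
    using truth[OF \<Sigma>(2-5), of A "\<lambda>i. i"] univ[OF that] that \<Sigma>(1) by (auto simp: ren_id)
  have nphi: "\<phi> \<notin> \<Sigma>"
  proof
    assume "\<phi> \<in> \<Sigma>"
    moreover have "(\<^bold>\<not> \<phi>) \<in> \<Sigma>" using \<Sigma>(1) by blast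
    ultimately show False using \<Sigma>(2) deriv.impE[of \<Sigma> \<phi> Falsum] unfolding consistent_def iff by blast
  qed
  have sat2: "\<not> sat ?E ?B ?C (\<lambda>i. i) \<phi>"
    using truth[OF \<Sigma>(2-5), of \<phi> "\<lambda>i. i"] phi nphi by (simp add: ren_id)
  have subst: "inst A y \<in> \<Sigma>" if "?E x y" "inst A x \<in> \<Sigma>" for A x y
    using that deriv.eq_subst unfolding iff by blast
  have E1: "?E x x" for x unfolding iff by (rule deriv.eq_refl)
  have E2: "?E y x" if "?E x y" for x y
    using subst[OF that, of "Eq 0 (Suc x)"] E1 by simp
  have E3: "?E x z" if "?E x y" "?E y z" for x y z
    using subst[OF that(2), of "Eq (Suc x) 0"] that(1) by simp
  have B1: "?B x' y z" if "?E x x'" "?B x y z" for x x' y z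
    using subst[OF that(1), of "Bet 0 (Suc y) (Suc z)"] that(2) by simp
  have B2: "?B x y' z" if "?E y y'" "?B x y z" for x y y' z
    using subst[OF that(1), of "Bet (Suc x) 0 (Suc z)"] that(2) by simp
  have B3: "?B x y z'" if "?E z z'" "?B x y z" for x y z z'
    using subst[OF that(1), of "Bet (Suc x) (Suc y) 0"] that(2) by simp
  have C1: "?C x' y z w" if "?E x x'" "?C x y z w" for x x' y z w
    using subst[OF that(1), of "Cong 0 (Suc y) (Suc z) (Suc w)"] that(2) by simp
  have C2: "?C x y' z w" if "?E y y'" "?C x y z w" for x y y' z w
    using subst[OF that(1), of "Cong (Suc x) 0 (Suc z) (Suc w)"] that(2) by simp
  have C3: "?C x y z' w" if "?E z z'" "?C x y z w" for x y z z' w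
    using subst[OF that(1), of "Cong (Suc x) (Suc y) 0 (Suc w)"] that(2) by simp
  have C4: "?C x y z w'" if "?E w w'" "?C x y z w" for x y z w w'
    using subst[OF that(1), of "Cong (Suc x) (Suc y) (Suc z) 0"] that(2) by simp
  have nab: "\<not> ?E a b"
  proof
    assume "?E a b"
    moreover have "\<Sigma> \<turnstile> Neq a b" using deriv_weaken[OF ab] \<Sigma>(1) by blast
    ultimately show False using \<Sigma>(2) deriv.impE unfolding consistent_def iff by blast
  qed
  have n: "sat ?E ?B ?C (\<lambda>i. i) A" if "A \<in> neutral" for A using sat1 neutral that by blast
  have "infinite (range (\<lambda>x. {y. ?E x y}))"
    by (rule infinite_classes[where E = ?E and B = ?B and C = ?C and e = "\<lambda>i. i", OF _ _ _ _ _ _ nab];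
        (rule n E1 E2 E3 C4 B3; assumption)?)
  hence "\<exists>h :: nat \<Rightarrow> nat. surj h \<and> (\<forall>x y. h x = h y \<longleftrightarrow> ?E x y)"
  proof (rule quotient_map[where E = ?E, rotated 3])
    show "?E x x" for x by (rule E1)
    show "?E y x" if "?E x y" for x y using that by (rule E2)
    show "?E x z" if "?E x y" "?E y z" for x y z using that by (rule E3)
  qed
  then obtain h :: "nat \<Rightarrow> nat" where h: "surj h" "\<And>x y. h x = h y \<longleftrightarrow> ?E x y" by blast
  define g where "g = inv h"
  have g: "?E (g (h x)) x" for x unfolding g_def using h(2)[of "inv h (h x)" x] surj_f_inv_f[OF h(1), of "h x"] by simp
  define B' where "B' x y z \<longleftrightarrow> ?B (g x) (g y) (g z)" for x y z
  define C' where "C' x y z w \<longleftrightarrow> ?C (g x) (g y) (g z) (g w)" for x y z w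
  have B': "B' (h x) (h y) (h z) \<longleftrightarrow> ?B x y z" for x y z
  proof
    assume "B' (h x) (h y) (h z)"
    thus "?B x y z" unfolding B'_def using B1[OF g B2[OF g B3[OF g]]] by simp
  next
    assume "?B x y z"
    thus "B' (h x) (h y) (h z)" unfolding B'_def using B1[OF E2[OF g] B2[OF E2[OF g] B3[OF E2[OF g]]]] by simp
  qed
  have C': "C' (h x) (h y) (h z) (h w) \<longleftrightarrow> ?C x y z w" for x y z w
  proof
    assume "C' (h x) (h y) (h z) (h w)"
    thus "?C x y z w" unfolding C'_def using C1[OF g C2[OF g C3[OF g C4[OF g]]]] by simp
  next
    assume "?C x y z w"
    thus "C' (h x) (h y) (h z) (h w)"
      unfolding C'_def using C1[OF E2[OF g] C2[OF E2[OF g] C3[OF E2[OF g] C4[OF E2[OF g]]]]] by simp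
  qed
  note q = sat_quotient[of h ?E B' ?B C' ?C "\<lambda>i. i", OF h B' C']
  have "sat (=) B' C' h \<phi>"
  proof (rule valid)
    show "h a \<noteq> h b" using h(2) nab by blast
  next
    fix A assume "A \<in> \<Gamma>"
    thus "sat (=) B' C' h A" using sat1[of A] q[of A] by simp
  qed
  thus False using sat2 q[of \<phi>] by simp
qed

lemma sat_T: "sat (=) B C e (T a b c) \<longleftrightarrow> wbet B (e a) (e b) (e c)"
  unfolding T_def wbet_def by simp
lemma sat_on: "sat (=) B C e (on x a b) \<longleftrightarrow> on_line B (e x) (e a) (e b)"
  unfolding on_def on_line_def by simp
lemma sat_collinear: "sat (=) B C e (collinear a b c) \<longleftrightarrow> on_common_line B (e a) (e b) (e c)"
  unfolding collinear_def on_common_line_def by (simp add: sat_on)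
lemma sat_le: "sat (=) B C e (le a b c d) \<longleftrightarrow> seg_le B C (e a) (e b) (e c) (e d)"
  unfolding le_def seg_le_def by (simp add: sat_T)
lemma sat_meets: "sat (=) B C e (meets a b c d) \<longleftrightarrow>
    (\<exists>x. on_line B x (e a) (e b) \<and> on_line B x (e c) (e d))"
  unfolding meets_def by (simp add: sat_on)
lemma sat_coincide: "sat (=) B C e (coincide a b c d) \<longleftrightarrow>
    (\<forall>x. on_line B x (e a) (e b) \<longleftrightarrow> on_line B x (e c) (e d))"
  unfolding coincide_def by (simp add: sat_on) blast

lemmas sat_geometry = sat_T sat_on sat_collinear sat_le sat_meets sat_coincide
  on_circle_def inside_def outside_def parallel_def

lemma neutral_plane_if_sat:
  fixes B :: "'p \<Rightarrow> 'p \<Rightarrow> 'p \<Rightarrow> bool"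
  assumes S: "\<And>A. A \<in> neutral \<Longrightarrow> sat (=) B C e A" and ab: "(a :: 'p) \<noteq> b"
  shows "neutral_plane B C"
proof -
  note simps = forall_defs sat.simps on_circle_def inside_def outside_def sat_geometry
  show ?thesis
    apply unfold_locales
    subgoal for a b using S[OF neutral.cong_swap, unfolded simps, simplified] by blast
    subgoal for a b p q r s
      using S[OF neutral.cong_trans, unfolded simps, simplified, rule_format, of a b p q r s] by blast
    subgoal for a b c using S[OF neutral.cong_null, unfolded simps, simplified] by blast
    subgoal for a b c d
      using S[OF neutral.extension, unfolded simps, simplified, rule_format, of a b c d] by blast
    subgoal for a b c a' b' c' d d'
      using S[OF neutral.five_segment, unfolded simps, simplified, rule_format, of a b c a' b' c' d d'] by blast
    subgoal for a b c using S[OF neutral.bet_sym, unfolded simps, simplified, rule_format, of a b c] .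
    subgoal for a b using S[OF neutral.bet_irrefl, unfolded simps, simplified] by blast
    subgoal for a b d c using S[OF neutral.inner_trans, unfolded simps, simplified, rule_format] by blast
    subgoal for a b c d using S[OF neutral.outer_trans, unfolded simps, simplified, rule_format] by blast
    subgoal for a b c d using S[OF neutral.connectivity, unfolded simps, simplified, rule_format] by blast
    subgoal for a b c p q
      using S[OF neutral.inner_pasch, unfolded simps, simplified, rule_format, of a b c p q] by blast
    subgoal using ab by blast
    subgoal for p q x y z
      using S[OF neutral.upper_dim, unfolded simps, simplified, rule_format] by blast
    subgoal for c d x p q r s y
      using S[OF neutral.circle_circle, unfolded simps, simplified] 
      by blast
    done
qed

section \<open>Derivations with named witnesses\<close>

primrec stable_form :: "form \<Rightarrow> bool" where
  "stable_form (Eq x y) = True"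
| "stable_form (Bet x y z) = True"
| "stable_form (Cong x y z w) = True"
| "stable_form Falsum = True"
| "stable_form (F \<^bold>\<and> G) = (stable_form F \<and> stable_form G)"
| "stable_form (F \<^bold>\<or> G) = False"
| "stable_form (F \<^bold>\<longrightarrow> G) = stable_form G"
| "stable_form (Forall F) = False"
| "stable_form (Exists F) = False"

lemma ren_T [simp]: "ren f (T a b c) = T (f a) (f b) (f c)" unfolding T_def by simp
lemma ren_on [simp]: "ren f (on a b c) = on (f a) (f b) (f c)" unfolding on_def by simp
lemma ren_collinear [simp]: "ren f (collinear a b c) = collinear (f a) (f b) (f c)"
  unfolding collinear_def by simp
lemma ren_le [simp]: "ren f (le a b c d) = le (f a) (f b) (f c) (f d)"
  unfolding le_def by simp
lemma ren_meets [simp]: "ren f (meets a b c d) = meets (f a) (f b) (f c) (f d)"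
  unfolding meets_def by simp
lemma ren_coincide [simp]: "ren f (coincide a b c d) = coincide (f a) (f b) (f c) (f d)"
  unfolding coincide_def by simp

lemma fv_T [simp]: "fv (T a b c) = {a, b, c}" unfolding T_def by auto
lemma fv_on [simp]: "fv (on a b c) = {a, b, c}" unfolding on_def by auto
lemma fv_collinear [simp]: "fv (collinear a b c) = {a, b, c}" unfolding collinear_def by auto
lemma fv_le [simp]: "fv (le a b c d) = {a, b, c, d}" unfolding le_def by auto
lemma fv_meets [simp]: "fv (meets a b c d) = {a, b, c, d}" unfolding meets_def by auto
lemma fv_coincide [simp]: "fv (coincide a b c d) = {a, b, c, d}" unfolding coincide_def by auto

lemma univ_at_geo [simp]: "univ_at x (T a b c)" "univ_at x (on a b c)" "univ_at x (collinear a b c)"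
  "univ_at x (le a b c d)" "univ_at x (meets a b c d)" "univ_at x (coincide a b c d) \<longleftrightarrow> x"
  unfolding geo_defs by simp_all
lemma stable_form_geo [simp]: "stable_form (T a b c)" "stable_form (on a b c)" unfolding geo_defs by simp_all

lemma univ_at_ren [simp]: "univ_at b (ren f A) = univ_at b A"
  by (induction A arbitrary: b f) auto

lemma double_neg_mono: assumes "insert A \<Gamma> \<turnstile> B" "\<Gamma> \<turnstile> \<^bold>\<not> \<^bold>\<not> A" shows "\<Gamma> \<turnstile> \<^bold>\<not> \<^bold>\<not> B"
proof (rule deriv.impI)
  let ?D = "insert (\<^bold>\<not> B) \<Gamma>"
  have "insert A ?D \<turnstile> Falsum"
    by (rule deriv.impE[OF deriv.assm deriv_weaken[OF assms(1)]]) auto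
  hence "?D \<turnstile> \<^bold>\<not> A" by (rule deriv.impI)
  thus "?D \<turnstile> Falsum" using deriv.impE[OF deriv_weaken[OF assms(2)]] by blast
qed

lemma stability_eq: "neutral \<turnstile> (\<^bold>\<not> \<^bold>\<not> Eq a b \<^bold>\<longrightarrow> Eq a b)"
proof -
  note x = deriv.assm[OF neutral.stable_eq, unfolded forall_defs]
  show ?thesis using deriv.forallE[OF deriv.forallE[OF x, of a, simplified], of b, simplified] .
qed

lemma stability_bet: "neutral \<turnstile> (\<^bold>\<not> \<^bold>\<not> Bet a b c \<^bold>\<longrightarrow> Bet a b c)"
proof -
  note x = deriv.assm[OF neutral.stable_bet, unfolded forall_defs]
  note x = deriv.forallE[OF x, of a, simplified]
  note x = deriv.forallE[OF x, of b, simplified]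
  show ?thesis using deriv.forallE[OF x, of c, simplified] .
qed

lemma stability_cong: "neutral \<turnstile> (\<^bold>\<not> \<^bold>\<not> Cong a b c d \<^bold>\<longrightarrow> Cong a b c d)"
proof -
  note x = deriv.assm[OF neutral.stable_cong, unfolded forall_defs]
  note x = deriv.forallE[OF x, of a, simplified]
  note x = deriv.forallE[OF x, of b, simplified]
  note x = deriv.forallE[OF x, of c, simplified]
  show ?thesis using deriv.forallE[OF x, of d, simplified] .
qed

text \<open>
  Stability of the atoms is inherited along conjunction and implication.
\<close>

lemma stable_form_deriv: assumes n: "neutral \<subseteq> \<Gamma>" and s: "stable_form A" and d: "\<Gamma> \<turnstile> \<^bold>\<not> \<^bold>\<not> A" shows "\<Gamma> \<turnstile> A"
  using n s d
proof (induction A arbitrary: \<Gamma>)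
  case (Eq a b) thus ?case using deriv.impE[OF deriv_weaken[OF stability_eq]] by blast
next
  case (Bet a b c) thus ?case using deriv.impE[OF deriv_weaken[OF stability_bet]] by blast
next
  case (Cong a b c d) thus ?case using deriv.impE[OF deriv_weaken[OF stability_cong]] by blast
next
  case Falsum
  thus ?case using deriv.impE[OF Falsum(3)] deriv.impI deriv.assm by blast
next
  case (Conj A B)
  have "insert (A \<^bold>\<and> B) \<Gamma> \<turnstile> A" "insert (A \<^bold>\<and> B) \<Gamma> \<turnstile> B"
    using deriv.conjE1 deriv.conjE2 deriv.assm by blast+
  thus ?case using Conj.IH Conj.prems double_neg_mono deriv.conjI by simp
next
  case (Imp A B)
  have "insert (A \<^bold>\<longrightarrow> B) (insert A \<Gamma>) \<turnstile> B" by (rule deriv.impE[of _ A B]) (auto intro: deriv.assm)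
  moreover have "insert A \<Gamma> \<turnstile> \<^bold>\<not> \<^bold>\<not> (A \<^bold>\<longrightarrow> B)" using deriv_weaken[OF Imp.prems(3)] by blast
  ultimately have "insert A \<Gamma> \<turnstile> \<^bold>\<not> \<^bold>\<not> B" by (rule double_neg_mono)
  hence "insert A \<Gamma> \<turnstile> B" using Imp.IH(2)[of "insert A \<Gamma>"] Imp.prems by auto
  thus ?case by (rule deriv.impI)
qed simp_all

lemma axiom_extension: "neutral \<turnstile> (Neq a b \<^bold>\<longrightarrow> Exists (T (Suc a) (Suc b) 0 \<^bold>\<and> Cong (Suc b) 0 (Suc c) (Suc d)))"
proof -
  note x = deriv.assm[OF neutral.extension, unfolded forall_defs]
  note x = deriv.forallE[OF x, of a, simplified]
  note x = deriv.forallE[OF x, of b, simplified]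
  note x = deriv.forallE[OF x, of c, simplified]
  show ?thesis using deriv.forallE[OF x, of d, simplified] .
qed

lemma axiom_pasch: "neutral \<turnstile> (\<^bold>\<not> collinear a b c \<^bold>\<and> Bet a p c \<^bold>\<and> Bet b q c \<^bold>\<longrightarrow>
       Exists (Bet (Suc p) 0 (Suc b) \<^bold>\<and> Bet (Suc q) 0 (Suc a)))"
proof -
  note x = deriv.assm[OF neutral.inner_pasch, unfolded forall_defs]
  note x = deriv.forallE[OF x, of a, simplified]
  note x = deriv.forallE[OF x, of b, simplified]
  note x = deriv.forallE[OF x, of c, simplified]
  note x = deriv.forallE[OF x, of p, simplified]
  show ?thesis using deriv.forallE[OF x, of q, simplified] .
qed

lemma axiom_circle_circle: "neutral \<turnstile> (Neq c d \<^bold>\<and>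
       on_circle x c p q \<^bold>\<and> inside x d r s \<^bold>\<and> on_circle y c p q \<^bold>\<and> outside y d r s \<^bold>\<longrightarrow>
       Exists (on_circle 0 (Suc c) (Suc p) (Suc q) \<^bold>\<and> on_circle 0 (Suc d) (Suc r) (Suc s)))"
proof -
  note x = deriv.assm[OF neutral.circle_circle, unfolded forall_defs on_circle_def inside_def outside_def]
  note x = deriv.forallE[OF x, of c, simplified]
  note x = deriv.forallE[OF x, of p, simplified]
  note x = deriv.forallE[OF x, of q, simplified]
  note x = deriv.forallE[OF x, of d, simplified]
  note x = deriv.forallE[OF x, of r, simplified]
  note x = deriv.forallE[OF x, of s, simplified]
  note x = deriv.forallE[OF x, of x, simplified]
  show ?thesis unfolding on_circle_def inside_def outside_def using deriv.forallE[OF x, of y, simplified] .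
qed

lemma strong_parallel_instance:
  assumes "\<Gamma> \<turnstile> strong_parallel"
  shows "\<Gamma> \<turnstile> (Bet p t q \<^bold>\<and> Bet s t r \<^bold>\<and> Cong p t q t \<^bold>\<and> Cong r t s t \<^bold>\<and> Neq p r \<^bold>\<and>
     \<^bold>\<not> on p s q \<^bold>\<and> \<^bold>\<not> on a p r \<^bold>\<longrightarrow> meets s q p a)"
proof -
  note x = assms[unfolded strong_parallel_def forall_defs]
  note x = deriv.forallE[OF x, of p, simplified]
  note x = deriv.forallE[OF x, of q, simplified]
  note x = deriv.forallE[OF x, of r, simplified]
  note x = deriv.forallE[OF x, of s, simplified]
  note x = deriv.forallE[OF x, of t, simplified]
  show ?thesis using deriv.forallE[OF x, of a, simplified] .
qed

lemma nonparallel_meet_instance: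
  assumes "\<Gamma> \<turnstile> nonparallel_meet"
  shows "\<Gamma> \<turnstile> (Neq l l' \<^bold>\<and> Neq m m' \<^bold>\<and> \<^bold>\<not> coincide l l' m m' \<^bold>\<and> \<^bold>\<not> parallel l l' m m' \<^bold>\<longrightarrow>
     meets m m' l l')"
proof -
  note x = assms[unfolded nonparallel_meet_def forall_defs parallel_def]
  note x = deriv.forallE[OF x, of l, simplified]
  note x = deriv.forallE[OF x, of l', simplified]
  note x = deriv.forallE[OF x, of m, simplified]
  show ?thesis unfolding parallel_def using deriv.forallE[OF x, of m', simplified] .
qed

definition context_of where "context_of S hs = insert S (neutral \<union> set hs)"

text \<open>
  The side conditions of \<open>double_negation_completeness\<close> for the hypotheses \<open>hs\<close> over
  the axioms \<open>neutral\<close> and one further axiom \<open>S\<close>.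
\<close>

definition admissible where "admissible S hs \<longleftrightarrow> fv S = {} \<and> univ_at True S \<and>
   (\<forall>h\<in>set hs. univ_at True h) \<and> (\<exists>a b. context_of S hs \<turnstile> Neq a b)"

text \<open>
  Derivability under the side conditions, which every rule below preserves; they are checked once for the
  initial context of a derivation and not at each of its steps.
\<close>

definition proves :: "form \<Rightarrow> form list \<Rightarrow> form \<Rightarrow> bool" where
  "proves S hs A \<longleftrightarrow> (admissible S hs \<longrightarrow> (context_of S hs \<turnstile> A))"

lemma admissible_Cons: "admissible S hs \<Longrightarrow> univ_at True A \<Longrightarrow> admissible S (A # hs)"
  unfolding admissible_def context_of_def
  using deriv_weaken[of "insert S (neutral \<union> set hs)" _ "insert S (neutral \<union> set (A # hs))"] by fastforce

lemma proves_classical: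
  assumes "univ_at False A" "stable_form A"
    and valid: "\<And>B C (e :: nat \<Rightarrow> nat). neutral_plane B C \<Longrightarrow> sat (=) B C e S \<Longrightarrow> \<forall>h\<in>set hs. sat (=) B C e h \<Longrightarrow>
       sat (=) B C e A"
  shows "proves S hs A"
  unfolding proves_def
proof
  assume a: "admissible S hs"
  let ?G = "context_of S hs"
  have n: "neutral \<subseteq> ?G" unfolding context_of_def by blast
  obtain a b where ab: "?G \<turnstile> Neq a b" using a admissible_def by blast
  have "?G \<turnstile> \<^bold>\<not> \<^bold>\<not> A"
  proof (rule double_negation_completeness[OF n _ _ ab assms(1)])
    show "univ_at True D" if "D \<in> ?G" for D
      using that a neutral_univ unfolding context_of_def admissible_def by auto
    show "finite (\<Union>A\<in>?G. fv A)"
      using a neutral_closed finite_fv unfolding context_of_def admissible_def by simp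
    fix B C and e :: "nat \<Rightarrow> nat"
    assume ne: "e a \<noteq> e b" and s: "\<And>A. A \<in> ?G \<Longrightarrow> sat (=) B C e A"
    have "neutral_plane B C" by (rule neutral_plane_if_sat[OF _ ne]) (use s n in blast)
    thus "sat (=) B C e A" by (rule valid) (use s in \<open>auto simp: context_of_def\<close>)
  qed
  thus "?G \<turnstile> A" by (rule stable_form_deriv[OF n assms(2)])
qed

lemma proves_cut: "proves S hs A \<Longrightarrow> univ_at True A \<Longrightarrow> proves S (A # hs) D \<Longrightarrow> proves S hs D"
  unfolding proves_def using admissible_Cons deriv_cut[of "context_of S hs" A D]
  by (simp add: context_of_def insert_commute)

lemma proves_exists:
  assumes "proves S hs (Exists A)" "proves S (inst A y # hs) D" "univ_at True A"
    "y \<notin> fv (Exists A)" "\<forall>h\<in>set hs. y \<notin> fv h" "y \<notin> fv D"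
  shows "proves S hs D"
  unfolding proves_def
proof
  assume a: "admissible S hs"
  hence "admissible S (inst A y # hs)" using admissible_Cons assms(3) by simp
  hence d: "insert (inst A y) (context_of S hs) \<turnstile> D"
    using assms(2) unfolding proves_def context_of_def by (simp add: insert_commute)
  have e: "context_of S hs \<turnstile> Exists A" using a assms(1) proves_def by blast
  show "context_of S hs \<turnstile> D"
    by (rule existsE_fresh[OF e d])
      (use a assms(4-6) neutral_closed in \<open>auto simp: context_of_def admissible_def\<close>)
qed

lemma proves_existsI: "proves S hs (inst A t) \<Longrightarrow> proves S hs (Exists A)"
  unfolding proves_def using deriv.existsI by blast

lemma proves_conjI: "proves S hs A \<Longrightarrow> proves S hs D \<Longrightarrow> proves S hs (A \<^bold>\<and> D)"
  unfolding proves_def using deriv.conjI by blast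

lemma proves_axiom: "neutral \<turnstile> (A \<^bold>\<longrightarrow> D) \<Longrightarrow> proves S hs A \<Longrightarrow> proves S hs D"
  unfolding proves_def using deriv.impE deriv_weaken[of neutral _ "context_of S hs"]
  unfolding context_of_def by blast

lemma proves_extend:
  assumes "proves S hs (Neq a b)" "proves S ((T a b y \<^bold>\<and> Cong b y c d) # hs) D"
    "y \<notin> {a, b, c, d}" "\<forall>h\<in>set hs. y \<notin> fv h" "y \<notin> fv D"
  shows "proves S hs D"
  by (rule proves_exists[OF proves_axiom[OF axiom_extension[of a b c d] assms(1)], of y])
    (use assms in auto)

lemma fresh_variable: "finite X \<Longrightarrow> \<exists>y::nat. y \<notin> X" using ex_new_if_finite[OF infinite_UNIV_nat] .

lemma finite_vars: "finite (\<Union>h\<in>set hs. fv h)" using finite_fv by simp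

text \<open>
  The two comparisons of radii that circle-circle continuity requires are existential assertions, witnessed by
  \<open>b\<close> and \<open>a\<close>.
\<close>

lemma proves_equilateral:
  assumes ab: "proves S hs (Neq a b)"
  shows "proves S hs (Exists (Cong (Suc a) 0 (Suc a) (Suc b) \<^bold>\<and> Cong (Suc b) 0 (Suc b) (Suc a)))"
proof (rule proves_cut[OF ab])
  let ?D = "Exists (Cong (Suc a) 0 (Suc a) (Suc b) \<^bold>\<and> Cong (Suc b) 0 (Suc b) (Suc a))"
  let ?h1 = "Neq a b # hs"
  obtain y where y: "y \<notin> {a, b} \<union> (\<Union>h\<in>set hs. fv h)"
    using fresh_variable[of "{a, b} \<union> (\<Union>h\<in>set hs. fv h)"] finite_vars by blast
  let ?h2 = "(T b a y \<^bold>\<and> Cong a y a b) # ?h1"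
  have 1: "proves S ?h1 (Neq b a)" by (rule proves_classical) auto
  have i: "proves S ?h2 (inside b b b a)"
    unfolding inside_def le_def
    by (rule proves_existsI[where t = b], rule proves_classical)
      (auto simp: wbet_def T_def neutral_plane.cong_refl)
  have o: "proves S ?h2 (outside y b b a)"
    unfolding outside_def le_def
    by (rule proves_existsI[where t = a], rule proves_classical)
      (auto simp: wbet_def T_def neutral_plane.cong_refl)
  have c: "proves S ?h2 (Neq a b)" "proves S ?h2 (on_circle b a a b)" "proves S ?h2 (on_circle y a a b)"
    unfolding on_circle_def by (rule proves_classical; auto simp: neutral_plane.cong_refl)+
  have "proves S ?h2 ?D"
    using proves_axiom[OF axiom_circle_circle[of a b b a b b a y]
        proves_conjI[OF c(1) proves_conjI[OF c(2) proves_conjI[OF i proves_conjI[OF c(3) o]]]]]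
    unfolding on_circle_def by simp
  thus "proves S ?h1 ?D"
    by (rule proves_extend[OF 1]) (use y in auto)
qed simp

lemma (in neutral_plane) equilateral_isosceles:
  assumes "a \<noteq> b" "C a c a b" "C b c b a" shows "\<not> col a b c" "C c a c b"
  using equilateral_not_col assms cong_sym cong_trans cong_flips by meson+

text \<open>
  The points of the classical construction, produced one after the other: the apex \<open>c\<close>, the ends
  \<open>p\<close> and \<open>q\<close> of the prolonged legs, the crossing \<open>r\<close> and the midpoint
  \<open>x\<close>.
\<close>

lemma proves_midpoint:
  assumes ab: "proves S hs (Neq a b)"
  shows "proves S hs (Exists (Bet (Suc a) 0 (Suc b) \<^bold>\<and> Cong (Suc a) 0 (Suc b) 0))"
proof (rule proves_cut[OF ab])
  let ?D = "Exists (Bet (Suc a) 0 (Suc b) \<^bold>\<and> Cong (Suc a) 0 (Suc b) 0)"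
  define V where "V = {a, b} \<union> (\<Union>h\<in>set hs. fv h)"
  have V: "finite V" "a \<in> V" "b \<in> V" "\<And>h. h \<in> set hs \<Longrightarrow> fv h \<subseteq> V" unfolding V_def using finite_vars by auto
  obtain c where c: "c \<notin> V" using fresh_variable V by blast
  obtain p where p: "p \<notin> insert c V" using fresh_variable[of "insert c V"] V by blast
  obtain q where q: "q \<notin> insert p (insert c V)" using fresh_variable[of "insert p (insert c V)"] V by blast
  obtain r where r: "r \<notin> insert q (insert p (insert c V))"
    using fresh_variable[of "insert q (insert p (insert c V))"] V by blast
  obtain x where x: "x \<notin> insert r (insert q (insert p (insert c V)))"
    using fresh_variable[of "insert r (insert q (insert p (insert c V)))"] V by blast
  let ?h1 = "Neq a b # hs"
  let ?h2 = "(Cong a c a b \<^bold>\<and> Cong b c b a) # ?h1"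
  let ?h3 = "(T c a p \<^bold>\<and> Cong a p a b) # ?h2"
  let ?h4 = "(T c b q \<^bold>\<and> Cong b q a b) # ?h3"
  let ?h5 = "(Bet a r q \<^bold>\<and> Bet b r p) # ?h4"
  let ?h6 = "(Bet a x b \<^bold>\<and> Bet r x c) # ?h5"
  note side = c p q r x V
  have f: "proves S ?h1 (Neq a b)" by (rule proves_classical) auto
  have g2: "proves S ?h2 (Neq c a)" "proves S ?h3 (Neq c b)"
  proof (rule_tac [!] proves_classical)
    fix B :: "nat \<Rightarrow> nat \<Rightarrow> nat \<Rightarrow> bool" and C and e :: "nat \<Rightarrow> nat"
    assume "neutral_plane B C"
    then interpret neutral_plane B C .
    { assume "\<forall>h\<in>set ?h2. sat (=) B C e h"
      hence "\<not> col (e a) (e b) (e c)" using equilateral_isosceles[of "e a" "e b" "e c"] by auto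
      thus "sat (=) B C e (Neq c a)" using col_triv by auto }
    { assume "\<forall>h\<in>set ?h3. sat (=) B C e h"
      hence "\<not> col (e a) (e b) (e c)" using equilateral_isosceles[of "e a" "e b" "e c"] by auto
      thus "sat (=) B C e (Neq c b)" using col_triv by auto }
  qed auto
  have g4: "proves S ?h4 (\<^bold>\<not> collinear p q c \<^bold>\<and> Bet p a c \<^bold>\<and> Bet q b c)"
  proof (rule proves_classical)
    fix B :: "nat \<Rightarrow> nat \<Rightarrow> nat \<Rightarrow> bool" and C and e :: "nat \<Rightarrow> nat"
    assume "neutral_plane B C"
    then interpret neutral_plane B C .
    assume h: "\<forall>h\<in>set ?h4. sat (=) B C e h"
    have i: "\<not> col (e a) (e b) (e c)" "C (e c) (e a) (e c) (e b)"
      using h equilateral_isosceles[of "e a" "e b" "e c"] by auto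
    show "sat (=) B C e (\<^bold>\<not> collinear p q c \<^bold>\<and> Bet p a c \<^bold>\<and> Bet q b c)"
      using isosceles_setup[OF i, of "e p" "e q"] h by (simp add: sat_T sat_collinear on_common_line_iff)
  qed auto
  have g5: "proves S ?h5 (\<^bold>\<not> collinear c b p \<^bold>\<and> Bet c a p \<^bold>\<and> Bet b r p)"
  proof (rule proves_classical)
    fix B :: "nat \<Rightarrow> nat \<Rightarrow> nat \<Rightarrow> bool" and C and e :: "nat \<Rightarrow> nat"
    assume "neutral_plane B C"
    then interpret neutral_plane B C .
    assume h: "\<forall>h\<in>set ?h5. sat (=) B C e h"
    have i: "\<not> col (e a) (e b) (e c)" "C (e c) (e a) (e c) (e b)"
      using h equilateral_isosceles[of "e a" "e b" "e c"] by auto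
    show "sat (=) B C e (\<^bold>\<not> collinear c b p \<^bold>\<and> Bet c a p \<^bold>\<and> Bet b r p)"
      using isosceles_crossing[OF i, of "e p" "e q" "e r"] h by (simp add: sat_T sat_collinear on_common_line_iff)
  qed auto
  have g6: "proves S ?h6 (Bet a x b \<^bold>\<and> Cong a x b x)"
  proof (rule proves_classical)
    fix B :: "nat \<Rightarrow> nat \<Rightarrow> nat \<Rightarrow> bool" and C and e :: "nat \<Rightarrow> nat"
    assume "neutral_plane B C"
    then interpret neutral_plane B C .
    assume h: "\<forall>h\<in>set ?h6. sat (=) B C e h"
    have i: "\<not> col (e a) (e b) (e c)" "C (e c) (e a) (e c) (e b)"
      using h equilateral_isosceles[of "e a" "e b" "e c"] by auto
    have "C (e r) (e a) (e r) (e b)"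
      using isosceles_crossing[OF i, of "e p" "e q" "e r"] h by (simp add: sat_T)
    hence "mid (e x) (e a) (e b)" using isosceles_midpoint[OF i, of "e r" "e x"] h by simp
    hence "C (e a) (e x) (e b) (e x)" unfolding mid_def using cong_flips by blast
    thus "sat (=) B C e (Bet a x b \<^bold>\<and> Cong a x b x)" using h by simp
  qed auto
  have "proves S ?h6 ?D" by (rule proves_existsI[where t = x]) (use g6 in simp)
  hence "proves S ?h5 ?D"
    by (intro proves_exists[OF proves_axiom[OF axiom_pasch g5], of x]) (use side in auto)
  hence "proves S ?h4 ?D"
    by (intro proves_exists[OF proves_axiom[OF axiom_pasch g4], of r]) (use side in auto)
  hence "proves S ?h3 ?D" by (rule proves_extend[OF g2(2)]) (use side in auto)
  hence "proves S ?h2 ?D" by (rule proves_extend[OF g2(1)]) (use side in auto)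
  thus "proves S ?h1 ?D"
    by (intro proves_exists[OF proves_equilateral[OF f], of c]) (use side in auto)
qed simp

lemma euclidean_if_sat_strong_parallel:
  assumes "neutral_plane B C" "sat (=) B C e strong_parallel" shows "euclidean_plane B C"
proof -
  interpret neutral_plane B C by fact
  note s = assms(2)[unfolded strong_parallel_def forall_defs sat.simps sat_geometry, simplified, rule_format]
  show ?thesis by (rule parallel_unique_if_strong_parallel) (use s in blast)
qed

lemma proves_in_euclidean:
  assumes "univ_at False A" "stable_form A"
    and "\<And>B C (e :: nat \<Rightarrow> nat). euclidean_plane B C \<Longrightarrow> \<forall>h\<in>set hs. sat (=) B C e h \<Longrightarrow> sat (=) B C e A"
  shows "proves strong_parallel hs A"
  using assms euclidean_if_sat_strong_parallel by (intro proves_classical) blast+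

lemma proves_strong_parallel_point:
  assumes "proves strong_parallel hs (Bet p t q \<^bold>\<and> Bet s t r \<^bold>\<and> Cong p t q t \<^bold>\<and> Cong r t s t \<^bold>\<and> Neq p r \<^bold>\<and>
     \<^bold>\<not> on p s q \<^bold>\<and> \<^bold>\<not> on a p r)"
  shows "proves strong_parallel hs (meets s q p a)"
proof -
  have "context_of strong_parallel hs \<turnstile> strong_parallel" unfolding context_of_def by (rule deriv.assm) simp
  from strong_parallel_instance[OF this] show ?thesis using assms unfolding proves_def using deriv.impE by blast
qed

lemma strong_parallel_closed: "fv strong_parallel = {}" "univ_at True strong_parallel"
  unfolding strong_parallel_def forall_defs by (auto simp: numeral_eq_Suc)

section \<open>The two implications\<close>

text \<open>
  Classically the negation of \<open>coincide\<close>, but without its negative universal quantifier.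
\<close>

definition differ where
  "differ a b c d = (\<^bold>\<not> \<^bold>\<not> Exists (\<^bold>\<not> (on 0 (Suc a) (Suc b) \<^bold>\<longleftrightarrow> on 0 (Suc c) (Suc d))))"

lemma sat_differ: "sat (=) B C e (differ a b c d) \<longleftrightarrow>
    \<not> (\<forall>x. on_line B x (e a) (e b) \<longleftrightarrow> on_line B x (e c) (e d))"
  unfolding differ_def by (simp add: sat_on) blast
lemma fv_differ [simp]: "fv (differ a b c d) = {a, b, c, d}" unfolding differ_def by auto
lemma univ_at_differ [simp]: "univ_at x (differ a b c d)" unfolding differ_def by simp

lemma fv_parallel [simp]: "fv (parallel a b c d) = {a, b, c, d}" unfolding parallel_def by simp
lemma univ_at_parallel [simp]: "univ_at x (parallel a b c d)" unfolding parallel_def by simp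
lemma ren_parallel [simp]: "ren f (parallel a b c d) = parallel (f a) (f b) (f c) (f d)"
  unfolding parallel_def by simp

text \<open>
  Membership in a line is stable; so if no point distinguishes the lines, they coincide.
\<close>

lemma differ_if_not_coincide:
  assumes n: "neutral \<subseteq> \<Gamma>" and d: "\<Gamma> \<turnstile> \<^bold>\<not> coincide a b c d"
  shows "\<Gamma> \<turnstile> differ a b c d"
  unfolding differ_def
proof (rule deriv.impI)
  let ?A = "on 0 (Suc a) (Suc b) \<^bold>\<longleftrightarrow> on 0 (Suc c) (Suc d)"
  let ?D = "insert (\<^bold>\<not> Exists (\<^bold>\<not> ?A)) \<Gamma>"
  let ?E = "shift ` ?D"
  have nE: "neutral \<subseteq> ?E"
  proof
    fix A assume "A \<in> neutral"
    thus "A \<in> ?E" using n ren_closed[OF neutral_closed, of A Suc] by (intro image_eqI[of _ _ A]) auto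
  qed
  have "insert (\<^bold>\<not> ?A) ?E \<turnstile> shift (Exists (\<^bold>\<not> ?A))"
    by (simp, rule deriv.existsI[where t = 0], rule deriv.assm) simp
  moreover have "insert (\<^bold>\<not> ?A) ?E \<turnstile> shift (\<^bold>\<not> Exists (\<^bold>\<not> ?A))"
    by (rule deriv.assm) blast
  ultimately have "insert (\<^bold>\<not> ?A) ?E \<turnstile> Falsum" using deriv.impE[of _ "shift (Exists (\<^bold>\<not> ?A))" Falsum] by simp
  hence "?E \<turnstile> \<^bold>\<not> \<^bold>\<not> ?A" by (rule deriv.impI)
  hence "?E \<turnstile> ?A" using stable_form_deriv[OF nE] by simp
  hence "?D \<turnstile> coincide a b c d" unfolding coincide_def by (rule deriv.forallI)
  moreover have "?D \<turnstile> \<^bold>\<not> coincide a b c d" using deriv_weaken[OF d] by blast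
  ultimately show "?D \<turnstile> Falsum" using deriv.impE by blast
qed

text \<open>The lines are \<open>L = Line(3,2)\<close> and \<open>M = Line(1,0)\<close>. The other variables are, in the order of their construction:
\<open>4\<close> the reflection of \<open>0\<close> in \<open>1\<close>;
\<open>5\<close> an apex over the base \<open>0 4\<close>, so that \<open>1 5\<close> is perpendicular to \<open>M\<close>;
\<open>6\<close> and \<open>7\<close> points on this perpendicular, opposite to \<open>5\<close>, at distances equal to and greater than that of \<open>3\<close> from \<open>1\<close>;
\<open>8\<close> and \<open>9\<close> the reflections of \<open>1\<close> and \<open>0\<close> in \<open>7\<close>, spanning \<open>W\<close>;
\<open>10\<close> the midpoint of \<open>3 8\<close>, and \<open>11\<close> the reflection of \<open>9\<close> in it;
\<open>12\<close> the point on \<open>W\<close> and \<open>L\<close> that the first application gives, and \<open>13\<close> its reflection in \<open>7\<close>, on \<open>M\<close>;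
\<open>14\<close> and \<open>15\<close> the auxiliary and the final point of the construction of a point of \<open>M\<close> other than \<open>13\<close>, and \<open>16\<close> the
reflection of \<open>15\<close> in \<open>7\<close>;
\<open>17\<close> the point on \<open>M\<close> and \<open>L\<close> that the second application gives.
The facts named \<open>o\<close> are the negative assertions that the next existential step depends on; each is verified classically.\<close>

lemma meets_if_not_parallel:
  "proves strong_parallel [Neq 3 2, Neq 1 0, differ 3 2 1 0, \<^bold>\<not> parallel 3 2 1 0] (meets 1 0 3 2)"
proof -
  let ?P = "proves strong_parallel"
  let ?M = "meets 1 0 3 2"
  let ?h0 = "[Neq 3 2, Neq 1 0, differ 3 2 1 0, \<^bold>\<not> parallel 3 2 1 0]"
  let ?h1 = "(T 0 1 4 \<^bold>\<and> Cong 1 4 1 0) # ?h0"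
  let ?h2 = "(Cong 0 5 0 4 \<^bold>\<and> Cong 4 5 4 0) # ?h1"
  let ?h3 = "(T 5 1 6 \<^bold>\<and> Cong 1 6 1 3) # ?h2"
  let ?h4 = "(T 5 6 7 \<^bold>\<and> Cong 6 7 5 1) # ?h3"
  let ?h5 = "(T 1 7 8 \<^bold>\<and> Cong 7 8 1 7) # ?h4"
  let ?h6 = "(T 0 7 9 \<^bold>\<and> Cong 7 9 0 7) # ?h5"
  let ?h7 = "(Neq 9 8 \<^bold>\<and> \<^bold>\<not> on 7 1 0 \<^bold>\<and> \<^bold>\<not> on 3 9 8) # ?h6"
  let ?h8 = "(Bet 3 10 8 \<^bold>\<and> Cong 3 10 8 10) # ?h7"
  let ?h9 = "(T 9 10 11 \<^bold>\<and> Cong 10 11 9 10) # ?h8"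
  let ?h10 = "(on 12 9 8 \<^bold>\<and> on 12 3 2) # ?h9"
  let ?h11 = "(T 12 7 13 \<^bold>\<and> Cong 7 13 12 7) # ?h10"
  let ?h12 = "(T 0 1 14 \<^bold>\<and> Cong 1 14 1 13) # ?h11"
  let ?h13 = "(T 0 14 15 \<^bold>\<and> Cong 14 15 1 0) # ?h12"
  let ?h14 = "(T 15 7 16 \<^bold>\<and> Cong 7 16 15 7) # ?h13"
  let ?h15 = "(on 17 15 13 \<^bold>\<and> on 17 12 3) # ?h14"
  note s = sat_T sat_on
  have o0: "?P ?h0 (Neq 0 1)" by (rule proves_in_euclidean) auto
  have o1: "?P ?h1 (Neq 0 4)"
  proof (rule proves_in_euclidean)
    fix B :: "nat \<Rightarrow> nat \<Rightarrow> nat \<Rightarrow> bool" and C and e :: "nat \<Rightarrow> nat"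
    assume "euclidean_plane B C" and h: "\<forall>h\<in>set ?h1. sat (=) B C e h"
    then interpret euclidean_plane B C by blast
    show "sat (=) B C e (Neq 0 4)" using double_segment[of "e 1" "e 0" "e 4"] h by (simp add: s)
  qed simp_all
  have o2: "?P ?h2 (Neq 5 1)"
  proof (rule proves_in_euclidean)
    fix B :: "nat \<Rightarrow> nat \<Rightarrow> nat \<Rightarrow> bool" and C and e :: "nat \<Rightarrow> nat"
    assume "euclidean_plane B C" and h: "\<forall>h\<in>set ?h2. sat (=) B C e h"
    then interpret euclidean_plane B C by blast
    show "sat (=) B C e (Neq 5 1)" using apex_ne[of "e 1" "e 0" "e 4" "e 5"] h by (simp add: s)
  qed simp_all
  have o3: "?P ?h3 (Neq 5 6)"
  proof (rule proves_in_euclidean)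
    fix B :: "nat \<Rightarrow> nat \<Rightarrow> nat \<Rightarrow> bool" and C and e :: "nat \<Rightarrow> nat"
    assume "euclidean_plane B C" and h: "\<forall>h\<in>set ?h3. sat (=) B C e h"
    then interpret euclidean_plane B C by blast
    have "e 5 \<noteq> e 1" using apex_ne[of "e 1" "e 0" "e 4" "e 5"] h by (simp add: s)
    thus "sat (=) B C e (Neq 5 6)" using bt_ident[of "e 5" "e 1"] h by (auto simp: s)
  qed simp_all
  have o4: "?P ?h4 (Neq 1 7)"
  proof (rule proves_in_euclidean)
    fix B :: "nat \<Rightarrow> nat \<Rightarrow> nat \<Rightarrow> bool" and C and e :: "nat \<Rightarrow> nat"
    assume "euclidean_plane B C" and h: "\<forall>h\<in>set ?h4. sat (=) B C e h"
    then interpret euclidean_plane B C by blast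
    have "e 5 \<noteq> e 1" using apex_ne[of "e 1" "e 0" "e 4" "e 5"] h by (simp add: s)
    thus "sat (=) B C e (Neq 1 7)" using altitude_ends(3)[of "e 5" "e 1" "e 6" "e 7"] h by (simp add: s)
  qed simp_all
  have far: "\<not> neutral_plane.col B (e 1) (e 0) (e 7) \<and> 
      (neutral_plane.mid B C (e 7) (e 1) (e 8) \<and> neutral_plane.mid B C (e 7) (e 0) (e 9) \<longrightarrow>
       \<not> neutral_plane.col B (e 9) (e 8) (e 3))"
    if "euclidean_plane B C" and h: "\<forall>h\<in>set ?h4. sat (=) B C e h"
    for B :: "nat \<Rightarrow> nat \<Rightarrow> nat \<Rightarrow> bool" and C and e :: "nat \<Rightarrow> nat"
  proof -
    interpret euclidean_plane B C by fact
    obtain w s1 where ws: "mid (e 7) (e 1) w" "mid (e 7) (e 0) s1" using mid_ex by blast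
    have f: "\<not> col (e 1) (e 0) (e 7) \<and> \<not> col s1 w (e 3)" if "mid (e 7) (e 1) w" "mid (e 7) (e 0) s1" for w s1
      using far_parallel[of "e 1" "e 0" "e 4" "e 5" "e 6" "e 3" "e 7" w s1] that h by (simp add: s)
    show ?thesis using f[OF ws] f by blast
  qed
  have o5: "?P ?h5 (Neq 0 7)"
  proof (rule proves_in_euclidean)
    fix B :: "nat \<Rightarrow> nat \<Rightarrow> nat \<Rightarrow> bool" and C and e :: "nat \<Rightarrow> nat"
    assume E: "euclidean_plane B C" and h: "\<forall>h\<in>set ?h5. sat (=) B C e h"
    interpret euclidean_plane B C by fact
    have "\<not> col (e 1) (e 0) (e 7)" using far[OF E, of e] h by simp
    thus "sat (=) B C e (Neq 0 7)" by auto
  qed simp_all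
  have o6: "?P ?h6 (Neq 9 8 \<^bold>\<and> \<^bold>\<not> on 7 1 0 \<^bold>\<and> \<^bold>\<not> on 3 9 8)"
  proof (rule proves_in_euclidean)
    fix B :: "nat \<Rightarrow> nat \<Rightarrow> nat \<Rightarrow> bool" and C and e :: "nat \<Rightarrow> nat"
    assume E: "euclidean_plane B C" and h: "\<forall>h\<in>set ?h6. sat (=) B C e h"
    interpret euclidean_plane B C by fact
    have m: "mid (e 7) (e 1) (e 8)" "mid (e 7) (e 0) (e 9)" and ne: "e 1 \<noteq> e 0"
      using h opposite_point[of "e 1" "e 7" "e 8"] opposite_point[of "e 0" "e 7" "e 9"] by (simp_all add: s)
    have f: "\<not> col (e 1) (e 0) (e 7)" "\<not> col (e 9) (e 8) (e 3)" using far[OF E, of e] h m by simp_all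
    have "e 9 \<noteq> e 8" using reflected_line(1)[OF ne f(1) m] .
    thus "sat (=) B C e (Neq 9 8 \<^bold>\<and> \<^bold>\<not> on 7 1 0 \<^bold>\<and> \<^bold>\<not> on 3 9 8)" using f ne lies_iff by (simp add: s)
  qed simp_all
  have base: "e 1 \<noteq> e 0 \<and> e 3 \<noteq> e 2 \<and> neutral_plane.mid B C (e 7) (e 1) (e 8) \<and> neutral_plane.mid B C (e 7) (e 0) (e 9) \<and>
      \<not> neutral_plane.col B (e 1) (e 0) (e 7) \<and> \<not> neutral_plane.col B (e 9) (e 8) (e 3)"
    if "euclidean_plane B C" and h: "\<forall>h\<in>set ?h7. sat (=) B C e h"
    for B :: "nat \<Rightarrow> nat \<Rightarrow> nat \<Rightarrow> bool" and C and e :: "nat \<Rightarrow> nat"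
  proof -
    interpret euclidean_plane B C by fact
    have n: "e 1 \<noteq> e 0" "e 3 \<noteq> e 2" "e 9 \<noteq> e 8" using h by simp_all
    have "mid (e 7) (e 1) (e 8)" "mid (e 7) (e 0) (e 9)" by (rule opposite_point; use h in \<open>simp add: s\<close>)+
    thus ?thesis using n h lies_iff[OF n(1)] lies_iff[OF n(3)] by (simp add: s)
  qed
  have o7: "?P ?h7 (Neq 3 8)"
  proof (rule proves_in_euclidean)
    fix B :: "nat \<Rightarrow> nat \<Rightarrow> nat \<Rightarrow> bool" and C and e :: "nat \<Rightarrow> nat"
    assume E: "euclidean_plane B C" and h: "\<forall>h\<in>set ?h7. sat (=) B C e h"
    interpret euclidean_plane B C by fact
    show "sat (=) B C e (Neq 3 8)" using base[OF E h] by auto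
  qed simp_all
  have first: "e 9 \<noteq> e 10 \<and> (neutral_plane.mid B C (e 10) (e 9) (e 11) \<longrightarrow> 
      B (e 3) (e 10) (e 8) \<and> B (e 9) (e 10) (e 11) \<and> e 3 \<noteq> e 11 \<and> \<not> on_line B (e 3) (e 9) (e 8) \<and> 
      \<not> on_line B (e 2) (e 3) (e 11))"
    if E: "euclidean_plane B C" and h: "\<forall>h\<in>set ?h8. sat (=) B C e h"
    for B :: "nat \<Rightarrow> nat \<Rightarrow> nat \<Rightarrow> bool" and C and e :: "nat \<Rightarrow> nat"
  proof -
    interpret euclidean_plane B C by fact
    have b: "e 1 \<noteq> e 0" "e 3 \<noteq> e 2" "mid (e 7) (e 1) (e 8)" "mid (e 7) (e 0) (e 9)"
      "\<not> col (e 1) (e 0) (e 7)" "\<not> col (e 9) (e 8) (e 3)" using base[OF E, of e] h by simp_all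
    have u: "mid (e 10) (e 3) (e 8)" 
      unfolding mid_def using h bet_iff[of "e 3" "e 10" "e 8"] cong_flip2[of "e 3" "e 10" "e 8" "e 10"] by simp
    have a: "\<not> (\<forall>x. lies x (e 3) (e 2) \<longleftrightarrow> lies x (e 1) (e 0))"
      and m: "\<exists>x. lies x (e 3) (e 2) \<and> lies x (e 1) (e 0)"
      using h by (simp_all add: sat_differ parallel_def sat_meets)
    note F = first_application[OF b(2,1) a m b(5,3,4,6) u]
    obtain r where "mid (e 10) (e 9) r" using mid_ex by blast
    thus ?thesis using F by blast
  qed
  have o8: "?P ?h8 (Neq 9 10)"
  proof (rule proves_in_euclidean)
    fix B :: "nat \<Rightarrow> nat \<Rightarrow> nat \<Rightarrow> bool" and C and e :: "nat \<Rightarrow> nat"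
    assume E: "euclidean_plane B C" and h: "\<forall>h\<in>set ?h8. sat (=) B C e h"
    show "sat (=) B C e (Neq 9 10)" using first[OF E h] by simp
  qed simp_all
  have o9: "?P ?h9 (Bet 3 10 8 \<^bold>\<and> Bet 9 10 11 \<^bold>\<and> Cong 3 10 8 10 \<^bold>\<and> Cong 11 10 9 10 \<^bold>\<and> Neq 3 11 \<^bold>\<and>
     \<^bold>\<not> on 3 9 8 \<^bold>\<and> \<^bold>\<not> on 2 3 11)"
  proof (rule proves_in_euclidean)
    fix B :: "nat \<Rightarrow> nat \<Rightarrow> nat \<Rightarrow> bool" and C and e :: "nat \<Rightarrow> nat"
    assume E: "euclidean_plane B C" and h: "\<forall>h\<in>set ?h9. sat (=) B C e h"
    interpret euclidean_plane B C by fact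
    have "mid (e 10) (e 9) (e 11)" using h opposite_point[of "e 9" "e 10" "e 11"] by (simp add: s)
    moreover have "C (e 11) (e 10) (e 9) (e 10)" using h cong_flip1[of "e 10" "e 11"] by simp
    ultimately show "sat (=) B C e (Bet 3 10 8 \<^bold>\<and> Bet 9 10 11 \<^bold>\<and> Cong 3 10 8 10 \<^bold>\<and> Cong 11 10 9 10 \<^bold>\<and> Neq 3 11 \<^bold>\<and>
     \<^bold>\<not> on 3 9 8 \<^bold>\<and> \<^bold>\<not> on 2 3 11)" using first[OF E, of e] h by (simp add: s)
  qed simp_all
  have o10: "?P ?h10 (Neq 12 7)"
  proof (rule proves_in_euclidean)
    fix B :: "nat \<Rightarrow> nat \<Rightarrow> nat \<Rightarrow> bool" and C and e :: "nat \<Rightarrow> nat"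
    assume E: "euclidean_plane B C" and h: "\<forall>h\<in>set ?h10. sat (=) B C e h"
    interpret euclidean_plane B C by fact
    show "sat (=) B C e (Neq 12 7)"
      using base[OF E, of e] h center_off_parallel[of "e 1" "e 0" "e 7" "e 8" "e 9" "e 12"] by (simp add: s)
  qed simp_all
  have o11: "?P ?h11 (Neq 0 1)" by (rule proves_in_euclidean) auto
  have o12: "?P ?h12 (Neq 0 14)"
  proof (rule proves_in_euclidean)
    fix B :: "nat \<Rightarrow> nat \<Rightarrow> nat \<Rightarrow> bool" and C and e :: "nat \<Rightarrow> nat"
    assume E: "euclidean_plane B C" and h: "\<forall>h\<in>set ?h12. sat (=) B C e h"
    interpret euclidean_plane B C by fact
    have "wbet B (e 0) (e 1) (e 14)" "e 1 \<noteq> e 0" using h by (simp_all add: s)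
    hence "e 0 \<noteq> e 14" using bt_ident[of "e 0" "e 1"] by metis
    thus "sat (=) B C e (Neq 0 14)" by simp
  qed simp_all
  have second: "e 15 \<noteq> e 7 \<and> (neutral_plane.mid B C (e 7) (e 15) (e 16) \<longrightarrow>
      B (e 12) (e 7) (e 13) \<and> B (e 15) (e 7) (e 16) \<and> e 12 \<noteq> e 16 \<and> \<not> on_line B (e 12) (e 15) (e 13) \<and>
      \<not> on_line B (e 3) (e 12) (e 16) \<and> 
      (on_line B (e 17) (e 15) (e 13) \<longrightarrow> on_line B (e 17) (e 12) (e 3) \<longrightarrow> 
       on_line B (e 17) (e 1) (e 0) \<and> on_line B (e 17) (e 3) (e 2)))"
    if E: "euclidean_plane B C" and h: "\<forall>h\<in>set ?h13. sat (=) B C e h"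
    for B :: "nat \<Rightarrow> nat \<Rightarrow> nat \<Rightarrow> bool" and C and e :: "nat \<Rightarrow> nat"
  proof -
    interpret euclidean_plane B C by fact
    have b: "e 1 \<noteq> e 0" "e 3 \<noteq> e 2" "mid (e 7) (e 1) (e 8)" "mid (e 7) (e 0) (e 9)"
      "\<not> col (e 1) (e 0) (e 7)" "\<not> col (e 9) (e 8) (e 3)" using base[OF E, of e] h by simp_all
    have q: "mid (e 7) (e 12) (e 13)" using h opposite_point[of "e 12" "e 7" "e 13"] by (simp add: s)
    have p: "lies (e 12) (e 9) (e 8)" "lies (e 12) (e 3) (e 2)" using h by (simp_all add: s)
    have z: "e 15 \<noteq> e 13" "col (e 1) (e 0) (e 15)"
      using second_point[OF b(1), of "e 14" "e 13" "e 15"] h by (simp_all add: s)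
    note S = second_application[OF b(2,1,5,3,4,6) p q z(2,1)]
    obtain r where "mid (e 7) (e 15) r" using mid_ex by blast
    thus ?thesis using S by blast
  qed
  have o13: "?P ?h13 (Neq 15 7)"
  proof (rule proves_in_euclidean)
    fix B :: "nat \<Rightarrow> nat \<Rightarrow> nat \<Rightarrow> bool" and C and e :: "nat \<Rightarrow> nat"
    assume E: "euclidean_plane B C" and h: "\<forall>h\<in>set ?h13. sat (=) B C e h"
    show "sat (=) B C e (Neq 15 7)" using second[OF E h] by simp
  qed simp_all
  have o14: "?P ?h14 (Bet 12 7 13 \<^bold>\<and> Bet 15 7 16 \<^bold>\<and> Cong 12 7 13 7 \<^bold>\<and> Cong 16 7 15 7 \<^bold>\<and> Neq 12 16 \<^bold>\<and>
     \<^bold>\<not> on 12 15 13 \<^bold>\<and> \<^bold>\<not> on 3 12 16)"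
  proof (rule proves_in_euclidean)
    fix B :: "nat \<Rightarrow> nat \<Rightarrow> nat \<Rightarrow> bool" and C and e :: "nat \<Rightarrow> nat"
    assume E: "euclidean_plane B C" and h: "\<forall>h\<in>set ?h14. sat (=) B C e h"
    interpret euclidean_plane B C by fact
    have "mid (e 7) (e 15) (e 16)" using h opposite_point[of "e 15" "e 7" "e 16"] by (simp add: s)
    moreover have "C (e 16) (e 7) (e 15) (e 7)" using h cong_flip1[of "e 7" "e 16"] by simp
    moreover have "C (e 7) (e 13) (e 12) (e 7)" using h by simp
    hence "C (e 12) (e 7) (e 13) (e 7)" using cong_sym cong_flip2 by blast
    ultimately show "sat (=) B C e (Bet 12 7 13 \<^bold>\<and> Bet 15 7 16 \<^bold>\<and> Cong 12 7 13 7 \<^bold>\<and> Cong 16 7 15 7 \<^bold>\<and> Neq 12 16 \<^bold>\<and>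
     \<^bold>\<not> on 12 15 13 \<^bold>\<and> \<^bold>\<not> on 3 12 16)" using second[OF E, of e] h by (simp add: s)
  qed simp_all
  have o15: "?P ?h15 (on 17 1 0 \<^bold>\<and> on 17 3 2)"
  proof (rule proves_in_euclidean)
    fix B :: "nat \<Rightarrow> nat \<Rightarrow> nat \<Rightarrow> bool" and C and e :: "nat \<Rightarrow> nat"
    assume E: "euclidean_plane B C" and h: "\<forall>h\<in>set ?h15. sat (=) B C e h"
    interpret euclidean_plane B C by fact
    have "mid (e 7) (e 15) (e 16)" using h opposite_point[of "e 15" "e 7" "e 16"] by (simp add: s)
    thus "sat (=) B C e (on 17 1 0 \<^bold>\<and> on 17 3 2)" using second[OF E, of e] h by (simp add: s)
  qed simp_all
  \<comment> \<open>The witnesses are discharged in reverse order of their construction.\<close>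
  have "?P ?h15 ?M" unfolding meets_def by (rule proves_existsI[where t = 17]) (use o15 in simp)
  hence "?P ?h14 ?M"
    by (intro proves_exists[OF proves_strong_parallel_point[OF o14, unfolded meets_def], of 17]) auto
  hence "?P ?h13 ?M" by (rule proves_extend[OF o13]) auto
  hence "?P ?h12 ?M" by (rule proves_extend[OF o12]) auto
  hence "?P ?h11 ?M" by (rule proves_extend[OF o11]) auto
  hence "?P ?h10 ?M" by (rule proves_extend[OF o10]) auto
  hence "?P ?h9 ?M"
    by (intro proves_exists[OF proves_strong_parallel_point[OF o9, unfolded meets_def], of 12]) auto
  hence "?P ?h8 ?M" by (rule proves_extend[OF o8]) auto
  hence "?P ?h7 ?M" by (intro proves_exists[OF proves_midpoint[OF o7], of 10]) auto
  hence "?P ?h6 ?M" by (rule proves_cut[OF o6, rotated]) auto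
  hence "?P ?h5 ?M" by (rule proves_extend[OF o5]) auto
  hence "?P ?h4 ?M" by (rule proves_extend[OF o4]) auto
  hence "?P ?h3 ?M" by (rule proves_extend[OF o3]) auto
  hence "?P ?h2 ?M" by (rule proves_extend[OF o2]) auto
  hence "?P ?h1 ?M" by (intro proves_exists[OF proves_equilateral[OF o1], of 5]) auto
  thus "?P ?h0 ?M" by (rule proves_extend[OF o0]) auto
qed

lemma admissibleI: "fv S = {} \<Longrightarrow> univ_at True S \<Longrightarrow> (\<And>h. h \<in> set hs \<Longrightarrow> univ_at True h) \<Longrightarrow>
    context_of S hs \<turnstile> Neq a b \<Longrightarrow> admissible S hs"
  unfolding admissible_def by blast

lemma nonparallel_meet_if_strong_parallel: "insert strong_parallel neutral \<turnstile> nonparallel_meet"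
  unfolding nonparallel_meet_def forall_defs
proof (intro deriv.forallI deriv.impI)
  let ?G = "insert strong_parallel neutral"
  let ?A = "Neq 3 2 \<^bold>\<and> Neq 1 0 \<^bold>\<and> \<^bold>\<not> coincide 3 2 1 0 \<^bold>\<and> \<^bold>\<not> parallel 3 2 1 0"
  have G: "shift ` ?G = ?G" by (rule shift_closed) (use neutral_closed strong_parallel_closed in auto)
  let ?H = "insert ?A ?G"
  have a: "?H \<turnstile> ?A" by (rule deriv.assm) simp
  have c: "?H \<turnstile> Neq 3 2" "?H \<turnstile> Neq 1 0" "?H \<turnstile> \<^bold>\<not> coincide 3 2 1 0" "?H \<turnstile> \<^bold>\<not> parallel 3 2 1 0"
    using a deriv.conjE1 deriv.conjE2 by blast+
  have ap: "?H \<turnstile> differ 3 2 1 0" by (rule differ_if_not_coincide[OF _ c(3)]) blast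
  let ?h0 = "[Neq 3 2, Neq 1 0, differ 3 2 1 0, \<^bold>\<not> parallel 3 2 1 0]"
  have "admissible strong_parallel ?h0"
    by (rule admissibleI[OF strong_parallel_closed, where a = 3 and b = 2])
      (auto simp: context_of_def intro: deriv.assm)
  hence "context_of strong_parallel ?h0 \<turnstile> meets 1 0 3 2"
    using meets_if_not_parallel unfolding proves_def by blast
  hence m: "insert (Neq 3 2) (insert (Neq 1 0) (insert (differ 3 2 1 0) (insert (\<^bold>\<not> parallel 3 2 1 0) ?H))) \<turnstile> meets 1 0 3 2"
    by (rule deriv_weaken) (auto simp: context_of_def)
  have "?H \<turnstile> meets 1 0 3 2"
    by (rule deriv_cut[OF c(4)], rule deriv_cut[OF deriv_weaken[OF ap]], blast,
      rule deriv_cut[OF deriv_weaken[OF c(2)]], blast, rule deriv_cut[OF deriv_weaken[OF c(1)]], blast, rule m)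
  thus "insert ?A (shift ` shift ` shift ` shift ` ?G) \<turnstile> meets 1 0 3 2" unfolding G .
qed

lemma playfair_if_strong_parallel: "insert strong_parallel neutral \<turnstile> playfair"
  unfolding playfair_def forall_defs coincide_def
proof (intro deriv.forallI deriv.impI)
  let ?G = "insert strong_parallel neutral"
  have G: "shift ` ?G = ?G" by (rule shift_closed) (use neutral_closed strong_parallel_closed in auto)
  let ?A = "Neq 7 6 \<^bold>\<and> Neq 5 4 \<^bold>\<and> Neq 3 2 \<^bold>\<and> parallel 7 6 5 4 \<^bold>\<and> parallel 3 2 5 4 \<^bold>\<and> on 1 7 6 \<^bold>\<and> on 1 3 2"
  let ?D = "on 0 7 6 \<^bold>\<longleftrightarrow> on 0 3 2"
  have "proves strong_parallel [?A] ?D"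
  proof (rule proves_in_euclidean)
    fix B :: "nat \<Rightarrow> nat \<Rightarrow> nat \<Rightarrow> bool" and C and e :: "nat \<Rightarrow> nat"
    assume E: "euclidean_plane B C" and h: "\<forall>h\<in>set [?A]. sat (=) B C e h"
    interpret euclidean_plane B C by fact
    show "sat (=) B C e ?D"
      using playfair_holds[of "e 7" "e 6" "e 5" "e 4" "e 3" "e 2" "e 1" "e 0"] h
      by (simp add: sat_on parallel_def sat_meets)
  qed simp_all
  moreover have "admissible strong_parallel [?A]"
    by (rule admissibleI[OF strong_parallel_closed, where a = 7 and b = 6])
      (auto simp: context_of_def intro: deriv.conjE1[OF deriv.assm])
  ultimately have d: "insert ?A ?G \<turnstile> ?D" unfolding proves_def context_of_def by (simp add: insert_commute)
  let ?Q = "Neq 6 5 \<^bold>\<and> Neq 4 3 \<^bold>\<and> Neq 2 1 \<^bold>\<and> parallel 6 5 4 3 \<^bold>\<and> parallel 2 1 4 3 \<^bold>\<and> on 0 6 5 \<^bold>\<and> on 0 2 1"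
  have Q: "shift ?Q = ?A" by (simp add: numeral_2_eq_2[symmetric])
  have A: "shift ` insert ?Q ?G = insert ?A ?G" using image_insert[of shift ?Q ?G, unfolded G Q] .
  have D: "(on 0 (Suc 6) (Suc 5) \<^bold>\<longleftrightarrow> on 0 (Suc 2) (Suc 1)) = ?D" by (simp add: numeral_2_eq_2[symmetric])
  show "shift ` insert ?Q (shift ` shift ` shift ` shift ` shift ` shift ` shift ` ?G) \<turnstile>
      (on 0 (Suc 6) (Suc 5) \<^bold>\<longleftrightarrow> on 0 (Suc 2) (Suc 1))"
    unfolding G A D by (rule d)
qed

lemma strong_parallel_converse: "insert (playfair \<^bold>\<and> nonparallel_meet) neutral \<turnstile> strong_parallel"
  unfolding strong_parallel_def forall_defs
proof (intro deriv.forallI deriv.impI)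
  let ?S = "playfair \<^bold>\<and> nonparallel_meet"
  let ?G = "insert ?S neutral"
  have S: "fv ?S = {}" "univ_at True ?S"
    unfolding playfair_def nonparallel_meet_def forall_defs by (auto simp: numeral_eq_Suc)
  have G: "shift ` ?G = ?G" by (rule shift_closed) (use neutral_closed S(1) in auto)
  let ?A = "Bet 5 1 4 \<^bold>\<and> Bet 2 1 3 \<^bold>\<and> Cong 5 1 4 1 \<^bold>\<and> Cong 3 1 2 1 \<^bold>\<and> Neq 5 3 \<^bold>\<and>
     \<^bold>\<not> on 5 2 4 \<^bold>\<and> \<^bold>\<not> on 0 5 3"
  let ?D = "Neq 5 0 \<^bold>\<and> Neq 2 4 \<^bold>\<and> \<^bold>\<not> coincide 5 0 2 4 \<^bold>\<and> \<^bold>\<not> parallel 5 0 2 4"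
  have "proves ?S [?A] ?D"
  proof (rule proves_classical)
    fix B :: "nat \<Rightarrow> nat \<Rightarrow> nat \<Rightarrow> bool" and C and e :: "nat \<Rightarrow> nat"
    assume n: "neutral_plane B C" and p: "sat (=) B C e ?S" and h: "\<forall>h\<in>set [?A]. sat (=) B C e h"
    interpret neutral_plane B C by fact
    have p: "sat (=) B C e playfair" using p by simp
    note pl = p[unfolded playfair_def forall_defs sat.simps parallel_def sat_geometry, simplified, rule_format]
    interpret euclidean_plane B C by (rule euclidean_if_playfair) (use pl in blast)
    show "sat (=) B C e ?D"
      using strong_parallel_lines[of "e 5" "e 1" "e 4" "e 2" "e 3" "e 0"] h
      by (simp add: sat_on parallel_def sat_meets sat_coincide)
  qed (simp_all add: parallel_def)
  moreover have "admissible ?S [?A]"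
  proof (rule admissibleI[OF S, where a = 5 and b = 3])
    have "context_of ?S [?A] \<turnstile> ?A" by (rule deriv.assm) (simp add: context_of_def)
    from deriv.conjE1[OF deriv.conjE2[OF deriv.conjE2[OF deriv.conjE2[OF deriv.conjE2[OF this]]]]]
    show "context_of ?S [?A] \<turnstile> Neq 5 3" .
  qed simp
  ultimately have d: "insert ?A ?G \<turnstile> ?D" unfolding proves_def context_of_def by (simp add: insert_commute)
  have "insert ?A ?G \<turnstile> nonparallel_meet" 
    by (rule deriv.conjE2[of _ playfair], rule deriv.assm) simp
  hence "insert ?A ?G \<turnstile> meets 2 4 5 0" by (rule deriv.impE[OF nonparallel_meet_instance d])
  thus "insert ?A (shift ` shift ` shift ` shift ` shift ` shift ` ?G) \<turnstile> meets 2 4 5 0" unfolding G .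
qed

theorem lemma6p12:
  "neutral \<turnstile> (strong_parallel \<^bold>\<longleftrightarrow> playfair \<^bold>\<and> nonparallel_meet)"
  using deriv.conjI[OF deriv.impI[OF deriv.conjI[OF playfair_if_strong_parallel
    nonparallel_meet_if_strong_parallel]] deriv.impI[OF strong_parallel_converse]] .

end
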